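(* Given an input graph $G=(V,E,\vec{W})$ with $n$ vertices and $m$ edges and privacy parameters $\varepsilon,\delta>0$, the One-Pass Private Kruskal algorithm (defined in the context) runs in $O(m + n\log n)$ time, is $(\varepsilon,\delta)$-differentially private, and returns an approximately minimum spanning tree $\mathcal{M}(G)$ such that, if $T^*$ is a minimum spanning tree of $G$, $$\mathbb{E}\left[\sum_{e \in \mathcal{M}(G)} w_e\right] - \sum_{e\in T^*} w_e \in O\left(\frac{1}{\varepsilon}\cdot n^{3/2}\cdot \log n\cdot\sqrt{\log(1/\delta)}\right).$$
   Context: A graph $G = (V, E, \vec{W})$ has public vertex set $V=\{1,\dots,n\}$, public undirected edge set $E$ with $|E|=m$, and private weights $\vec{W}=(w_e)_{e\in E}\in\mathbb{R}^E$. Two graphs are neighboring if they have the same $V$ and $E$ and $\max_{e\in E}|w_e-w'_e|\le 1$. A randomized algorithm $\mathcal{M}$ outputting spanning trees is $(\varepsilon,\delta)$-differentially private if for all neighboring $G,G'$ and every set $Z$ of spanning trees, $\Pr[\mathcal{M}(G)\in Z]\le e^{\varepsilon}\Pr[\mathcal{M}(G')\in Z]+\delta$. $\mathrm{Exp}(1)$ denotes the exponential distribution with density $e^{-x}$ on $x\ge 0$. The One-Pass Private Kruskal algorithm on input $G$ and $(\varepsilon,\delta)$: set $\rho = \left(\sqrt{\varepsilon+\log(1/\delta)}-\sqrt{\log(1/\delta)}\right)^2$ and $\varepsilon' = \sqrt{2\rho/(n-1)}$; initialize $T\leftarrow\emptyset$, $F\leftarrow E$; for each $e\in E$ independently set $\tilde{w}_e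 = X_e / e^{-\frac{\varepsilon'}{2} w_e}$ with $X_e\sim\mathrm{Exp}(1)$; for $i=1,\dots,n-1$: let $e=\arg\min_{e\in F}\tilde{w}_e$, set $T\leftarrow T\cup\{e\}$, and set $F\leftarrow F\setminus\{e'\in F:\{e'\}\cup T\text{ contains a cycle}\}$; return $T$.
   Formalization: The utility bound is stated for δ < 1 and ε ≤ K·log(1/δ), with a constant depending only on K (any K > 0); for δ ≥ 1, or uniformly as δ → 1, the stated bound is undefined or false. *)

theory Defs
  imports "HOL-Probability.Probability"
begin

section \<open>Graphs, spanning trees, and edge weights\<close>

text \<open>A graph on the vertices 1, ..., n is simple and undirected: an edge is a two-element set
  of vertices. A weight function is total on \<^typ>\<open>nat set\<close>, but only its values on the edge set
  are ever used.\<close>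

type_synonym edge = "nat set"

definition contains_cycle :: "edge set \<Rightarrow> bool" where
  "contains_cycle F \<longleftrightarrow> (\<exists>vs. 3 \<le> length vs \<and> distinct vs \<and>
     (\<forall>i < length vs. {vs ! i, vs ! (Suc i mod length vs)} \<in> F))"

definition connects :: "nat set \<Rightarrow> edge set \<Rightarrow> bool" where
  "connects V F \<longleftrightarrow> (\<forall>u\<in>V. \<forall>v\<in>V. (u, v) \<in> {(x, y). {x, y} \<in> F}\<^sup>*)"

definition connected_graph :: "nat \<Rightarrow> edge set \<Rightarrow> bool" where
  "connected_graph n E \<longleftrightarrow> 1 \<le> n \<and> E \<subseteq> {e. e \<subseteq> {1..n} \<and> card e = 2} \<and> connects {1..n} E"

definition spanning_tree :: "nat \<Rightarrow> edge set \<Rightarrow> edge set \<Rightarrow> bool" where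
  "spanning_tree n E T \<longleftrightarrow> T \<subseteq> E \<and> connects {1..n} T \<and> \<not> contains_cycle T"

definition minimum_spanning_tree :: "nat \<Rightarrow> edge set \<Rightarrow> (edge \<Rightarrow> real) \<Rightarrow> edge set \<Rightarrow> bool" where
  "minimum_spanning_tree n E w T \<longleftrightarrow>
     spanning_tree n E T \<and> (\<forall>T'. spanning_tree n E T' \<longrightarrow> sum w T \<le> sum w T')"


section \<open>Differential privacy\<close>

text \<open>The vertex and edge sets are public, so neighboring graphs differ in their weights only. The
  pointwise form of the maximum also covers the graph without edges.\<close>

definition neighboring :: "edge set \<Rightarrow> (edge \<Rightarrow> real) \<Rightarrow> (edge \<Rightarrow> real) \<Rightarrow> bool" where
  "neighboring E w w' \<longleftrightarrow> (\<forall>e\<in>E. \<bar>w e - w' e\<bar> \<le> 1)"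

definition differentially_private ::
  "nat \<Rightarrow> edge set \<Rightarrow> real \<Rightarrow> real \<Rightarrow> ((edge \<Rightarrow> real) \<Rightarrow> edge set measure) \<Rightarrow> bool" where
  "differentially_private n E \<epsilon> \<delta> M \<longleftrightarrow>
     (\<forall>w w' Z. neighboring E w w' \<longrightarrow> Z \<subseteq> {T. spanning_tree n E T} \<longrightarrow>
        measure (M w) Z \<le> exp \<epsilon> * measure (M w') Z + \<delta>)"


section \<open>The One-Pass Private Kruskal algorithm\<close>

definition priv_rho :: "real \<Rightarrow> real \<Rightarrow> real" where
  "priv_rho \<epsilon> \<delta> = (sqrt (\<epsilon> + ln (1 / \<delta>)) - sqrt (ln (1 / \<delta>)))\<^sup>2"

definition step_eps :: "nat \<Rightarrow> real \<Rightarrow> real \<Rightarrow> real" where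
  "step_eps n \<epsilon> \<delta> = sqrt (2 * priv_rho \<epsilon> \<delta> / (real n - 1))"

definition noisy_weight ::
  "nat \<Rightarrow> real \<Rightarrow> real \<Rightarrow> (edge \<Rightarrow> real) \<Rightarrow> (edge \<Rightarrow> real) \<Rightarrow> edge \<Rightarrow> real" where
  "noisy_weight n \<epsilon> \<delta> w X e = X e / exp (- (step_eps n \<epsilon> \<delta> / 2) * w e)"

text \<open>The state after i iterations of the loop is the pair (T, F). The edge that has just been
  selected leaves F explicitly: together with T it forms no cycle in the set-theoretic sense, so
  the cycle test alone would not discard it.\<close>

primrec kruskal_state :: "edge set \<Rightarrow> (edge \<Rightarrow> real) \<Rightarrow> nat \<Rightarrow> edge set \<times> edge set" where
  "kruskal_state E wt 0 = ({}, E)"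
| "kruskal_state E wt (Suc i) =
     (let (T, F) = kruskal_state E wt i;
          e = arg_min_on wt F;
          T' = insert e T
      in (T', F - {e} - {e' \<in> F. contains_cycle (insert e' T')}))"

definition opk_tree ::
  "nat \<Rightarrow> edge set \<Rightarrow> real \<Rightarrow> real \<Rightarrow> (edge \<Rightarrow> real) \<Rightarrow> (edge \<Rightarrow> real) \<Rightarrow> edge set" where
  "opk_tree n E \<epsilon> \<delta> w X = fst (kruskal_state E (noisy_weight n \<epsilon> \<delta> w X) (n - 1))"

definition opk :: "nat \<Rightarrow> edge set \<Rightarrow> real \<Rightarrow> real \<Rightarrow> (edge \<Rightarrow> real) \<Rightarrow> edge set measure" where
  "opk n E \<epsilon> \<delta> w =
     distr (Pi\<^sub>M E (\<lambda>_. density lborel (exponential_density 1))) (count_space UNIV)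
       (opk_tree n E \<epsilon> \<delta> w)"


section \<open>Running time: a real RAM\<close>

text \<open>Running time is measured on a real RAM, presented as a structured language over named arrays
  of unbounded length (a register is an array of which only cell 0 is used). Naturals serve as
  counters and addresses and support only addition and truncated subtraction. Reals are exact; they
  can be compared but not rounded to naturals, and the only constants are naturals. One command
  draws a fresh sample of the exponential distribution. Every assignment, sampling command and
  evaluation of a test costs one unit; expressions have no loops, so for a fixed program this agrees
  with counting single operations up to a constant factor.\<close>

datatype nexp =
    NConst nat
  | NRead string nexp
  | NAdd nexp nexp
  | NSub nexp nexp

datatype rexp =
    ROfNat nexp
  | RRead string nexp
  | RAdd rexp rexp
  | RSub rexp rexp
  | RMul rexp rexp
  | RDiv rexp rexp
  | RSqrt rexp
  | RExp rexp
  | RLn rexp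

datatype bexp =
    NLess nexp nexp
  | RLess rexp rexp
  | BNot bexp
  | BAnd bexp bexp

datatype com =
    Skip
  | NWrite string nexp nexp
  | RWrite string nexp rexp
  | Sample string nexp
  | Seq com com
  | If bexp com com
  | While bexp com

record store =
  nats :: "string \<Rightarrow> nat \<Rightarrow> nat"
  reals :: "string \<Rightarrow> nat \<Rightarrow> real"
  drawn :: nat  \<comment> \<open>number of samples drawn so far\<close>

primrec nval :: "nexp \<Rightarrow> store \<Rightarrow> nat" where
  "nval (NConst k) s = k"
| "nval (NRead a i) s = nats s a (nval i s)"
| "nval (NAdd x y) s = nval x s + nval y s"
| "nval (NSub x y) s = nval x s - nval y s"

primrec rval :: "rexp \<Rightarrow> store \<Rightarrow> real" where
  "rval (ROfNat x) s = real (nval x s)"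
| "rval (RRead a i) s = reals s a (nval i s)"
| "rval (RAdd x y) s = rval x s + rval y s"
| "rval (RSub x y) s = rval x s - rval y s"
| "rval (RMul x y) s = rval x s * rval y s"
| "rval (RDiv x y) s = rval x s / rval y s"
| "rval (RSqrt x) s = sqrt (rval x s)"
| "rval (RExp x) s = exp (rval x s)"
| "rval (RLn x) s = ln (rval x s)"

primrec bval :: "bexp \<Rightarrow> store \<Rightarrow> bool" where
  "bval (NLess x y) s \<longleftrightarrow> nval x s < nval y s"
| "bval (RLess x y) s \<longleftrightarrow> rval x s < rval y s"
| "bval (BNot b) s \<longleftrightarrow> \<not> bval b s"
| "bval (BAnd b c) s \<longleftrightarrow> bval b s \<and> bval c s"

definition nat_write :: "string \<Rightarrow> nat \<Rightarrow> nat \<Rightarrow> store \<Rightarrow> store" where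
  "nat_write a i x s = s\<lparr>nats := (nats s)(a := (nats s a)(i := x))\<rparr>"

definition real_write :: "string \<Rightarrow> nat \<Rightarrow> real \<Rightarrow> store \<Rightarrow> store" where
  "real_write a i x s = s\<lparr>reals := (reals s)(a := (reals s a)(i := x))\<rparr>"

text \<open>\<open>exec \<omega> c s t s'\<close>: started in store s, the command c halts in store s' after t steps, where
  \<open>\<omega> k\<close> is the outcome of the k-th sample (counting from 0).\<close>

inductive exec :: "(nat \<Rightarrow> real) \<Rightarrow> com \<Rightarrow> store \<Rightarrow> nat \<Rightarrow> store \<Rightarrow> bool" for \<omega> where
  Skip: "exec \<omega> Skip s 1 s"
| NWrite: "exec \<omega> (NWrite a i x) s 1 (nat_write a (nval i s) (nval x s) s)"
| RWrite: "exec \<omega> (RWrite a i x) s 1 (real_write a (nval i s) (rval x s) s)"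
| Sample: "exec \<omega> (Sample a i) s 1
             ((real_write a (nval i s) (\<omega> (drawn s)) s)\<lparr>drawn := Suc (drawn s)\<rparr>)"
| Seq: "exec \<omega> c1 s t1 s' \<Longrightarrow> exec \<omega> c2 s' t2 s'' \<Longrightarrow> exec \<omega> (Seq c1 c2) s (t1 + t2) s''"
| IfTrue: "bval b s \<Longrightarrow> exec \<omega> c1 s t s' \<Longrightarrow> exec \<omega> (If b c1 c2) s (1 + t) s'"
| IfFalse: "\<not> bval b s \<Longrightarrow> exec \<omega> c2 s t s' \<Longrightarrow> exec \<omega> (If b c1 c2) s (1 + t) s'"
| WhileFalse: "\<not> bval b s \<Longrightarrow> exec \<omega> (While b c) s 1 s"
| WhileTrue: "bval b s \<Longrightarrow> exec \<omega> c s t1 s' \<Longrightarrow> exec \<omega> (While b c) s' t2 s'' \<Longrightarrow>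
                exec \<omega> (While b c) s (1 + t1 + t2) s''"

text \<open>The graph is given to a program as a list of edges, each with its two endpoints in either
  order; all memory not holding input is zero.\<close>

definition undirected :: "nat \<times> nat \<Rightarrow> edge" where
  "undirected p = {fst p, snd p}"

definition edge_listing :: "(nat \<times> nat) list \<Rightarrow> edge set \<Rightarrow> bool" where
  "edge_listing es E \<longleftrightarrow> distinct (map undirected es) \<and> set (map undirected es) = E"

definition input_store ::
  "nat \<Rightarrow> (nat \<times> nat) list \<Rightarrow> (edge \<Rightarrow> real) \<Rightarrow> real \<Rightarrow> real \<Rightarrow> store" where
  "input_store n es w \<epsilon> \<delta> =
     \<lparr>nats = (\<lambda>a i.
        if a = ''n'' \<and> i = 0 then n
        else if a = ''m'' \<and> i = 0 then length es
        else if a = ''src'' \<and> i < length es then fst (es ! i)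
        else if a = ''dst'' \<and> i < length es then snd (es ! i)
        else 0),
      reals = (\<lambda>a i.
        if a = ''eps'' \<and> i = 0 then \<epsilon>
        else if a = ''delta'' \<and> i = 0 then \<delta>
        else if a = ''w'' \<and> i < length es then w (undirected (es ! i))
        else 0),
      drawn = 0\<rparr>"

text \<open>The output tree is read off a flag for each position of the edge list.\<close>

definition output_tree :: "(nat \<times> nat) list \<Rightarrow> store \<Rightarrow> edge set" where
  "output_tree es s = {undirected (es ! i) | i. i < length es \<and> nats s ''out'' i \<noteq> 0}"

text \<open>A program implements the algorithm within the step bound B, a function of n and m, if it
  halts on every input and for all outcomes of the samples, for n at least 2 within the bound, and
  returns the tree that the algorithm computes when the i-th sample drawn is the noise of the i-th
  listed edge. The trees are compared only if the noisy weights are pairwise distinct, which happens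
  almost surely, because otherwise the argmin in the algorithm is not unique. The bound is not
  imposed for n = 1, where m + n log n vanishes.\<close>

definition implements_opk :: "com \<Rightarrow> (nat \<Rightarrow> nat \<Rightarrow> real) \<Rightarrow> bool" where
  "implements_opk P B \<longleftrightarrow>
     (\<forall>n E w \<epsilon> \<delta> es X \<omega>.
        connected_graph n E \<longrightarrow> \<epsilon> > 0 \<longrightarrow> \<delta> > 0 \<longrightarrow> edge_listing es E \<longrightarrow>
        (\<forall>i < length es. \<omega> i = X (undirected (es ! i))) \<longrightarrow>
        (\<exists>t s. exec \<omega> P (input_store n es w \<epsilon> \<delta>) t s \<and>
           (2 \<le> n \<longrightarrow> real t \<le> B n (card E)) \<and>
           (inj_on (noisy_weight n \<epsilon> \<delta> w X) E \<longrightarrow>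
              output_tree es s = opk_tree n E \<epsilon> \<delta> w X)))"

end

theory Submission
  imports Defs
begin

text \<open>The noisy weights are exponential clocks with rates \<open>exp (- \<epsilon>' w / 2)\<close>. By memorylessness the
  edge that the loop selects from F is distributed proportionally to the rates, whatever has been
  selected before. For neighboring weights the logarithmic likelihood ratio of such a selection has
  a range of length \<open>\<epsilon>'\<close>, and Hoeffding's lemma bounds its exponential moments; over n - 1 steps
  they multiply, and a Chernoff bound gives the privacy guarantee. For the utility, each selected
  edge is exchanged into a minimum spanning tree, which costs at most the expected excess of the
  selected edge over the minimum of F, and this is at most \<open>2 ln |F| / \<epsilon>'\<close>.

  The program draws the noise once and then runs Prim's algorithm with a Fibonacci heap. By the cut
  property each of its edges is selected by Kruskal's algorithm as well, so for distinct noisy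
  weights the two spanning trees coincide.\<close>

section \<open>Connectivity and cycles\<close>

text \<open>Write L = ln (1 / \<delta>) and r^2 for the value of \<open>priv_rho\<close>. Its
  definition amounts to \<epsilon> = r^2 + 2 r sqrt L, and the Chernoff parameter s = sqrt L / r
  then satisfies (s + s^2) r^2 - s \<epsilon> = - L. So for \<delta> < 1 the privacy losses beyond
  \<epsilon> contribute at most exp (- L) = \<delta>. The candidates of a round depend on the
  earlier selections, which is why race, privacy and utility are all proved by induction from an
  arbitrary loop state.

  Since 1 / r = (sqrt (\<epsilon> + L) + sqrt L) / \<epsilon>, a utility bound proportional to sqrt
  L needs \<epsilon> to be at most a constant multiple of L; this is the origin of the factor
  \<open>K\<close>.

  Sorting the edges by noisy weight costs more than m + n log n on sparse graphs, so the program
  does not follow Kruskal's order and only the resulting trees are compared. The machine can neither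
  multiply naturals nor round reals, which shapes the array layout and keeps logarithms out of the
  program: they occur only in the credits.\<close>

abbreviation conn :: "edge set \<Rightarrow> (nat \<times> nat) set" where
  "conn F \<equiv> {(x, y). {x, y} \<in> F}\<^sup>*"

lemma conn_sym: "(a, b) \<in> conn F \<Longrightarrow> (b, a) \<in> conn F"
proof -
  have "sym {(x, y). {x, y} \<in> F}" by (auto simp: sym_def insert_commute)
  then show "(a, b) \<in> conn F \<Longrightarrow> (b, a) \<in> conn F" by (meson sym_rtrancl symD)
qed

lemma conn_mono: "F \<subseteq> G \<Longrightarrow> conn F \<subseteq> conn G"
  by (rule rtrancl_mono) auto

lemma conn_edge: "{a, b} \<in> F \<Longrightarrow> (a, b) \<in> conn F"
  by auto

lemma conn_subsetI:
  assumes "\<And>a b. {a, b} \<in> F \<Longrightarrow> (a, b) \<in> conn G"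
  shows "conn F \<subseteq> conn G"
proof -
  have "{(x, y). {x, y} \<in> F} \<subseteq> conn G" using assms by auto
  then show ?thesis by (metis rtrancl_mono rtrancl_idemp)
qed

lemma contains_cycle_mono: "contains_cycle F \<Longrightarrow> F \<subseteq> G \<Longrightarrow> contains_cycle G"
  unfolding contains_cycle_def by blast

lemma not_contains_cycle_empty: "\<not> contains_cycle {}"
proof
  assume "contains_cycle {}"
  then obtain vs :: "nat list" where "3 \<le> length vs" "\<forall>i < length vs. {vs ! i, vs ! (Suc i mod length vs)} \<in> ({} :: edge set)"
    unfolding contains_cycle_def by blast
  then have "0 < length vs" by linarith
  then show False using \<open>\<forall>i < length vs. _\<close> by blast
qed

lemma conn_crossing:
  assumes "(a, b) \<in> conn F" "a \<in> S" "b \<notin> S"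
  shows "\<exists>x y. x \<in> S \<and> y \<notin> S \<and> {x, y} \<in> F"
  using assms by (induction rule: rtrancl_induct) auto

text \<open>When the next vertex already occurs on the path, the path is cut back to that
  occurrence, so repetitions never arise.\<close>

lemma conn_distinct_path:
  assumes "(a, b) \<in> conn T"
  shows "\<exists>vs. vs \<noteq> [] \<and> hd vs = a \<and> last vs = b \<and> distinct vs \<and> successively (\<lambda>x y. {x, y} \<in> T) vs"
  using assms
proof (induction rule: rtrancl_induct)
  case base
  show ?case by (rule exI[of _ "[a]"]) auto
next
  case (step b c)
  then obtain vs where vs: "vs \<noteq> []" "hd vs = a" "last vs = b" "distinct vs"
    "successively (\<lambda>x y. {x, y} \<in> T) vs" by blast
  show ?case
  proof (cases "c \<in> set vs")
    case True
    then obtain xs ys where s: "vs = xs @ c # ys" by (meson split_list)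
    show ?thesis
      using vs s
      by (intro exI[of _ "xs @ [c]"]) (auto simp: successively_append_iff hd_append)
  next
    case False
    then show ?thesis using vs step
      by (intro exI[of _ "vs @ [c]"]) (auto simp: successively_append_iff)
  qed
qed

text \<open>A simple path from \<open>a\<close> to \<open>b\<close> has more than one vertex because
  \<open>a \<noteq> b\<close> and more than two because \<open>{a, b} \<notin> T\<close>. The new
  edge closes it where the index wraps around to 0.\<close>

lemma contains_cycle_insertI:
  assumes "(a, b) \<in> conn T" "a \<noteq> b" "{a, b} \<notin> T"
  shows "contains_cycle (insert {a, b} T)"
proof -
  obtain vs where vs: "vs \<noteq> []" "hd vs = a" "last vs = b" "distinct vs"
    "successively (\<lambda>x y. {x, y} \<in> T) vs" using conn_distinct_path[OF assms(1)] by blast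
  have n1: "length vs \<noteq> 1" using vs assms(2) by (auto simp: length_Suc_conv)
  have n2: "length vs \<noteq> 2" using vs assms(3) by (auto simp: length_Suc_conv numeral_2_eq_2)
  have n0: "length vs \<noteq> 0" using vs by simp
  have len: "3 \<le> length vs" using n0 n1 n2 by linarith
  have "{vs ! i, vs ! (Suc i mod length vs)} \<in> insert {a, b} T" if "i < length vs" for i
  proof (cases "Suc i < length vs")
    case True
    then show ?thesis using vs(5) by (auto simp: successively_conv_nth)
  next
    case False
    then have "Suc i = length vs" using that by linarith
    moreover from this have "vs ! i = b" using vs by (metis diff_Suc_1 last_conv_nth)
    moreover have "vs ! 0 = a" using vs by (simp add: hd_conv_nth)
    ultimately show ?thesis by (auto simp: insert_commute)
  qed
  then show ?thesis unfolding contains_cycle_def using len vs(4) by blast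
qed

text \<open>The cycle must use the new edge. Opened there, it becomes a walk in \<open>T\<close>
  between the two ends.\<close>

lemma contains_cycle_insertD:
  assumes "contains_cycle (insert {a, b} T)" "\<not> contains_cycle T"
  shows "(a, b) \<in> conn T"
proof -
  obtain vs where len: "3 \<le> length vs" and d: "distinct vs"
    and ed: "\<And>i. i < length vs \<Longrightarrow> {vs ! i, vs ! (Suc i mod length vs)} \<in> insert {a, b} T"
    using assms(1) unfolding contains_cycle_def by blast
  define l where "l = length vs"
  \<comment> \<open>Periodic extension of the vertex list, so that walking past its end needs no
    case distinction.\<close>
  define g where "g i = vs ! (i mod l)" for i
  have l3: "3 \<le> l" using len l_def by simp
  have ginj: "g i = g j \<longleftrightarrow> i mod l = j mod l" for i j
    proof -
    have "k mod length vs < length vs" for k using len by (intro mod_less_divisor) linarith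
    then show ?thesis using d unfolding g_def l_def by (simp add: nth_eq_iff_index_eq)
  qed
  have ed': "{g i, g (Suc i)} \<in> insert {a, b} T" for i
    proof -
    have "i mod length vs < length vs" using len by (intro mod_less_divisor) linarith
    then show ?thesis using ed[of "i mod l"] unfolding g_def l_def by (simp add: mod_Suc_eq)
  qed
  have "\<exists>i<l. {g i, g (Suc i)} \<notin> T"
  proof (rule ccontr)
    assume "\<not> ?thesis"
    then have "\<forall>i<length vs. {vs ! i, vs ! (Suc i mod length vs)} \<in> T"
      unfolding g_def l_def by auto
    then show False using assms(2) len d unfolding contains_cycle_def by blast
  qed
  then obtain i where i: "i < l" "{g i, g (Suc i)} = {a, b}" using ed' by blast
  \<comment> \<open>The new edge occurs at one position only: a second occurrence would traverse it
    backwards, and the length would divide 2.\<close>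
  have other: "{g j, g (Suc j)} \<in> T" if "j mod l \<noteq> i" for j
  proof (rule ccontr)
    assume "{g j, g (Suc j)} \<notin> T"
    then have eq: "{g j, g (Suc j)} = {g i, g (Suc i)}" using ed' i by blast
    have "g j \<noteq> g i" using that i by (simp add: ginj)
    then have "g j = g (Suc i)" "g (Suc j) = g i" using eq by (auto simp: doubleton_eq_iff)
    then have "j mod l = Suc i mod l" "Suc j mod l = i mod l" by (auto simp: ginj)
    then have "Suc (Suc i) mod l = i mod l" by (metis mod_Suc_eq)
    then have "(i + 2) mod l = i mod l" by simp
    then have "l dvd 2" by (metis add_diff_cancel_left' mod_eq_dvd_iff_nat le_add1)
    then show False using l3 by (auto dest: dvd_imp_le)
  qed
  have walk: "(g (Suc i), g (Suc i + k)) \<in> conn T" if "k < l" for k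
    using that
  proof (induction k)
    case (Suc k)
    have "(Suc i + k) mod l \<noteq> i"
    proof
      assume "(Suc i + k) mod l = i"
      then have "(i + Suc k) mod l = i mod l" using i by simp
      then have "l dvd Suc k" by (metis add_diff_cancel_left' mod_eq_dvd_iff_nat le_add1)
      then show False using Suc.prems by (auto dest: dvd_imp_le)
    qed
    then have "{g (Suc i + k), g (Suc i + Suc k)} \<in> T" using other by simp
    then show ?case using Suc by (simp add: rtrancl.rtrancl_into_rtrancl)
  qed simp
  have "g (Suc i + (l - 1)) = g i" using l3 by (simp add: ginj)
  then have "(g (Suc i), g i) \<in> conn T" using walk[of "l - 1"] l3 by simp
  then show ?thesis using i(2) conn_sym by (auto simp: doubleton_eq_iff)
qed

text \<open>The bridge property of forests: were the ends still joined, putting the edge back would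
  close a cycle.\<close>

lemma not_conn_remove_edge:
  assumes "\<not> contains_cycle K" "{a, b} \<in> K" "a \<noteq> b"
  shows "(a, b) \<notin> conn (K - {{a, b}})"
  using contains_cycle_insertI[of a b "K - {{a, b}}"] assms by (auto simp: insert_absorb)

text \<open>A walk that uses the new edge repeatedly can be shortened to use it once, in one of the
  two directions.\<close>

lemma conn_insertD:
  assumes "(a, b) \<in> conn (insert {x, y} G)"
  shows "(a, b) \<in> conn G \<or> (a, x) \<in> conn G \<and> (y, b) \<in> conn G \<or> (a, y) \<in> conn G \<and> (x, b) \<in> conn G"
  using assms
proof (induction rule: rtrancl_induct)
  case (step b c)
  then consider "{b, c} \<in> G" | "{b, c} = {x, y}" by auto
  then show ?case
  proof cases
    case 1
    then show ?thesis using step.IH by (auto intro: rtrancl.rtrancl_into_rtrancl)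
  next
    case 2
    then have "b = x \<and> c = y \<or> b = y \<and> c = x" by (auto simp: doubleton_eq_iff)
    then show ?thesis using step.IH by auto
  qed
qed auto

section \<open>Exchanging an edge of a spanning tree\<close>

text \<open>The edges of \<open>W\<close> are added to \<open>T\<close> one at a time;
  \<open>f\<close> is the one whose arrival joins \<open>a\<close> and \<open>b\<close>, and
  \<open>G\<close> is what was present before.\<close>

lemma conn_first_edge:
  assumes "finite W" "(a, b) \<in> conn (T \<union> W)" "(a, b) \<notin> conn T"
  shows "\<exists>f\<in>W. \<exists>G. G \<subseteq> T \<union> W - {f} \<and> f \<notin> T \<and> (a, b) \<notin> conn G \<and> (a, b) \<in> conn (insert f G)"
  using assms
proof (induction W rule: finite_induct)
  case (insert f W)
  show ?case
  proof (cases "(a, b) \<in> conn (T \<union> W)")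
    case True
    then obtain f' G where "f' \<in> W" "G \<subseteq> T \<union> W - {f'}" "f' \<notin> T" "(a, b) \<notin> conn G" "(a, b) \<in> conn (insert f' G)"
      using insert by blast
    then show ?thesis by blast
  next
    case False
    have "f \<notin> T" using False insert.prems(1) by (metis UnI1 Un_insert_right insert_absorb)
    then show ?thesis using False insert by (intro bexI[of _ f] exI[of _ "T \<union> W"]) auto
  qed
qed simp

text \<open>\<open>B\<close> joins \<open>a\<close> and \<open>b\<close> while \<open>T\<close> does
  not, so a connection between them needs an edge \<open>f\<close> of \<open>B - T\<close>. The new
  edge bridges the gap that \<open>f\<close> leaves. It closes no cycle, for if \<open>a\<close> and
  \<open>b\<close> were still joined without \<open>f\<close>, so would be the ends of
  \<open>f\<close>, and \<open>f\<close> is a bridge of \<open>B\<close>.\<close>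

lemma spanning_tree_exchange:
  assumes st: "spanning_tree n E B" and fin: "finite B" and TB: "T \<subseteq> B"
    and e: "{a, b} \<in> E" "a \<in> {1..n}" "b \<in> {1..n}" "a \<noteq> b" "{a, b} \<notin> B"
    and edges: "\<And>e. e \<in> E \<Longrightarrow> card e = 2"
    and nc: "\<not> contains_cycle (insert {a, b} T)"
  shows "\<exists>f\<in>B - T. spanning_tree n E (insert {a, b} (B - {f}))"
proof -
  have ab: "(a, b) \<in> conn B" using st e unfolding spanning_tree_def connects_def by blast
  have "(a, b) \<notin> conn T" using contains_cycle_insertI nc e TB by blast
  moreover have eqB: "T \<union> (B - T) = B" using TB by blast
  ultimately obtain f G where f: "f \<in> B - T" "G \<subseteq> B - {f}" "(a, b) \<notin> conn G" "(a, b) \<in> conn (insert f G)"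
    using conn_first_edge[of "B - T" a b T] fin ab unfolding eqB by blast
  have "card f = 2" using f st edges unfolding spanning_tree_def by blast
  then obtain x0 y0 where "f = {x0, y0}" "x0 \<noteq> y0" by (auto simp: card_2_iff)
  \<comment> \<open>Name the ends of \<open>f\<close> so that \<open>x\<close> is on the side of
    \<open>a\<close>.\<close>
  have "\<exists>x y. f = {x, y} \<and> x \<noteq> y \<and> (a, x) \<in> conn G \<and> (y, b) \<in> conn G"
  proof -
    have "(a, x0) \<in> conn G \<and> (y0, b) \<in> conn G \<or> (a, y0) \<in> conn G \<and> (x0, b) \<in> conn G"
      using conn_insertD[of a b x0 y0 G] f(3,4) unfolding \<open>f = {x0, y0}\<close> by blast
    moreover have "f = {y0, x0}" using \<open>f = _\<close> by auto
    ultimately show ?thesis using \<open>x0 \<noteq> y0\<close> \<open>f = {x0, y0}\<close> by metis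
  qed
  then obtain x y where xy: "f = {x, y}" "x \<noteq> y" "(a, x) \<in> conn G" "(y, b) \<in> conn G" by blast
  let ?B = "B - {f}"
  have GB: "conn G \<subseteq> conn ?B" using f by (intro conn_mono) auto
  have ax: "(a, x) \<in> conn ?B" and yb: "(y, b) \<in> conn ?B" using xy GB by auto
  have sub: "conn ?B \<subseteq> conn (insert {a, b} ?B)" by (rule conn_mono) auto
  have xy': "(x, y) \<in> conn (insert {a, b} ?B)"
  proof -
    have "(x, a) \<in> conn (insert {a, b} ?B)" "(b, y) \<in> conn (insert {a, b} ?B)"
      using sub ax yb conn_sym by blast+
    moreover have "(a, b) \<in> conn (insert {a, b} ?B)" by (rule conn_edge) simp
    ultimately show ?thesis by (meson rtrancl_trans)
  qed
  have "conn B \<subseteq> conn (insert {a, b} ?B)"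
  proof (rule conn_subsetI)
    fix u v assume uv: "{u, v} \<in> B"
    show "(u, v) \<in> conn (insert {a, b} ?B)"
    proof (cases "{u, v} = f")
      case True
      then have "u = x \<and> v = y \<or> u = y \<and> v = x" using xy by (auto simp: doubleton_eq_iff)
      then show ?thesis using xy' conn_sym by blast
    next
      case False
      then show ?thesis using uv by (intro conn_edge) auto
    qed
  qed
  then have 1: "connects {1..n} (insert {a, b} ?B)"
    using st unfolding spanning_tree_def connects_def by blast
  have nB: "\<not> contains_cycle ?B" using st contains_cycle_mono unfolding spanning_tree_def by blast
  have "(a, b) \<notin> conn ?B"
  proof
    assume "(a, b) \<in> conn ?B"
    then have "(x, y) \<in> conn ?B" using conn_sym[OF ax] conn_sym[OF yb] by (meson rtrancl_trans)
    then show False using not_conn_remove_edge[of B x y] st f xy unfolding spanning_tree_def by auto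
  qed
  then have "\<not> contains_cycle (insert {a, b} ?B)" using nB contains_cycle_insertD by blast
  then show ?thesis using 1 f st e unfolding spanning_tree_def by blast
qed

text \<open>A further edge of \<open>T\<close> would be a bridge whose ends \<open>S\<close> already
  connects. Trees are thereby identified from one inclusion, both for the reference tree of the
  utility proof and for the output of the program.\<close>

lemma spanning_tree_subset_eq:
  assumes "connects {1..n} S" "S \<subseteq> T" "spanning_tree n E T" "E \<subseteq> {e. e \<subseteq> {1..n} \<and> card e = 2}"
  shows "S = T"
proof (rule ccontr)
  assume "S \<noteq> T"
  then obtain f where f: "f \<in> T" "f \<notin> S" using assms by blast
  then have "f \<in> E" using assms unfolding spanning_tree_def by auto
  then obtain a b where ab: "f = {a, b}" "a \<noteq> b" "a \<in> {1..n}" "b \<in> {1..n}"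
    using assms(4) by (auto simp: card_2_iff)
  have "(a, b) \<in> conn S" using ab assms(1) unfolding connects_def by blast
  moreover have "conn S \<subseteq> conn (T - {f})" using assms f by (intro conn_mono) auto
  ultimately have "(a, b) \<in> conn (T - {f})" by blast
  then show False using not_conn_remove_edge[of T a b] ab f assms unfolding spanning_tree_def by auto
qed

section \<open>Kruskal's loop\<close>

text \<open>The loop body with the choice of the edge left open, so that the argmin of noisy weights
  and the random selection drive the same state machine.\<close>

definition next_state :: "edge set \<times> edge set \<Rightarrow> edge \<Rightarrow> edge set \<times> edge set" where
  "next_state \<sigma> e = (insert e (fst \<sigma>),
     snd \<sigma> - {e} - {e' \<in> snd \<sigma>. contains_cycle (insert e' (insert e (fst \<sigma>)))})"

text \<open>A labelling of the vertices replaces the equivalence classes, so that merging two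
  components is a relabelling.\<close>

definition num_components :: "nat \<Rightarrow> edge set \<Rightarrow> nat \<Rightarrow> bool" where
  "num_components n T k \<longleftrightarrow> (\<exists>c :: nat \<Rightarrow> nat.
     (\<forall>u\<in>{1..n}. \<forall>v\<in>{1..n}. (u, v) \<in> conn T \<longleftrightarrow> c u = c v) \<and> card (c ` {1..n}) = k)"

text \<open>The component count controls the number of rounds: \<open>F\<close> cannot run empty
  before \<open>T\<close> has n - 1 edges, and then \<open>T\<close> spans. The bound on
  \<open>card\<close> keeps the subtraction from being truncated.\<close>

definition kruskal_inv :: "nat \<Rightarrow> edge set \<Rightarrow> edge set \<times> edge set \<Rightarrow> bool" where
  "kruskal_inv n E \<sigma> \<longleftrightarrow> fst \<sigma> \<subseteq> E \<and> \<not> contains_cycle (fst \<sigma>) \<and>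
     snd \<sigma> = {e \<in> E - fst \<sigma>. \<not> contains_cycle (insert e (fst \<sigma>))} \<and>
     card (fst \<sigma>) \<le> n \<and> num_components n (fst \<sigma>) (n - card (fst \<sigma>))"

context
  fixes n E assumes con: "connected_graph n E"
begin

lemma edgeE:
  assumes "e \<in> E"
  obtains a b where "e = {a, b}" "a \<noteq> b" "a \<in> {1..n}" "b \<in> {1..n}"
  using assms con unfolding connected_graph_def by (auto simp: card_2_iff)

lemma finite_edges: "finite E"
proof -
  have "E \<subseteq> Pow {1..n}" using con unfolding connected_graph_def by auto
  then show ?thesis by (rule finite_subset) simp
qed

lemma card_edges_le: "card E \<le> n\<^sup>2"
proof -
  have "E \<subseteq> (\<lambda>(a, b). {a, b}) ` ({1..n} \<times> {1..n})"
  proof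
    fix e assume "e \<in> E"
    then obtain a b where "e = {a, b}" "a \<in> {1..n}" "b \<in> {1..n}" using edgeE by metis
    then show "e \<in> (\<lambda>(a, b). {a, b}) ` ({1..n} \<times> {1..n})" by auto
  qed
  then have "card E \<le> card ({1..n} \<times> {1..n})"
    by (meson finite_SigmaI finite_atLeastAtMost surj_card_le)
  then show ?thesis by (simp add: power2_eq_square)
qed

lemma single_edge_acyclic: "\<not> contains_cycle {e}"
proof
  assume "contains_cycle {e}"
  then obtain vs where vs: "3 \<le> length vs" "distinct vs"
     "\<forall>i < length vs. {vs ! i, vs ! (Suc i mod length vs)} = e"
    unfolding contains_cycle_def by blast
  have "{vs ! 0, vs ! 1} = e" using vs(1) spec[OF vs(3), of 0] by auto
  moreover have "{vs ! 1, vs ! 2} = e" using vs(1) spec[OF vs(3), of 1] by (auto simp: numeral_2_eq_2)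
  ultimately have "{vs ! 0, vs ! 1} = {vs ! 1, vs ! 2}" by simp
  then have "vs ! 0 = vs ! 1 \<or> vs ! 0 = vs ! 2" by (auto simp: doubleton_eq_iff)
  moreover have "0 < length vs" "1 < length vs" "2 < length vs" using vs(1) by auto
  ultimately show False using vs(2) by (auto simp: nth_eq_iff_index_eq)
qed

lemma kruskal_inv_init: "kruskal_inv n E ({}, E)"
proof -
  have "num_components n {} n"
    unfolding num_components_def by (rule exI[of _ "\<lambda>x. x"]) auto
  then show ?thesis
    unfolding kruskal_inv_def by (auto simp: not_contains_cycle_empty single_edge_acyclic)
qed

lemma kruskal_inv_next:
  assumes inv: "kruskal_inv n E \<sigma>" and e: "e \<in> snd \<sigma>"
  shows "kruskal_inv n E (next_state \<sigma> e)" "card (fst (next_state \<sigma> e)) = Suc (card (fst \<sigma>))"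
proof -
  obtain T F where s: "\<sigma> = (T, F)" by (cases \<sigma>)
  have T: "T \<subseteq> E" "\<not> contains_cycle T" and F: "F = {e \<in> E - T. \<not> contains_cycle (insert e T)}"
    and le: "card T \<le> n" and nc: "num_components n T (n - card T)"
    using inv s unfolding kruskal_inv_def by auto
  have finT: "finite T" using T finite_edges finite_subset by blast
  have eF: "e \<in> E" "e \<notin> T" "\<not> contains_cycle (insert e T)" using e s F by auto
  show card: "card (fst (next_state \<sigma> e)) = Suc (card (fst \<sigma>))"
    using eF finT s by (simp add: next_state_def)
  obtain a b where ab: "e = {a, b}" "a \<noteq> b" "a \<in> {1..n}" "b \<in> {1..n}" using edgeE eF(1) by metis
  obtain c :: "nat \<Rightarrow> nat" where c: "\<And>u v. u\<in>{1..n} \<Longrightarrow> v\<in>{1..n} \<Longrightarrow> (u, v) \<in> conn T \<longleftrightarrow> c u = c v"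
    and cc: "card (c ` {1..n}) = n - card T" using nc unfolding num_components_def by blast
  have "(a, b) \<notin> conn T" using contains_cycle_insertI eF ab by blast
  then have cab: "c a \<noteq> c b" using c ab by blast
  \<comment> \<open>The component of \<open>b\<close> takes over the label of \<open>a\<close>; the
    two labels differ, so exactly one disappears.\<close>
  define c' where "c' v = (if c v = c b then c a else c v)" for v
  have c'1: "(u, v) \<in> conn (insert e T) \<longleftrightarrow> c' u = c' v" if uv: "u \<in> {1..n}" "v \<in> {1..n}" for u v
  proof
    assume "(u, v) \<in> conn (insert e T)"
    then have "(u, v) \<in> conn T \<or> (u, a) \<in> conn T \<and> (b, v) \<in> conn T \<or> (u, b) \<in> conn T \<and> (a, v) \<in> conn T"
      using conn_insertD ab by blast
    then show "c' u = c' v" using c ab uv unfolding c'_def by auto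
  next
    assume eq: "c' u = c' v"
    have m: "conn T \<subseteq> conn (insert e T)" by (rule conn_mono) auto
    have ed: "(a, b) \<in> conn (insert e T)" "(b, a) \<in> conn (insert e T)" 
      using ab by (auto intro!: conn_edge simp: insert_commute)
    consider "c u = c v" | "c u = c a" "c b = c v" | "c u = c b" "c a = c v"
      using eq unfolding c'_def by (auto split: if_splits)
    then show "(u, v) \<in> conn (insert e T)"
    proof cases
      case 1 then show ?thesis using c uv m by blast
    next
      case 2 
      then have "(u, a) \<in> conn (insert e T)" "(b, v) \<in> conn (insert e T)" using c uv m ab by blast+
      then show ?thesis using ed by (meson rtrancl_trans)
    next
      case 3
      then have "(u, b) \<in> conn (insert e T)" "(a, v) \<in> conn (insert e T)" using c uv m ab by blast+
      then show ?thesis using ed by (meson rtrancl_trans)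
    qed
  qed
  have im: "c' ` {1..n} = c ` {1..n} - {c b}"
  proof
    show "c' ` {1..n} \<subseteq> c ` {1..n} - {c b}" using ab cab unfolding c'_def by auto
    show "c ` {1..n} - {c b} \<subseteq> c' ` {1..n}" unfolding c'_def by force
  qed
  have cim: "card (c' ` {1..n}) = n - card T - 1" using im cc ab by simp
  have pos: "0 < n - card T" using cc ab by (metis card_gt_0_iff empty_iff finite_atLeastAtMost finite_imageI image_eqI)
  have "num_components n (insert e T) (n - card (insert e T))"
    unfolding num_components_def
    by (rule exI[of _ c']) (use c'1 cim finT eF in auto)
  moreover have "card (insert e T) \<le> n" using pos eF finT by simp
  \<comment> \<open>An edge rejected earlier also closes a cycle with the larger forest, so
    filtering \<open>F\<close> agrees with filtering all of \<open>E\<close>.\<close>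
  moreover have "snd (next_state \<sigma> e) = {e' \<in> E - insert e T. \<not> contains_cycle (insert e' (insert e T))}"
  proof -
    have "\<not> contains_cycle (insert e' T)" if "\<not> contains_cycle (insert e' (insert e T))" for e'
      using that contains_cycle_mono[of "insert e' T" "insert e' (insert e T)"] by blast
    then show ?thesis unfolding next_state_def s using F by auto
  qed
  ultimately show "kruskal_inv n E (next_state \<sigma> e)"
    unfolding kruskal_inv_def using s T eF by (auto simp: next_state_def)
qed

lemma kruskal_inv_finite: "kruskal_inv n E \<sigma> \<Longrightarrow> finite (fst \<sigma>) \<and> finite (snd \<sigma>)"
  using finite_edges finite_subset unfolding kruskal_inv_def by (metis (no_types, lifting) DiffD1 mem_Collect_eq subsetI)

text \<open>An edge is missing from \<open>F\<close> because it is in \<open>T\<close> or because it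
  closes a cycle with \<open>T\<close>.\<close>

lemma not_joined_outside:
  assumes "kruskal_inv n E \<sigma>" "{a, b} \<in> E" "{a, b} \<notin> snd \<sigma>"
  shows "(a, b) \<in> conn (fst \<sigma>)"
proof (cases "{a, b} \<in> fst \<sigma>")
  case False
  then have "contains_cycle (insert {a, b} (fst \<sigma>))" using assms unfolding kruskal_inv_def by auto
  then show ?thesis using assms contains_cycle_insertD unfolding kruskal_inv_def by blast
qed auto

text \<open>If no edge is left, \<open>T\<close> joins whatever \<open>E\<close> joins, hence all
  vertices, and a single component leaves n - |T| at most 1.\<close>

lemma kruskal_inv_nonempty:
  assumes inv: "kruskal_inv n E \<sigma>" and lt: "Suc (card (fst \<sigma>)) < n"
  shows "snd \<sigma> \<noteq> {}"
proof
  assume em: "snd \<sigma> = {}"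
  have sub: "conn E \<subseteq> conn (fst \<sigma>)"
    using not_joined_outside[OF inv] em by (intro conn_subsetI) auto
  obtain c :: "nat \<Rightarrow> nat" where c: "\<And>u v. u\<in>{1..n} \<Longrightarrow> v\<in>{1..n} \<Longrightarrow> (u, v) \<in> conn (fst \<sigma>) \<longleftrightarrow> c u = c v"
    and cc: "card (c ` {1..n}) = n - card (fst \<sigma>)" using inv unfolding kruskal_inv_def num_components_def by blast
  have "c u = c 1" if u: "u \<in> {1..n}" for u
  proof -
    have "1 \<in> {1..n}" using con unfolding connected_graph_def by simp
    moreover from this have "(u, 1) \<in> conn E" using u con unfolding connected_graph_def connects_def by blast
    ultimately show ?thesis using c[OF u] sub by blast
  qed
  then have "c ` {1..n} \<subseteq> {c 1}" by blast
  then have "card (c ` {1..n}) \<le> 1" by (metis card.empty card_insert_le_m1 card_mono finite.intros is_singletonI is_singleton_altdef)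
  then show False using cc lt by linarith
qed

lemma kruskal_inv_final:
  assumes inv: "kruskal_inv n E \<sigma>" and eq: "Suc (card (fst \<sigma>)) = n"
  shows "spanning_tree n E (fst \<sigma>)" "snd \<sigma> = {}"
proof -
  obtain c :: "nat \<Rightarrow> nat" where c: "\<And>u v. u\<in>{1..n} \<Longrightarrow> v\<in>{1..n} \<Longrightarrow> (u, v) \<in> conn (fst \<sigma>) \<longleftrightarrow> c u = c v"
    and cc: "card (c ` {1..n}) = n - card (fst \<sigma>)" using inv unfolding kruskal_inv_def num_components_def by blast
  have "card (c ` {1..n}) = 1" using cc eq by simp
  then obtain z where z: "c ` {1..n} = {z}" by (auto simp: card_1_singleton_iff)
  then have con': "connects {1..n} (fst \<sigma>)" unfolding connects_def using c by (metis imageI singletonD)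
  then show st: "spanning_tree n E (fst \<sigma>)" using inv unfolding kruskal_inv_def spanning_tree_def by auto
  show "snd \<sigma> = {}"
  proof (rule ccontr)
    assume "snd \<sigma> \<noteq> {}"
    then obtain e where e: "e \<in> E" "e \<notin> fst \<sigma>" "\<not> contains_cycle (insert e (fst \<sigma>))"
      using inv unfolding kruskal_inv_def by auto
    obtain a b where ab: "e = {a, b}" "a \<noteq> b" "a \<in> {1..n}" "b \<in> {1..n}" using edgeE e by metis
    then show False using contains_cycle_insertI[of a b "fst \<sigma>"] con' e unfolding connects_def by blast
  qed
qed

section \<open>The run for given weights and the cut property\<close>

lemma kruskal_state_next:
  "kruskal_state E wt (Suc i) = next_state (kruskal_state E wt i) (arg_min_on wt (snd (kruskal_state E wt i)))"
  by (auto simp: next_state_def Let_def split_beta)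

lemma kruskal_state_inv:
  assumes "i < n"
  shows "kruskal_inv n E (kruskal_state E wt i) \<and> card (fst (kruskal_state E wt i)) = i"
  using assms
proof (induction i)
  case 0
  then show ?case using kruskal_inv_init by simp
next
  case (Suc i)
  then have IH: "kruskal_inv n E (kruskal_state E wt i)" "card (fst (kruskal_state E wt i)) = i" by auto
  then have "snd (kruskal_state E wt i) \<noteq> {}" using kruskal_inv_nonempty Suc.prems by simp
  then have "arg_min_on wt (snd (kruskal_state E wt i)) \<in> snd (kruskal_state E wt i)"
    using kruskal_inv_finite IH arg_min_if_finite by blast
  then show ?case using kruskal_inv_next IH kruskal_state_next by metis
qed

text \<open>Two facts are maintained together: selected edges are lighter than all remaining ones,
  and the ends of a rejected edge are joined by lighter selected edges. An edge rejected in the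
  current round was in \<open>F\<close> until now, so the first fact yields the second for
  it.\<close>

lemma kruskal_state_light:
  assumes inj: "inj_on wt E" and "i < n"
  shows "(\<forall>f \<in> fst (kruskal_state E wt i). \<forall>e \<in> snd (kruskal_state E wt i). wt f < wt e) \<and>
    (\<forall>a b. {a, b} \<in> E - fst (kruskal_state E wt i) - snd (kruskal_state E wt i) \<longrightarrow>
      (a, b) \<in> conn {f \<in> fst (kruskal_state E wt i). wt f < wt {a, b}})"
  using assms(2)
proof (induction i)
  case (Suc i)
  define T where "T = fst (kruskal_state E wt i)"
  define F where "F = snd (kruskal_state E wt i)"
  define e where "e = arg_min_on wt F"
  have inv: "kruskal_inv n E (kruskal_state E wt i)" "card T = i" 
    using kruskal_state_inv Suc.prems unfolding T_def by auto
  have ne: "F \<noteq> {}" using kruskal_inv_nonempty[OF inv(1)] inv(2) Suc.prems unfolding F_def T_def by simp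
  have fin: "finite F" using kruskal_inv_finite inv unfolding F_def by blast
  have FE: "F \<subseteq> E" using inv unfolding kruskal_inv_def F_def by auto
  have eF: "e \<in> F" using arg_min_if_finite(1)[OF fin ne] e_def by metis
  have least: "wt e < wt f" if "f \<in> F" "f \<noteq> e" for f
  proof -
    have "wt e \<le> wt f" using arg_min_least[OF fin ne that(1)] e_def by metis
    moreover have "wt e \<noteq> wt f" using inj_onD[OF inj, of e f] that FE eF by blast
    ultimately show ?thesis by simp
  qed
  have nx: "kruskal_state E wt (Suc i) = next_state (T, F) e"
    unfolding e_def T_def F_def by (subst kruskal_state_next) simp
  have fst': "fst (kruskal_state E wt (Suc i)) = insert e T"
    and snd': "snd (kruskal_state E wt (Suc i)) = F - {e} - {e' \<in> F. contains_cycle (insert e' (insert e T))}"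
    unfolding nx next_state_def by auto
  have inv': "kruskal_inv n E (kruskal_state E wt (Suc i))" using kruskal_state_inv Suc.prems by blast
  have IH1: "wt f < wt e'" if "f \<in> T" "e' \<in> F" for f e' using Suc that T_def F_def by simp
  have IH2: "(a, b) \<in> conn {f \<in> T. wt f < wt {a, b}}" if "{a, b} \<in> E" "{a, b} \<notin> T" "{a, b} \<notin> F" for a b
    using Suc that T_def F_def by auto
  have lt: "wt f < wt e'" if "f \<in> insert e T" "e' \<in> F" "e' \<noteq> e" for f e'
    using that IH1 least by auto
  have "(a, b) \<in> conn {f \<in> insert e T. wt f < wt {a, b}}"
    if ab: "{a, b} \<in> E" "{a, b} \<notin> insert e T" "{a, b} \<notin> snd (kruskal_state E wt (Suc i))" for a b
  proof (cases "{a, b} \<in> F")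
    case True
    then have "(a, b) \<in> conn (insert e T)" using not_joined_outside[OF inv' ab(1) ab(3)] fst' by simp
    moreover have "{f \<in> insert e T. wt f < wt {a, b}} = insert e T" using lt[of _ "{a, b}"] True ab(2) by blast
    ultimately show ?thesis by simp
  next
    case False
    then have "(a, b) \<in> conn {f \<in> T. wt f < wt {a, b}}" using IH2 ab by auto
    moreover have "conn {f \<in> T. wt f < wt {a, b}} \<subseteq> conn {f \<in> insert e T. wt f < wt {a, b}}"
      by (rule conn_mono) auto
    ultimately show ?thesis by blast
  qed
  then show ?case unfolding fst' using lt snd' by auto
qed simp

text \<open>If the edge were not selected, strictly lighter tree edges would join its ends, and one
  of them would cross the cut.\<close>

lemma kruskal_cut_property:
  assumes inj: "inj_on wt E" and e: "{a, b} \<in> E" "a \<in> S" "b \<notin> S"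
    and min: "\<And>x y. {x, y} \<in> E \<Longrightarrow> x \<in> S \<Longrightarrow> y \<notin> S \<Longrightarrow> wt {a, b} \<le> wt {x, y}"
  shows "{a, b} \<in> fst (kruskal_state E wt (n - 1))"
proof (rule ccontr)
  assume no: "{a, b} \<notin> fst (kruskal_state E wt (n - 1))"
  have n: "n - 1 < n" using con unfolding connected_graph_def by simp
  have inv: "kruskal_inv n E (kruskal_state E wt (n - 1))" "card (fst (kruskal_state E wt (n - 1))) = n - 1"
    using kruskal_state_inv[OF n] by auto
  then have "snd (kruskal_state E wt (n - 1)) = {}" using kruskal_inv_final n by simp
  then have "(a, b) \<in> conn {f \<in> fst (kruskal_state E wt (n - 1)). wt f < wt {a, b}}"
    using kruskal_state_light[OF inj n] no e by auto
  then obtain x y where "x \<in> S" "y \<notin> S" "{x, y} \<in> fst (kruskal_state E wt (n - 1))" "wt {x, y} < wt {a, b}"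
    using conn_crossing[OF _ e(2,3)] by blast
  moreover have "{x, y} \<in> E" using calculation inv unfolding kruskal_inv_def by blast
  ultimately show False using min by fastforce
qed

lemma spanning_tree_kruskal: "spanning_tree n E (fst (kruskal_state E wt (n - 1)))"
proof -
  have n: "n - 1 < n" using con unfolding connected_graph_def by simp
  then show ?thesis using kruskal_state_inv[OF n] kruskal_inv_final by simp
qed

end

section \<open>The exponential race\<close>

text \<open>The law of the winner among independent exponential clocks of rates \<open>l e\<close>,
  to be used with a finite nonempty \<open>F\<close> and positive rates.\<close>

definition pick :: "(edge \<Rightarrow> real) \<Rightarrow> edge set \<Rightarrow> edge pmf" where
  "pick l F = embed_pmf (\<lambda>e. if e \<in> F then l e / sum l F else 0)"

lemma
  assumes "finite F" "F \<noteq> {}" and pos: "\<And>e. 0 < l e"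
  shows pmf_pick: "pmf (pick l F) e = (if e \<in> F then l e / sum l F else 0)"
    and set_pmf_pick: "set_pmf (pick l F) = F"
proof -
  have S: "0 < sum l F" using assms by (simp add: sum_pos)
  have "(\<integral>\<^sup>+ e. ennreal (if e \<in> F then l e / sum l F else 0) \<partial>count_space UNIV) =
      (\<Sum>e\<in>F. ennreal (if e \<in> F then l e / sum l F else 0))"
    using assms by (intro nn_integral_count_space') auto
  also have "\<dots> = (\<Sum>e\<in>F. ennreal (l e / sum l F))" by (rule sum.cong) auto
  also have "\<dots> = ennreal (\<Sum>e\<in>F. l e / sum l F)" using pos S by (simp add: less_imp_le)
  also have "(\<Sum>e\<in>F. l e / sum l F) = 1" using S by (simp add: sum_divide_distrib[symmetric])
  finally have 1: "(\<integral>\<^sup>+ e. ennreal (if e \<in> F then l e / sum l F else 0) \<partial>count_space UNIV) = 1" by simp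
  show p: "pmf (pick l F) e = (if e \<in> F then l e / sum l F else 0)" for e
    unfolding pick_def by (rule pmf_embed_pmf) (use 1 S pos in \<open>auto simp: less_imp_le\<close>)
  have "pmf (pick l F) e \<noteq> 0 \<longleftrightarrow> e \<in> F" for e
    using p[of e] S pos[of e] by simp
  then show "set_pmf (pick l F) = F" by (simp add: set_pmf_eq)
qed

primrec kruskal_pmf :: "(edge \<Rightarrow> real) \<Rightarrow> nat \<Rightarrow> edge set \<times> edge set \<Rightarrow> (edge set \<times> edge set) pmf" where
  "kruskal_pmf l 0 \<sigma> = return_pmf \<sigma>"
| "kruskal_pmf l (Suc k) \<sigma> = bind_pmf (pick l (snd \<sigma>)) (\<lambda>e. kruskal_pmf l k (next_state \<sigma> e))"

text \<open>\<open>kruskal_state\<close> adds a round at the end, this recursion and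
  \<open>kruskal_pmf\<close> at the front. Memorylessness restarts the race after the first
  selection, so that is the round to be split off.\<close>

primrec greedy :: "(edge \<Rightarrow> real) \<Rightarrow> nat \<Rightarrow> edge set \<times> edge set \<Rightarrow> edge set \<times> edge set" where
  "greedy wt 0 \<sigma> = \<sigma>"
| "greedy wt (Suc k) \<sigma> = greedy wt k (next_state \<sigma> (arg_min_on wt (snd \<sigma>)))"

lemma greedy_kruskal_state: "greedy wt k (kruskal_state E wt i) = kruskal_state E wt (i + k)"
proof (induction k arbitrary: i)
  case (Suc k)
  have "kruskal_state E wt (Suc i) = next_state (kruskal_state E wt i) (arg_min_on wt (snd (kruskal_state E wt i)))"
    by (auto simp: next_state_def Let_def split_beta)
  then show ?case using Suc[of "Suc i"] by (simp del: kruskal_state.simps)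
qed simp

text \<open>The argmin is a choice from the set of minimizers, which depends on comparisons of
  weights only. Measurability and the invariance under order-preserving changes follow, even when
  there are ties.\<close>

lemma arg_min_on_eq: "arg_min_on wt F = (SOME x. x \<in> {x \<in> F. \<forall>y\<in>F. \<not> wt y < wt x})"
  unfolding arg_min_on_def arg_min_def is_arg_min_def by (rule arg_cong[where f = Eps]) auto

lemma snd_next_state_subset: "snd (next_state \<sigma> e) \<subseteq> snd \<sigma> - {e}"
  unfolding next_state_def by auto

lemma greedy_order_cong:
  assumes "\<And>e f. e \<in> snd \<sigma> \<Longrightarrow> f \<in> snd \<sigma> \<Longrightarrow> wt e < wt f \<longleftrightarrow> wt' e < wt' f"
  shows "greedy wt k \<sigma> = greedy wt' k \<sigma>"
  using assms
proof (induction k arbitrary: \<sigma>)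
  case (Suc k)
  have "{x \<in> snd \<sigma>. \<forall>y\<in>snd \<sigma>. \<not> wt y < wt x} = {x \<in> snd \<sigma>. \<forall>y\<in>snd \<sigma>. \<not> wt' y < wt' x}"
    using Suc.prems by auto
  then have a: "arg_min_on wt (snd \<sigma>) = arg_min_on wt' (snd \<sigma>)" unfolding arg_min_on_eq by simp
  have "greedy wt k (next_state \<sigma> e) = greedy wt' k (next_state \<sigma> e)" for e
    using snd_next_state_subset[of \<sigma> e] by (intro Suc.IH Suc.prems) auto
  then show ?case by (simp add: a)
qed simp

section \<open>Measurability and memorylessness of the exponential clocks\<close>

abbreviation exp1 :: "real measure" where
  "exp1 \<equiv> density lborel (exponential_density 1)"

lemma prob_space_exp1: "prob_space exp1"
  by (rule prob_space_exponential_density) simp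

interpretation exp1: prob_space exp1 by (rule prob_space_exp1)

interpretation exp1P: product_sigma_finite "\<lambda>_ :: edge. exp1"
  by unfold_locales

text \<open>The set of minimizers takes finitely many values, each given by finitely many
  comparisons of coordinates. The codomain is restricted to the possible choices because a
  composition over a countable index set follows, and the type of edges is uncountable.\<close>

lemma measurable_arg_min_on:
  fixes l :: "edge \<Rightarrow> real"
  assumes "finite F" "F \<subseteq> G"
  shows "(\<lambda>X. arg_min_on (\<lambda>e. X e / l e) F) \<in> measurable (Pi\<^sub>M G (\<lambda>_. exp1)) (count_space ((\<lambda>B. SOME x. x \<in> B) ` Pow F))"
proof -
  have [measurable]: "(\<lambda>X. X e) \<in> borel_measurable (Pi\<^sub>M G (\<lambda>_. exp1))" if "e \<in> F" for e
    using that assms measurable_component_singleton[of e G "\<lambda>_. exp1"] by auto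
  have "(\<lambda>X. {x \<in> F. \<forall>y\<in>F. \<not> X y / l y < X x / l x}) \<in> measurable (Pi\<^sub>M G (\<lambda>_. exp1)) (count_space (Pow F))"
  proof (subst measurable_count_space_eq2, use assms in simp, intro conjI ballI)
    fix B assume B: "B \<in> Pow F"
    have "{X \<in> space (Pi\<^sub>M G (\<lambda>_. exp1)). \<forall>x\<in>F. (x \<in> B) = (\<forall>y\<in>F. \<not> X y / l y < X x / l x)} \<in> sets (Pi\<^sub>M G (\<lambda>_. exp1))"
      using assms(1) by measurable
    also have "{X \<in> space (Pi\<^sub>M G (\<lambda>_. exp1)). \<forall>x\<in>F. (x \<in> B) = (\<forall>y\<in>F. \<not> X y / l y < X x / l x)} =
       (\<lambda>X. {x \<in> F. \<forall>y\<in>F. \<not> X y / l y < X x / l x}) -` {B} \<inter> space (Pi\<^sub>M G (\<lambda>_. exp1))"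
      using B by auto
    finally show "(\<lambda>X. {x \<in> F. \<forall>y\<in>F. \<not> X y / l y < X x / l x}) -` {B} \<inter> space (Pi\<^sub>M G (\<lambda>_. exp1)) \<in> sets (Pi\<^sub>M G (\<lambda>_. exp1))" .
  qed auto
  moreover have "(\<lambda>B. SOME x. x \<in> B) \<in> measurable (count_space (Pow F)) (count_space ((\<lambda>B. SOME x. x \<in> B) ` Pow F))"
    by auto
  ultimately show ?thesis unfolding arg_min_on_eq by (rule measurable_compose)
qed

lemma measurable_greedy:
  fixes l :: "edge \<Rightarrow> real"
  assumes "finite (snd \<sigma>)" "snd \<sigma> \<subseteq> G"
  shows "(\<lambda>X. greedy (\<lambda>e. X e / l e) k \<sigma>) \<in> measurable (Pi\<^sub>M G (\<lambda>_. exp1)) (count_space UNIV)"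
  using assms
proof (induction k arbitrary: \<sigma>)
  case (Suc k)
  have fin: "finite (snd (next_state \<sigma> e))" "snd (next_state \<sigma> e) \<subseteq> G" for e
    using Suc.prems snd_next_state_subset[of \<sigma> e] finite_subset by blast+
  show ?case unfolding greedy.simps
    by (rule measurable_compose_countable'[OF _ measurable_arg_min_on[of "snd \<sigma>" G l]])
       (use Suc.prems Suc.IH fin in \<open>auto intro: countable_finite\<close>)
qed simp

text \<open>Memorylessness: a clock exceeds \<open>c\<close> with probability
  \<open>exp (- c)\<close>, and its excess is then again standard exponential.\<close>

lemma nn_integral_exp1_shift:
  assumes [measurable]: "g \<in> borel_measurable borel" and c: "0 \<le> c"
  shows "(\<integral>\<^sup>+ x. indicator {c<..} x * g (x - c) \<partial>exp1) = ennreal (exp (- c)) * (\<integral>\<^sup>+ x. g x \<partial>exp1)"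
proof -
  have "(\<integral>\<^sup>+ x. indicator {c<..} x * g (x - c) \<partial>exp1) =
      (\<integral>\<^sup>+ x. ennreal (exponential_density 1 x) * (indicator {c<..} x * g (x - c)) \<partial>lborel)"
    by (subst nn_integral_density) auto
  also have "\<dots> = (\<integral>\<^sup>+ x. ennreal (exponential_density 1 (c + 1 * x)) * (indicator {c<..} (c + 1 * x) * g (c + 1 * x - c)) \<partial>lborel)"
    by (subst nn_integral_real_affine[where t = c and c = 1]) auto
  also have "\<dots> = (\<integral>\<^sup>+ x. ennreal (exp (- c)) * (ennreal (exponential_density 1 x) * g x) \<partial>lborel)"
  proof (rule nn_integral_cong_AE)
    \<comment> \<open>At 0 the strict indicator vanishes while the density does not; a single point
      is a null set.\<close>
    show "AE x in lborel. ennreal (exponential_density 1 (c + 1 * x)) * (indicator {c<..} (c + 1 * x) * g (c + 1 * x - c)) =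
      ennreal (exp (- c)) * (ennreal (exponential_density 1 x) * g x)"
      using AE_lborel_singleton[of 0]
    proof eventually_elim
      case (elim x)
      show ?case
      proof (cases "0 < x")
        case True
        have "exponential_density 1 (c + x) = exp (- c) * exponential_density 1 x"
          using True c by (simp add: exponential_density_def exp_add[symmetric])
        then show ?thesis using True by (simp add: ennreal_mult' mult.assoc)
      next
        case False
        then have "x < 0" using elim by simp
        then show ?thesis by (simp add: exponential_density_def)
      qed
    qed
  qed
  also have "\<dots> = ennreal (exp (- c)) * (\<integral>\<^sup>+ x. ennreal (exponential_density 1 x) * g x \<partial>lborel)"
    by (rule nn_integral_cmult) auto
  also have "(\<integral>\<^sup>+ x. ennreal (exponential_density 1 x) * g x \<partial>lborel) = (\<integral>\<^sup>+ x. g x \<partial>exp1)"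
    by (subst nn_integral_density) auto
  finally show ?thesis .
qed

text \<open>Each clock has its own offset, because clocks of different rates reach the same time at
  different values of \<open>X f\<close>.\<close>

lemma nn_integral_exp1_shift_PiM:
  assumes "finite G" "\<And>f. f \<in> G \<Longrightarrow> 0 \<le> c f" "h \<in> borel_measurable (Pi\<^sub>M G (\<lambda>_. exp1))"
  shows "(\<integral>\<^sup>+ X. (\<Prod>f\<in>G. indicator {c f<..} (X f)) * h (\<lambda>f\<in>G. X f - c f) \<partial>Pi\<^sub>M G (\<lambda>_ :: edge. exp1)) =
     ennreal (exp (- sum c G)) * (\<integral>\<^sup>+ X. h X \<partial>Pi\<^sub>M G (\<lambda>_. exp1))"
  using assms
proof (induction G arbitrary: h rule: finite_induct)
  case empty
  then show ?case by (simp add: PiM_empty nn_integral_count_space_finite)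
next
  case (insert i I)
  note [measurable] = insert.prems(2)
  have shift[measurable]: "(\<lambda>X. \<lambda>f\<in>insert i I. X f - c f) \<in> measurable (Pi\<^sub>M (insert i I) (\<lambda>_. exp1)) (Pi\<^sub>M (insert i I) (\<lambda>_. exp1))"
    by measurable
  have shiftI[measurable]: "(\<lambda>X. \<lambda>f\<in>I. X f - c f) \<in> measurable (Pi\<^sub>M I (\<lambda>_. exp1)) (Pi\<^sub>M I (\<lambda>_. exp1))"
    by measurable
  have ups: "(\<lambda>y. x(i := y)) \<in> measurable borel (Pi\<^sub>M (insert i I) (\<lambda>_. exp1))" if "x \<in> space (Pi\<^sub>M I (\<lambda>_. exp1))" for x
    using measurable_fun_upd[of "insert i I" I i "\<lambda>_. x" borel "\<lambda>_. exp1" "\<lambda>y. y"] that by (simp add: insert_ident)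
  have h'[measurable]: "(\<lambda>x. \<integral>\<^sup>+ y. h (x(i := y)) \<partial>exp1) \<in> borel_measurable (Pi\<^sub>M I (\<lambda>_. exp1))"
    by measurable
  have "(\<integral>\<^sup>+ X. (\<Prod>f\<in>insert i I. indicator {c f<..} (X f)) * h (\<lambda>f\<in>insert i I. X f - c f) \<partial>Pi\<^sub>M (insert i I) (\<lambda>_. exp1)) =
    (\<integral>\<^sup>+ x. (\<integral>\<^sup>+ y. (\<Prod>f\<in>insert i I. indicator {c f<..} ((x(i := y)) f)) * h (\<lambda>f\<in>insert i I. (x(i := y)) f - c f) \<partial>exp1) \<partial>Pi\<^sub>M I (\<lambda>_. exp1))"
    using insert by (intro exp1P.product_nn_integral_insert) auto
  also have "\<dots> = (\<integral>\<^sup>+ x. ennreal (exp (- c i)) * ((\<Prod>f\<in>I. indicator {c f<..} (x f)) * (\<integral>\<^sup>+ y. h ((\<lambda>f\<in>I. x f - c f)(i := y)) \<partial>exp1)) \<partial>Pi\<^sub>M I (\<lambda>_. exp1))"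
  proof (rule nn_integral_cong)
    fix x assume x: "x \<in> space (Pi\<^sub>M I (\<lambda>_ :: edge. exp1))"
    define x' where "x' = (\<lambda>f\<in>I. x f - c f)"
    have x': "x' \<in> space (Pi\<^sub>M I (\<lambda>_ :: edge. exp1))" unfolding x'_def by (auto simp: space_PiM)
    have [measurable]: "(\<lambda>y. h (x'(i := y))) \<in> borel_measurable borel"
      by (rule measurable_compose[OF ups[OF x'] insert.prems(2)])
    have "(\<lambda>f\<in>insert i I. (x(i := y)) f - c f) = x'(i := y - c i)" for y
      using insert.hyps by (auto simp: x'_def fun_eq_iff)
    moreover have "(\<Prod>f\<in>I. indicator {c f<..} ((x(i := y)) f)) = ((\<Prod>f\<in>I. indicator {c f<..} (x f)) :: ennreal)" for y
      using insert.hyps by (intro prod.cong) auto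
    ultimately have "(\<integral>\<^sup>+ y. (\<Prod>f\<in>insert i I. indicator {c f<..} ((x(i := y)) f)) * h (\<lambda>f\<in>insert i I. (x(i := y)) f - c f) \<partial>exp1) =
       (\<integral>\<^sup>+ y. (\<Prod>f\<in>I. indicator {c f<..} (x f)) * (indicator {c i<..} y * h (x'(i := y - c i))) \<partial>exp1)"
      using insert.hyps by (simp add: mult_ac)
    also have "\<dots> = (\<Prod>f\<in>I. indicator {c f<..} (x f)) * (\<integral>\<^sup>+ y. indicator {c i<..} y * h (x'(i := y - c i)) \<partial>exp1)"
      by (rule nn_integral_cmult) measurable
    also have "(\<integral>\<^sup>+ y. indicator {c i<..} y * h (x'(i := y - c i)) \<partial>exp1) = ennreal (exp (- c i)) * (\<integral>\<^sup>+ y. h (x'(i := y)) \<partial>exp1)"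
      using insert.prems by (intro nn_integral_exp1_shift[where g = "\<lambda>y. h (x'(i := y))"]) auto
    also have "(\<Prod>f\<in>I. indicator {c f<..} (x f)) * (ennreal (exp (- c i)) * (\<integral>\<^sup>+ y. h (x'(i := y)) \<partial>exp1)) =
      ennreal (exp (- c i)) * ((\<Prod>f\<in>I. indicator {c f<..} (x f)) * (\<integral>\<^sup>+ y. h ((\<lambda>f\<in>I. x f - c f)(i := y)) \<partial>exp1))"
      unfolding x'_def by (rule mult.left_commute)
    finally show "(\<integral>\<^sup>+ y. (\<Prod>f\<in>insert i I. indicator {c f<..} ((x(i := y)) f)) * h (\<lambda>f\<in>insert i I. (x(i := y)) f - c f) \<partial>exp1) =
      ennreal (exp (- c i)) * ((\<Prod>f\<in>I. indicator {c f<..} (x f)) * (\<integral>\<^sup>+ y. h ((\<lambda>f\<in>I. x f - c f)(i := y)) \<partial>exp1))" .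
  qed
  also have "\<dots> = ennreal (exp (- c i)) * (\<integral>\<^sup>+ x. (\<Prod>f\<in>I. indicator {c f<..} (x f)) * (\<integral>\<^sup>+ y. h ((\<lambda>f\<in>I. x f - c f)(i := y)) \<partial>exp1) \<partial>Pi\<^sub>M I (\<lambda>_. exp1))"
    using measurable_compose[OF shiftI h'] by (intro nn_integral_cmult) measurable
  also have "(\<integral>\<^sup>+ x. (\<Prod>f\<in>I. indicator {c f<..} (x f)) * (\<integral>\<^sup>+ y. h ((\<lambda>f\<in>I. x f - c f)(i := y)) \<partial>exp1) \<partial>Pi\<^sub>M I (\<lambda>_. exp1)) =
      ennreal (exp (- sum c I)) * (\<integral>\<^sup>+ x. (\<integral>\<^sup>+ y. h (x(i := y)) \<partial>exp1) \<partial>Pi\<^sub>M I (\<lambda>_. exp1))"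
    by (rule insert.IH[OF _ h']) (use insert.prems in auto)
  also have "(\<integral>\<^sup>+ x. (\<integral>\<^sup>+ y. h (x(i := y)) \<partial>exp1) \<partial>Pi\<^sub>M I (\<lambda>_. exp1)) = (\<integral>\<^sup>+ X. h X \<partial>Pi\<^sub>M (insert i I) (\<lambda>_. exp1))"
    using insert by (intro exp1P.product_nn_integral_insert[symmetric]) auto
  finally show ?case using insert.hyps
    by (simp add: mult.assoc[symmetric] ennreal_mult'[symmetric] exp_add[symmetric] add.commute)
qed

text \<open>The integrand is a multiple of the exponential density of rate 1 + r. The value is the
  probability that a clock of rate 1 beats competitors of total rate \<open>r\<close>.\<close>

lemma nn_integral_exp1_exp:
  assumes "0 \<le> r"
  shows "(\<integral>\<^sup>+ y. ennreal (exp (- (y * r))) \<partial>exp1) = ennreal (1 / (1 + r))"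
proof -
  interpret P: prob_space "density lborel (exponential_density (1 + r))"
    using assms by (intro prob_space_exponential_density) simp
  have "(\<integral>\<^sup>+ y. ennreal (exp (- (y * r))) \<partial>exp1) =
      (\<integral>\<^sup>+ y. ennreal (exponential_density 1 y) * ennreal (exp (- (y * r))) \<partial>lborel)"
    by (subst nn_integral_density) auto
  also have "\<dots> = (\<integral>\<^sup>+ y. ennreal (1 / (1 + r)) * ennreal (exponential_density (1 + r) y) \<partial>lborel)"
  proof (rule nn_integral_cong)
    fix y
    have "exponential_density 1 y * exp (- (y * r)) = 1 / (1 + r) * exponential_density (1 + r) y"
      using assms by (simp add: exponential_density_def exp_add[symmetric] distrib_left)
    then show "ennreal (exponential_density 1 y) * ennreal (exp (- (y * r))) = ennreal (1 / (1 + r)) * ennreal (exponential_density (1 + r) y)"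
      using assms by (simp add: ennreal_mult'[symmetric] ennreal_mult''[symmetric])
  qed
  also have "\<dots> = ennreal (1 / (1 + r)) * (\<integral>\<^sup>+ y. 1 \<partial>density lborel (exponential_density (1 + r)))"
    by (subst nn_integral_density) (auto simp: nn_integral_cmult)
  finally show ?thesis using P.emeasure_space_1 by simp
qed

text \<open>\<open>k\<close> counts the rounds still to come, the recursion parameter of
  \<open>greedy\<close> and \<open>kruskal_pmf\<close>.\<close>

definition kruskal_step_inv :: "nat \<Rightarrow> edge set \<Rightarrow> edge set \<times> edge set \<Rightarrow> nat \<Rightarrow> bool" where
  "kruskal_step_inv n E \<sigma> k \<longleftrightarrow> kruskal_inv n E \<sigma> \<and> card (fst \<sigma>) + Suc k = n"

context
  fixes n E assumes con: "connected_graph n E"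
begin

lemma kruskal_step_inv_init: "kruskal_step_inv n E ({}, E) (n - 1)"
  using kruskal_inv_init[OF con] con unfolding kruskal_step_inv_def connected_graph_def by auto

lemma kruskal_step_inv_Suc:
  assumes "kruskal_step_inv n E \<sigma> (Suc k)"
  shows "finite (snd \<sigma>)" "snd \<sigma> \<noteq> {}" "snd \<sigma> \<subseteq> E" "e \<in> snd \<sigma> \<Longrightarrow> kruskal_step_inv n E (next_state \<sigma> e) k"
proof -
  have inv: "kruskal_inv n E \<sigma>" "card (fst \<sigma>) + Suc (Suc k) = n" using assms unfolding kruskal_step_inv_def by auto
  show "finite (snd \<sigma>)" "snd \<sigma> \<subseteq> E"
    using kruskal_inv_finite[OF con inv(1)] inv unfolding kruskal_inv_def by auto
  show "snd \<sigma> \<noteq> {}" using kruskal_inv_nonempty[OF con inv(1)] inv(2) by linarith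
  show "kruskal_step_inv n E (next_state \<sigma> e) k" if "e \<in> snd \<sigma>"
    using kruskal_inv_next[OF con inv(1) that] inv(2) unfolding kruskal_step_inv_def by simp
qed

text \<open>Only the lower bound is proved by induction, on the events that the minimum is attained
  strictly; as both sides have total mass one, this already determines the distribution.\<close>

lemma kruskal_pmf_le_race:
  fixes l :: "edge \<Rightarrow> real"
  assumes pos: "\<And>e. 0 < l e" and "kruskal_step_inv n E \<sigma> k" "finite G" "snd \<sigma> \<subseteq> G"
  shows "ennreal (pmf (kruskal_pmf l k \<sigma>) S) \<le>
    (\<integral>\<^sup>+ X. indicator {X. greedy (\<lambda>e. X e / l e) k \<sigma> = S} X \<partial>Pi\<^sub>M G (\<lambda>_. exp1))"
  using assms(2-)
proof (induction k arbitrary: \<sigma> G)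
  case 0
  interpret P: prob_space "Pi\<^sub>M G (\<lambda>_ :: edge. exp1)" by (rule prob_space_PiM) (rule prob_space_exp1)
  show ?case using P.emeasure_space_1 by (auto simp: indicator_def)
next
  case (Suc k)
  define F where "F = snd \<sigma>"
  note F = kruskal_step_inv_Suc[OF Suc.prems(1), folded F_def]
  have FG: "F \<subseteq> G" using Suc.prems F_def by simp
  let ?M = "\<lambda>G. Pi\<^sub>M G (\<lambda>_ :: edge. exp1)"
  define wt where "wt X e = X e / l e" for X :: "edge \<Rightarrow> real" and e
  \<comment> \<open>The winner is required to be strict, which makes these events disjoint and omits
    ties; a lower bound can afford this.\<close>
  define A where "A e = {X. (\<forall>f\<in>F - {e}. wt X e < wt X f) \<and> greedy (wt X) k (next_state \<sigma> e) = S}" for e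
  have L: "0 < sum l F" using F pos by (simp add: sum_pos)
  have mA: "{X \<in> space (?M G). X \<in> A e} \<in> sets (?M G)" if "e \<in> F" for e
  proof -
    have [measurable]: "(\<lambda>X. X e) \<in> borel_measurable (?M G)" if "e \<in> F" for e
      using that FG measurable_component_singleton[of e G "\<lambda>_. exp1"] by auto
    have [measurable]: "(\<lambda>X. greedy (wt X) k (next_state \<sigma> e)) \<in> measurable (?M G) (count_space UNIV)"
      unfolding wt_def using F FG snd_next_state_subset[of \<sigma> e, folded F_def]
      by (intro measurable_greedy) (auto intro: finite_subset)
    show ?thesis unfolding A_def mem_Collect_eq using that F(1) unfolding wt_def[of _ e] 
      by (subst wt_def) measurable
  qed
  have main: "ennreal (l e / sum l F) * ennreal (pmf (kruskal_pmf l k (next_state \<sigma> e)) S) \<le>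
      (\<integral>\<^sup>+ X. indicator (A e) X \<partial>?M G)" if e: "e \<in> F" for e
  proof -
    \<comment> \<open>Only the clock of the winner is integrated out. The clocks of edges that are
      discarded with it stay in the product, which is why \<open>G\<close> may be larger than
      \<open>F\<close>.\<close>
    define G' where "G' = G - {e}"
    have G: "G = insert e G'" "e \<notin> G'" "finite G'" using e FG Suc.prems unfolding G'_def by auto
    have sub: "snd (next_state \<sigma> e) \<subseteq> F - {e}" "F - {e} \<subseteq> G'"
      using snd_next_state_subset[of \<sigma> e] FG unfolding F_def G'_def by auto
    define h where "h X = (indicator {X. greedy (wt X) k (next_state \<sigma> e) = S} X :: ennreal)" for X
    have mh[measurable]: "h \<in> borel_measurable (?M G')"
    proof -
      have [measurable]: "(\<lambda>X. greedy (wt X) k (next_state \<sigma> e)) \<in> measurable (?M G') (count_space UNIV)"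
        unfolding wt_def using F sub by (intro measurable_greedy) (auto intro: finite_subset)
      have "(\<lambda>X. indicator {S} (greedy (wt X) k (next_state \<sigma> e)) :: ennreal) \<in> borel_measurable (?M G')"
        by (rule measurable_compose[of _ _ "count_space UNIV"]) auto
      moreover have "(\<lambda>X. indicator {S} (greedy (wt X) k (next_state \<sigma> e))) = h"
        by (simp add: h_def indicator_def fun_eq_iff)
      ultimately show ?thesis by simp
    qed
    define p where "p = ennreal (pmf (kruskal_pmf l k (next_state \<sigma> e)) S)"
    define r where "r = sum l (F - {e}) / l e"
    have r0: "0 \<le> r" unfolding r_def using pos by (simp add: sum_nonneg less_imp_le)
    have IH: "p \<le> (\<integral>\<^sup>+ X. h X \<partial>?M G')"
      unfolding p_def h_def wt_def using F(4)[OF e] G sub by (intro Suc.IH) auto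
    have inner: "ennreal (exp (- (y * r))) * p \<le> (\<integral>\<^sup>+ X. indicator (A e) (X(e := y)) \<partial>?M G')" if y: "0 \<le> y" for y
    proof -
      \<comment> \<open>The value of \<open>X f\<close> at the time \<open>y / l e\<close> at which
        the clock of \<open>e\<close> runs out; clocks outside \<open>F\<close> are not
        shifted.\<close>
      define c where "c f = (if f \<in> F - {e} then l f * y / l e else 0)" for f
      have c0: "0 \<le> c f" for f unfolding c_def using y pos by (simp add: less_imp_le)
      have "sum c G' = sum c (F - {e})"
        using G sub by (intro sum.mono_neutral_right) (auto simp: c_def)
      also have "\<dots> = y * r" unfolding r_def c_def by (simp add: sum_distrib_left sum_divide_distrib mult_ac)
      finally have sc: "sum c G' = y * r" .
      have "ennreal (exp (- (y * r))) * p \<le> ennreal (exp (- (y * r))) * (\<integral>\<^sup>+ X. h X \<partial>?M G')"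
        by (intro mult_left_mono IH) simp
      also have "\<dots> = (\<integral>\<^sup>+ X. (\<Prod>f\<in>G'. indicator {c f<..} (X f)) * h (\<lambda>f\<in>G'. X f - c f) \<partial>?M G')"
        using nn_integral_exp1_shift_PiM[of G' c h] G c0 mh sc by simp
      also have "\<dots> \<le> (\<integral>\<^sup>+ X. indicator (A e) (X(e := y)) \<partial>?M G')"
      proof (rule nn_integral_mono)
        fix X :: "edge \<Rightarrow> real"
        show "(\<Prod>f\<in>G'. indicator {c f<..} (X f)) * h (\<lambda>f\<in>G'. X f - c f) \<le> indicator (A e) (X(e := y))"
        proof (cases "(\<forall>f\<in>G'. c f < X f) \<and> h (\<lambda>f\<in>G'. X f - c f) \<noteq> 0")
          case False
          then have z: "(\<Prod>f\<in>G'. indicator {c f<..} (X f)) * h (\<lambda>f\<in>G'. X f - c f) = 0"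
          proof (cases "\<forall>f\<in>G'. c f < X f")
            case False
            then have "\<exists>f\<in>G'. indicator {c f<..} (X f) = (0 :: ennreal)" by (auto simp: indicator_def)
            then have "(\<Prod>f\<in>G'. indicator {c f<..} (X f)) = (0 :: ennreal)" by (rule prod_zero[OF G(3)])
            then show ?thesis by simp
          qed simp
          show ?thesis unfolding z by (rule zero_le)
        next
          case True
          then have gr: "greedy (wt (\<lambda>f\<in>G'. X f - c f)) k (next_state \<sigma> e) = S" unfolding h_def by (auto simp: indicator_def split: if_splits)
          have lt: "y / l e < X f / l f" if "f \<in> F - {e}" for f
          proof -
            have "c f < X f" using True that sub by blast
            then have "l f * y / l e < X f" using that by (simp add: c_def)
            then have "(y / l e) * l f < X f" by (simp add: mult.commute)
            then show ?thesis using pos[of f] by (simp add: pos_less_divide_eq)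
          qed
          \<comment> \<open>The offsets lower all noisy weights still in the race by the same amount
            \<open>y / l e\<close>, so the later selections do not change.\<close>
          have "greedy (wt (X(e := y))) k (next_state \<sigma> e) = greedy (wt (\<lambda>f\<in>G'. X f - c f)) k (next_state \<sigma> e)"
          proof (rule greedy_order_cong)
            fix f f' assume "f \<in> snd (next_state \<sigma> e)" "f' \<in> snd (next_state \<sigma> e)"
            then have ff: "f \<in> F - {e}" "f' \<in> F - {e}" using sub by auto
            have "wt (\<lambda>f\<in>G'. X f - c f) g = wt (X(e := y)) g - y / l e" if "g \<in> F - {e}" for g
              using that sub pos[of g] by (auto simp: wt_def c_def field_simps)
            then show "wt (X(e := y)) f < wt (X(e := y)) f' \<longleftrightarrow> wt (\<lambda>f\<in>G'. X f - c f) f < wt (\<lambda>f\<in>G'. X f - c f) f'"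
              using ff by simp
          qed
          then have "X(e := y) \<in> A e" unfolding A_def using lt gr by (auto simp: wt_def)
          moreover have "h (\<lambda>f\<in>G'. X f - c f) \<le> 1" unfolding h_def by (simp add: indicator_def)
          moreover have "(\<Prod>f\<in>G'. indicator {c f<..} (X f)) \<le> (1 :: ennreal)" by (rule prod_le_1) (auto simp: indicator_def)
          ultimately show ?thesis by (auto intro: mult_le_one)
        qed
      qed
      finally show ?thesis .
    qed
    have "l e / sum l F = 1 / (1 + r)"
      using F e pos[of e] L unfolding r_def by (simp add: sum.remove[of F e] field_simps)
    then have "ennreal (l e / sum l F) * p = (\<integral>\<^sup>+ y. ennreal (exp (- (y * r))) \<partial>exp1) * p"
      using nn_integral_exp1_exp[OF r0] by simp
    also have "\<dots> = (\<integral>\<^sup>+ y. ennreal (exp (- (y * r))) * p \<partial>exp1)"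
      by (rule nn_integral_multc[symmetric]) simp
    also have "\<dots> \<le> (\<integral>\<^sup>+ y. (\<integral>\<^sup>+ X. indicator (A e) (X(e := y)) \<partial>?M G') \<partial>exp1)"
    proof (rule nn_integral_mono_AE)
      have "AE y in exp1. 0 \<le> y"
        by (subst AE_density) (auto simp: exponential_density_def)
      then show "AE y in exp1. ennreal (exp (- (y * r))) * p \<le> (\<integral>\<^sup>+ X. indicator (A e) (X(e := y)) \<partial>?M G')"
        by eventually_elim (rule inner)
    qed
    also have "\<dots> = (\<integral>\<^sup>+ X. indicator (A e) X \<partial>?M G)"
      unfolding G(1) using mA[OF e] G 
      by (intro exp1P.product_nn_integral_insert_rev[symmetric]) (auto simp: borel_measurable_indicator_iff Int_def conj_commute)
    finally show ?thesis unfolding p_def .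
  qed
  have "ennreal (pmf (kruskal_pmf l (Suc k) \<sigma>) S) = ennreal (\<Sum>e\<in>F. l e / sum l F * pmf (kruskal_pmf l k (next_state \<sigma> e)) S)"
  proof -
    have "measure_pmf.expectation (pick l F) (\<lambda>e. pmf (kruskal_pmf l k (next_state \<sigma> e)) S) =
        (\<Sum>e\<in>F. pmf (kruskal_pmf l k (next_state \<sigma> e)) S * pmf (pick l F) e)"
      using set_pmf_pick[of F l, OF F(1,2) pos] F(1) by (intro integral_measure_pmf_real) auto
    also have "\<dots> = (\<Sum>e\<in>F. l e / sum l F * pmf (kruskal_pmf l k (next_state \<sigma> e)) S)"
      using pmf_pick[of F l, OF F(1,2) pos] by (intro sum.cong) auto
    finally show ?thesis by (simp add: pmf_bind F_def[symmetric])
  qed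
  also have "\<dots> = (\<Sum>e\<in>F. ennreal (l e / sum l F * pmf (kruskal_pmf l k (next_state \<sigma> e)) S))"
    using pos L by (intro sum_ennreal[symmetric]) (auto simp: less_imp_le)
  also have "\<dots> = (\<Sum>e\<in>F. ennreal (l e / sum l F) * ennreal (pmf (kruskal_pmf l k (next_state \<sigma> e)) S))"
    using pos L by (intro sum.cong refl ennreal_mult') (auto simp: less_imp_le)
  also have "\<dots> \<le> (\<Sum>e\<in>F. (\<integral>\<^sup>+ X. indicator (A e) X \<partial>?M G))" by (rule sum_mono) (rule main)
  also have "\<dots> = (\<integral>\<^sup>+ X. (\<Sum>e\<in>F. indicator (A e) X) \<partial>?M G)"
    using mA by (intro nn_integral_sum[symmetric]) (auto simp: borel_measurable_indicator_iff Int_def conj_commute)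
  also have "\<dots> \<le> (\<integral>\<^sup>+ X. indicator {X. greedy (wt X) (Suc k) \<sigma> = S} X \<partial>?M G)"
  proof (rule nn_integral_mono)
    fix X
    show "(\<Sum>e\<in>F. indicator (A e) X) \<le> (indicator {X. greedy (wt X) (Suc k) \<sigma> = S} X :: ennreal)"
    proof (cases "\<exists>e\<in>F. X \<in> A e")
      case False
      then show ?thesis by (simp add: indicator_def)
    next
      case True
      then obtain e where e: "e \<in> F" "X \<in> A e" by blast
      have other: "X \<notin> A f" if "f \<in> F" "f \<noteq> e" for f
      proof
        assume "X \<in> A f"
        then have "wt X f < wt X e" "wt X e < wt X f" using that e unfolding A_def by auto
        then show False by simp
      qed
      have "(\<Sum>f\<in>F. indicator (A f) X) = (\<Sum>f\<in>F. if f = e then 1 else 0 :: ennreal)"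
        using e other by (intro sum.cong) (auto simp: indicator_def)
      also have "\<dots> = 1" using e F(1) by simp
      finally have s1: "(\<Sum>f\<in>F. indicator (A f) X) = (1 :: ennreal)" .
      have "{x \<in> F. \<forall>y\<in>F. \<not> wt X y < wt X x} = {e}"
      proof (intro set_eqI iffI)
        fix x assume "x \<in> {x \<in> F. \<forall>y\<in>F. \<not> wt X y < wt X x}"
        then show "x \<in> {e}" using e unfolding A_def by auto
      next
        fix x assume "x \<in> {e}"
        then show "x \<in> {x \<in> F. \<forall>y\<in>F. \<not> wt X y < wt X x}" using e unfolding A_def
          by (auto simp: not_less) (metis DiffI empty_iff insert_iff less_imp_le order_refl)
      qed
      then have "arg_min_on (wt X) (snd \<sigma>) = e" unfolding arg_min_on_eq F_def[symmetric] by simp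
      then have "greedy (wt X) (Suc k) \<sigma> = S" using e unfolding A_def by simp
      then show ?thesis using s1 by simp
    qed
  qed
  finally show ?case unfolding wt_def .
qed

text \<open>The race dominates \<open>kruskal_pmf\<close> on every event. Both have total mass one,
  so passing to complements turns domination into equality.\<close>

lemma opk_eq_pmf:
  "opk n E \<epsilon> \<delta> w = measure_pmf (map_pmf fst (kruskal_pmf (\<lambda>e. exp (- (step_eps n \<epsilon> \<delta> / 2) * w e)) (n - 1) ({}, E)))"
proof -
  define l where "l e = exp (- (step_eps n \<epsilon> \<delta> / 2) * w e)" for e
  let ?M = "Pi\<^sub>M E (\<lambda>_ :: edge. exp1)"
  interpret P: prob_space ?M by (rule prob_space_PiM) (rule prob_space_exp1)
  define K where "K = kruskal_pmf l (n - 1) ({}, E)"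
  define g where "g X = greedy (\<lambda>e. X e / l e) (n - 1) ({}, E)" for X
  have finE: "finite E" using finite_edges[OF con] .
  have mg[measurable]: "g \<in> measurable ?M (count_space UNIV)"
    unfolding g_def by (rule measurable_greedy) (use finE in auto)
  define D where "D = distr ?M (count_space UNIV) g"
  interpret D: prob_space D unfolding D_def by (rule P.prob_space_distr) (rule mg)
  have le1: "ennreal (pmf K S) \<le> emeasure D {S}" for S
  proof -
    have "ennreal (pmf K S) \<le> (\<integral>\<^sup>+ X. indicator {X. greedy (\<lambda>e. X e / l e) (n - 1) ({}, E) = S} X \<partial>?M)"
      unfolding K_def using kruskal_step_inv_init finE by (intro kruskal_pmf_le_race) (auto simp: l_def)
    also have "\<dots> = (\<integral>\<^sup>+ X. indicator {S} (g X) \<partial>?M)" by (simp add: g_def indicator_def)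
    also have "\<dots> = (\<integral>\<^sup>+ \<sigma>. indicator {S} \<sigma> \<partial>D)" unfolding D_def by (rule nn_integral_distr[symmetric]) auto
    also have "\<dots> = emeasure D {S}" unfolding D_def by (rule nn_integral_indicator) simp
    finally show ?thesis .
  qed
  have sD: "sets D = UNIV" "space D = UNIV" unfolding D_def by auto
  \<comment> \<open>The type of states is uncountable, hence point masses are summed over the
    countable support of \<open>K\<close> only.\<close>
  have le: "emeasure K Z \<le> emeasure D Z" for Z
  proof -
    have "emeasure K Z = emeasure K (Z \<inter> set_pmf K)" by (simp add: emeasure_Int_set_pmf)
    also have "\<dots> = (\<integral>\<^sup>+ S. emeasure K {S} \<partial>count_space (Z \<inter> set_pmf K))"
      by (rule emeasure_countable_singleton) auto
    also have "\<dots> \<le> (\<integral>\<^sup>+ S. emeasure D {S} \<partial>count_space (Z \<inter> set_pmf K))"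
      using le1 by (intro nn_integral_mono) (simp add: emeasure_pmf_single)
    also have "\<dots> = emeasure D (Z \<inter> set_pmf K)"
      by (rule emeasure_countable_singleton[symmetric]) (auto simp: sD)
    also have "\<dots> \<le> emeasure D Z" by (rule emeasure_mono) (auto simp: sD)
    finally show ?thesis .
  qed
  have "measure_pmf K = D"
  proof (rule measure_eqI)
    fix Z assume "Z \<in> sets (measure_pmf K)"
    have a: "measure K Z \<le> measure D Z" for Z
      using le[of Z] by (simp add: measure_pmf.emeasure_eq_measure D.emeasure_eq_measure)
    have "measure K (- Z) = 1 - measure K Z" using measure_pmf.prob_compl[of Z K] by (simp add: Compl_eq_Diff_UNIV)
    moreover have "measure D (- Z) = 1 - measure D Z" using D.prob_compl[of Z] sD by (simp add: Compl_eq_Diff_UNIV)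
    ultimately have "measure K Z = measure D Z" using a[of Z] a[of "- Z"] by linarith
    then show "emeasure K Z = emeasure D Z" by (simp add: measure_pmf.emeasure_eq_measure D.emeasure_eq_measure)
  qed (simp add: sD)
  have "opk_tree n E \<epsilon> \<delta> w = (\<lambda>X. fst (g X))"
  proof
    fix X
    have "noisy_weight n \<epsilon> \<delta> w X = (\<lambda>e. X e / l e)" by (simp add: noisy_weight_def l_def fun_eq_iff)
    then show "opk_tree n E \<epsilon> \<delta> w X = fst (g X)"
      using greedy_kruskal_state[of "\<lambda>e. X e / l e" "n - 1" E 0] by (simp add: opk_tree_def g_def)
  qed
  then have "opk n E \<epsilon> \<delta> w = distr D (count_space UNIV) fst"
    unfolding opk_def D_def by (subst distr_distr) (auto simp: comp_def)
  also have "\<dots> = measure_pmf (map_pmf fst K)"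
    unfolding \<open>measure_pmf K = D\<close>[symmetric] map_pmf_rep_eq ..
  finally show ?thesis unfolding K_def l_def .
qed

end

section \<open>Privacy\<close>

text \<open>The lemma for centred variables, with the mean split off as a factor.\<close>

lemma pmf_hoeffding:
  fixes p :: "'a pmf" and f :: "'a \<Rightarrow> real"
  assumes fin: "finite (set_pmf p)" and f: "\<And>x. x \<in> set_pmf p \<Longrightarrow> f x \<in> {a..b}" and s: "0 < s"
  shows "measure_pmf.expectation p (\<lambda>x. exp (s * f x)) \<le>
    exp (s * measure_pmf.expectation p f + s\<^sup>2 * (b - a)\<^sup>2 / 8)"
proof -
  interpret interval_bounded_random_variable "measure_pmf p" f a b
    by unfold_locales (use f in \<open>auto simp: AE_measure_pmf_iff\<close>)
  define m where "m = measure_pmf.expectation p f"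
  have "ennreal (measure_pmf.expectation p (\<lambda>x. exp (s * (f x - m)))) = (\<integral>\<^sup>+ x. exp (s * (f x - m)) \<partial>p)"
    by (intro nn_integral_eq_integral[symmetric] integrable_measure_pmf_finite fin) auto
  also have "\<dots> \<le> ennreal (exp (s\<^sup>2 * (b - a)\<^sup>2 / 8))"
    unfolding m_def using Hoeffdings_lemma_nn_integral[OF s] by simp
  finally have "measure_pmf.expectation p (\<lambda>x. exp (s * (f x - m))) \<le> exp (s\<^sup>2 * (b - a)\<^sup>2 / 8)"
    by simp
  then have "exp (s * m) * measure_pmf.expectation p (\<lambda>x. exp (s * (f x - m))) \<le> exp (s * m) * exp (s\<^sup>2 * (b - a)\<^sup>2 / 8)"
    by (intro mult_left_mono) auto
  also have "exp (s * m) * measure_pmf.expectation p (\<lambda>x. exp (s * (f x - m))) = measure_pmf.expectation p (\<lambda>x. exp (s * f x))"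
    by (subst integral_mult_right_zero[symmetric]) (simp add: exp_add[symmetric] algebra_simps)
  finally show ?thesis by (simp add: m_def exp_add)
qed

lemma expectation_pick:
  fixes h :: "edge \<Rightarrow> real"
  assumes "finite F" "F \<noteq> {}" "\<And>e. 0 < l e"
  shows "measure_pmf.expectation (pick l F) h = (\<Sum>e\<in>F. l e / sum l F * h e)"
proof -
  have "measure_pmf.expectation (pick l F) h = (\<Sum>e\<in>F. h e * pmf (pick l F) e)"
    using set_pmf_pick[of F l] assms by (intro integral_measure_pmf_real) auto
  then show ?thesis using pmf_pick[of F l, OF assms] by (auto intro!: sum.cong)
qed

text \<open>Under \<open>pick l F\<close> the privacy loss has range \<open>2 * \<eta>\<close>. Since the expectation of its negated
  exponential is one, Hoeffding's lemma also bounds its mean, by \<open>\<eta>\<^sup>2 / 2\<close>.\<close>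

lemma pick_renyi:
  fixes l l' :: "edge \<Rightarrow> real"
  assumes F: "finite F" "F \<noteq> {}" and l: "\<And>e. 0 < l e" and l': "\<And>e. 0 < l' e"
    and close: "\<And>e. e \<in> F \<Longrightarrow> \<bar>ln (l e) - ln (l' e)\<bar> \<le> \<eta>" and s: "0 < s"
  shows "(\<Sum>e\<in>F. l e / sum l F * ((l e / sum l F) / (l' e / sum l' F)) powr s) \<le> exp ((s + s\<^sup>2) * \<eta>\<^sup>2 / 2)"
proof -
  have S: "0 < sum l F" "0 < sum l' F" using F l l' by (simp_all add: sum_pos)
  \<comment> \<open>Changing the normalizing sum translates the range of the loss but does not widen
    it. Bounding both quotients separately would double the length.\<close>
  define c where "c = ln (sum l F / sum l' F)"
  define L where "L e = ln ((l e / sum l F) / (l' e / sum l' F))" for e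
  have L_eq: "L e = ln (l e) - ln (l' e) - c" for e
    using l[of e] l'[of e] S unfolding L_def c_def by (simp add: ln_div ln_mult)
  have bd: "L e \<in> {- \<eta> - c..\<eta> - c}" "- L e \<in> {c - \<eta>..c + \<eta>}" if "e \<in> F" for e
    using close[OF that] unfolding L_eq by auto
  have sp: "set_pmf (pick l F) = F" using set_pmf_pick[of F l] F l by blast
  let ?E = "measure_pmf.expectation (pick l F)"
  have eL: "exp (L e) = (l e / sum l F) / (l' e / sum l' F)" for e
    unfolding L_def using l[of e] l'[of e] S by (intro exp_ln) auto
  have "1 = (\<Sum>e\<in>F. l' e / sum l' F)" using S by (simp add: sum_divide_distrib[symmetric])
  also have "\<dots> = (\<Sum>e\<in>F. l e / sum l F * exp (1 * - L e))"
  proof (rule sum.cong)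
    fix e
    show "l' e / sum l' F = l e / sum l F * exp (1 * - L e)"
      using l[of e] l'[of e] S by (simp add: exp_minus eL field_simps)
  qed simp
  also have "\<dots> = ?E (\<lambda>e. exp (1 * - L e))" by (rule expectation_pick[symmetric]) (use F l in auto)
  also have "\<dots> \<le> exp (1 * ?E (\<lambda>e. - L e) + 1\<^sup>2 * (c + \<eta> - (c - \<eta>))\<^sup>2 / 8)"
    by (rule pmf_hoeffding) (use F sp bd in auto)
  finally have "0 \<le> ?E (\<lambda>e. - L e) + (2 * \<eta>)\<^sup>2 / 8" by simp
  then have mean: "?E L \<le> \<eta>\<^sup>2 / 2" by (simp add: power2_eq_square)
  have "(\<Sum>e\<in>F. l e / sum l F * ((l e / sum l F) / (l' e / sum l' F)) powr s) = (\<Sum>e\<in>F. l e / sum l F * exp (s * L e))"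
  proof (rule sum.cong)
    fix e
    have "(l e / sum l F) / (l' e / sum l' F) \<noteq> 0" using l[of e] l'[of e] S by auto
    then show "l e / sum l F * ((l e / sum l F) / (l' e / sum l' F)) powr s = l e / sum l F * exp (s * L e)"
      by (simp only: powr_def L_def if_False)
  qed simp
  also have "\<dots> = ?E (\<lambda>e. exp (s * L e))" by (rule expectation_pick[symmetric]) (use F l in auto)
  also have "\<dots> \<le> exp (s * ?E L + s\<^sup>2 * (\<eta> - c - (- \<eta> - c))\<^sup>2 / 8)"
    by (rule pmf_hoeffding) (use F sp bd s in auto)
  \<comment> \<open>\<open>s * \<eta>\<^sup>2 / 2\<close> comes from the mean,
    \<open>s\<^sup>2 * (2 * \<eta>)\<^sup>2 / 8\<close> from Hoeffding's lemma.\<close>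
  also have "\<dots> \<le> exp ((s + s\<^sup>2) * \<eta>\<^sup>2 / 2)"
    using mult_left_mono[OF mean, of s] s by (simp add: power2_eq_square field_simps)
  finally show ?thesis .
qed

lemma measure_bind_pick:
  assumes "finite F" "F \<noteq> {}" "\<And>e. 0 < l e"
  shows "measure (bind_pmf (pick l F) K) Z = (\<Sum>e\<in>F. l e / sum l F * measure (K e) Z)"
proof -
  have "measure (bind_pmf (pick l F) K) Z = measure_pmf.expectation (pick l F) (\<lambda>e. measure (K e) Z)"
    unfolding measure_pmf_bind
    by (subst measure_pmf.measure_bind[where N = "count_space UNIV"])
       (auto simp: measure_subprob space_subprob_algebra intro!: prob_space_imp_subprob_space measure_pmf.prob_space_axioms)
  then show ?thesis using expectation_pick[OF assms] by simp
qed

context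
  fixes n E assumes con: "connected_graph n E"
begin

text \<open>The factor \<open>a\<close> is arbitrary, so that a step that picks \<open>e\<close> can use the induction hypothesis with
  \<open>a\<close> multiplied by the ratio of the two probabilities of \<open>e\<close>.\<close>

lemma measure_kruskal_pmf_le:
  assumes l: "\<And>e. 0 < l e" and l': "\<And>e. 0 < l' e"
    and close: "\<And>e. e \<in> E \<Longrightarrow> \<bar>ln (l e) - ln (l' e)\<bar> \<le> \<eta>" and s: "0 < s"
    and M: "M = exp ((s + s\<^sup>2) * \<eta>\<^sup>2 / 2)"
    and inv: "kruskal_step_inv n E \<sigma> k" and a: "0 < a"
  shows "measure (kruskal_pmf l k \<sigma>) Z \<le> a * measure (kruskal_pmf l' k \<sigma>) Z + a powr (- s) * M ^ k"
  using inv a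
proof (induction k arbitrary: \<sigma> a)
  case 0
  \<comment> \<open>The pointwise Chernoff bound: an outcome in \<open>Z\<close> is covered by the
    first term if a is at least 1, and by the penalty term otherwise.\<close>
  have "1 \<le> a + a powr (- s)"
  proof (cases "1 \<le> a")
    case True
    then show ?thesis by (simp add: add_increasing2)
  next
    case False
    then have "1 \<le> a powr (- s)" using 0 s powr_mono'[of "- s" 0 a] by simp
    then show ?thesis using 0 by simp
  qed
  then show ?case using 0 by (simp add: indicator_def)
next
  case (Suc k)
  define F where "F = snd \<sigma>"
  note F = kruskal_step_inv_Suc[OF con Suc.prems(1), folded F_def]
  have S: "0 < sum l F" "0 < sum l' F" using F l l' by (simp_all add: sum_pos)
  define p where "p e = l e / sum l F" for e
  define p' where "p' e = l' e / sum l' F" for e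
  have pp: "0 < p e" "0 < p' e" for e using l[of e] l'[of e] S unfolding p_def p'_def by auto
  have M0: "0 \<le> M" using M by simp
  let ?m = "\<lambda>l e. measure (kruskal_pmf l k (next_state \<sigma> e)) Z"
  have "measure (kruskal_pmf l (Suc k) \<sigma>) Z = (\<Sum>e\<in>F. p e * ?m l e)"
    unfolding p_def kruskal_pmf.simps F_def[symmetric] using F(1,2) l by (rule measure_bind_pick)
  \<comment> \<open>In the first term \<open>p e\<close> cancels against the new multiplier, leaving
    one step of the process with rates \<open>l'\<close>; the second term collects the s-th moment
    of the likelihood ratio.\<close>
  also have "\<dots> \<le> (\<Sum>e\<in>F. p e * ((a * p' e / p e) * ?m l' e + (a * p' e / p e) powr (- s) * M ^ k))"
    using Suc.prems pp F(4) by (intro sum_mono mult_left_mono Suc.IH) (auto simp: less_imp_le)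
  also have "\<dots> = (\<Sum>e\<in>F. a * (p' e * ?m l' e) + a powr (- s) * M ^ k * (p e * (p e / p' e) powr s))"
  proof (rule sum.cong)
    fix e
    have "(a * p' e / p e) powr (- s) = a powr (- s) * (p' e / p e) powr (- s)"
      using pp[of e] Suc.prems by (simp add: powr_mult[symmetric])
    also have "(p' e / p e) powr (- s) = (p e / p' e) powr s"
      using pp[of e] by (simp add: powr_minus powr_divide)
    finally show "p e * ((a * p' e / p e) * ?m l' e + (a * p' e / p e) powr (- s) * M ^ k) =
        a * (p' e * ?m l' e) + a powr (- s) * M ^ k * (p e * (p e / p' e) powr s)"
      using pp[of e] by (simp add: field_simps)
  qed simp
  also have "\<dots> = a * (\<Sum>e\<in>F. p' e * ?m l' e) + a powr (- s) * M ^ k * (\<Sum>e\<in>F. p e * (p e / p' e) powr s)"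
    by (simp add: sum.distrib sum_distrib_left)
  also have "(\<Sum>e\<in>F. p' e * ?m l' e) = measure (kruskal_pmf l' (Suc k) \<sigma>) Z"
    unfolding p'_def kruskal_pmf.simps F_def[symmetric] using F(1,2) l' by (rule measure_bind_pick[symmetric])
  also have "a powr (- s) * M ^ k * (\<Sum>e\<in>F. p e * (p e / p' e) powr s) \<le> a powr (- s) * M ^ k * M"
    unfolding p_def p'_def M using F(3) by (intro mult_left_mono pick_renyi[OF F(1,2) l l' _ s] close) auto
  finally show ?case by (simp add: mult_ac)
qed

text \<open>The composition bound is applied with multiplier exp \<epsilon>, and the chosen
  \<open>s\<close> brings the penalty term below \<delta>. This needs L > 0; for \<delta> at least 1
  the claim is that a probability is at most 1.\<close>

lemma opk_private:
  assumes eps: "0 < \<epsilon>" and delta: "0 < \<delta>"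
  shows "differentially_private n E \<epsilon> \<delta> (opk n E \<epsilon> \<delta>)"
  unfolding differentially_private_def
proof (intro allI impI)
  fix w w' Z
  assume nb: "neighboring E w w'"
  define l where "l w e = exp (- (step_eps n \<epsilon> \<delta> / 2) * w e)" for w :: "edge \<Rightarrow> real" and e
  define K where "K w = kruskal_pmf (l w) (n - 1) ({}, E)" for w
  have mo: "measure (opk n E \<epsilon> \<delta> w) Z = measure (K w) (fst -` Z)" for w
    unfolding opk_eq_pmf[OF con] K_def l_def by (simp add: measure_map_pmf)
  show "measure (opk n E \<epsilon> \<delta> w) Z \<le> exp \<epsilon> * measure (opk n E \<epsilon> \<delta> w') Z + \<delta>"
  proof (cases "1 \<le> \<delta>")
    case True
    then have "measure (K w) (fst -` Z) \<le> \<delta>" using measure_pmf.prob_le_1[of "K w"] by (meson order_trans)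
    then show ?thesis unfolding mo by (simp add: add_increasing)
  next
    case False
    define L where "L = ln (1 / \<delta>)"
    have L: "0 < L" using False delta unfolding L_def by simp
    define r where "r = sqrt (\<epsilon> + L) - sqrt L"
    have r: "0 < r" using eps L unfolding r_def by simp
    have rho: "priv_rho \<epsilon> \<delta> = r\<^sup>2" unfolding priv_rho_def r_def L_def ..
    have eps_eq: "\<epsilon> = r\<^sup>2 + 2 * r * sqrt L"
    proof -
      have "(r + sqrt L)\<^sup>2 = \<epsilon> + L" unfolding r_def using eps L by simp
      moreover have "(sqrt L)\<^sup>2 = L" using L by simp
      ultimately show ?thesis by (simp add: power2_sum)
    qed
    define s where "s = sqrt L / r"
    have s: "0 < s" unfolding s_def using L r by simp
    \<comment> \<open>The rates are \<open>exp (- \<eta> * w e)\<close>, so their logarithms differ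
      by at most this much for neighboring weights.\<close>
    define \<eta> where "\<eta> = step_eps n \<epsilon> \<delta> / 2"
    have n1: "1 \<le> n" using con unfolding connected_graph_def by simp
    have eta0: "0 \<le> \<eta>" unfolding \<eta>_def step_eps_def rho using n1 by simp
    have eta: "real (n - 1) * \<eta>\<^sup>2 \<le> r\<^sup>2 / 2"
    proof (cases "n = 1")
      case False
      then have "\<eta>\<^sup>2 = (2 * r\<^sup>2 / (real n - 1)) / 4"
        using n1 unfolding \<eta>_def step_eps_def rho by (simp add: power_divide)
      then show ?thesis using False n1 by (simp add: of_nat_diff field_simps)
    qed simp
    define M where "M = exp ((s + s\<^sup>2) * \<eta>\<^sup>2 / 2)"
    have close: "\<bar>ln (l w e) - ln (l w' e)\<bar> \<le> \<eta>" if "e \<in> E" for e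
    proof -
      have "ln (l w e) - ln (l w' e) = \<eta> * (w' e - w e)" unfolding l_def \<eta>_def by (simp add: algebra_simps)
      then have "\<bar>ln (l w e) - ln (l w' e)\<bar> = \<eta> * \<bar>w e - w' e\<bar>" using eta0 by (simp add: abs_mult abs_minus_commute)
      also have "\<dots> \<le> \<eta> * 1" using nb that eta0 unfolding neighboring_def by (intro mult_left_mono) auto
      finally show ?thesis by simp
    qed
    have main: "measure (K w) (fst -` Z) \<le> exp \<epsilon> * measure (K w') (fst -` Z) + exp \<epsilon> powr (- s) * M ^ (n - 1)"
      unfolding K_def
      by (rule measure_kruskal_pmf_le[OF _ _ close s M_def kruskal_step_inv_init[OF con]]) (auto simp: l_def)
    have "exp \<epsilon> powr (- s) * M ^ (n - 1) = exp (- (s * \<epsilon>) + real (n - 1) * ((s + s\<^sup>2) * \<eta>\<^sup>2 / 2))"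
      unfolding M_def by (simp add: powr_def exp_of_nat_mult[symmetric] mult_exp_exp)
    also have "\<dots> \<le> exp (- L)"
    proof -
      have "real (n - 1) * ((s + s\<^sup>2) * \<eta>\<^sup>2 / 2) = (s + s\<^sup>2) / 2 * (real (n - 1) * \<eta>\<^sup>2)" by simp
      also have "\<dots> \<le> (s + s\<^sup>2) / 2 * (r\<^sup>2 / 2)" using eta s by (intro mult_left_mono) auto
      \<comment> \<open>A factor of four is given away, which leaves exactly the quantity that falls
        short of \<open>s * \<epsilon>\<close> by \<open>L\<close>.\<close>
      also have "\<dots> \<le> (s + s\<^sup>2) * r\<^sup>2" using s by (simp add: field_simps)
      also have "(s + s\<^sup>2) * r\<^sup>2 = r * sqrt L + L" unfolding s_def using r L by (simp add: field_simps power2_eq_square)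
      finally have "real (n - 1) * ((s + s\<^sup>2) * \<eta>\<^sup>2 / 2) \<le> r * sqrt L + L" .
      moreover have "s * \<epsilon> = r * sqrt L + 2 * L"
        unfolding eps_eq s_def using r L by (simp add: field_simps power2_eq_square)
      ultimately show ?thesis by simp
    qed
    also have "\<dots> = \<delta>" unfolding L_def using delta by (simp add: ln_div)
    finally show ?thesis using main unfolding mo by linarith
  qed
qed

section \<open>Utility\<close>

text \<open>The normalizing sum contains the term of a minimizer, so
  \<open>\<eta> * (w e - m)\<close> is at most the negated logarithm of the probability of
  \<open>e\<close>. The scaled mean excess is thus at most the entropy of the selection, hence at
  most ln |F|.\<close>

lemma pick_gap:
  fixes w :: "edge \<Rightarrow> real"
  assumes F: "finite F" "F \<noteq> {}" and eta: "0 < \<eta>"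
  defines "l \<equiv> \<lambda>e. exp (- \<eta> * w e)"
  shows "(\<Sum>e\<in>F. l e / sum l F * (w e - Min (w ` F))) \<le> ln (real (card F)) / \<eta>"
proof -
  define m where "m = Min (w ` F)"
  define N where "N = real (card F)"
  have N: "0 < N" unfolding N_def using F by (simp add: card_gt_0_iff)
  have S: "0 < sum l F" using F by (intro sum_pos) (auto simp: l_def)
  define p where "p e = l e / sum l F" for e
  have p: "0 < p e" for e using S unfolding p_def l_def by simp
  have p1: "sum p F = 1" unfolding p_def using S by (simp add: sum_divide_distrib[symmetric])
  have "m \<in> w ` F" unfolding m_def using F by (intro Min_in) auto
  then obtain e0 where e0: "e0 \<in> F" "w e0 = m" by auto
  have "l e0 \<le> sum l F" using F e0 by (intro member_le_sum) (auto simp: l_def)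
  then have lnS: "- \<eta> * m \<le> ln (sum l F)" using ln_mono[of "l e0" "sum l F"] S e0 by (simp add: l_def)
  have summand: "\<eta> * (p e * (w e - m)) \<le> 1 / N - p e + p e * ln N" for e
  proof -
    have "ln (p e) = - \<eta> * w e - ln (sum l F)" unfolding p_def using S by (simp add: ln_div l_def)
    then have "\<eta> * (w e - m) \<le> - ln (p e)" using lnS by (simp add: algebra_simps)
    also have "\<dots> = ln (1 / (N * p e)) + ln N" using N p[of e] by (simp add: ln_div ln_mult)
    \<comment> \<open>Termwise comparison with the uniform distribution, whose entropy is ln
      N.\<close>
    also have "ln (1 / (N * p e)) \<le> 1 / (N * p e) - 1" using N p[of e] by (intro ln_le_minus_one) simp
    finally have "\<eta> * (w e - m) \<le> 1 / (N * p e) - 1 + ln N" by simp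
    then have "p e * (\<eta> * (w e - m)) \<le> p e * (1 / (N * p e) - 1 + ln N)" using p[of e] by (intro mult_left_mono) auto
    also have "\<dots> = 1 / N - p e + p e * ln N" using N p[of e] by (simp add: field_simps)
    finally show ?thesis by (simp add: mult_ac)
  qed
  have "\<eta> * (\<Sum>e\<in>F. p e * (w e - m)) \<le> (\<Sum>e\<in>F. 1 / N - p e + p e * ln N)"
    unfolding sum_distrib_left by (intro sum_mono summand)
  also have "\<dots> = N * (1 / N) - 1 + ln N"
    unfolding sum.distrib sum_subtractf sum_distrib_right[symmetric] p1 by (simp add: N_def)
  also have "\<dots> = ln N" using N by simp
  finally show ?thesis using eta unfolding p_def m_def N_def by (simp add: field_simps)
qed

text \<open>\<open>B\<close> extends the current forest. If \<open>e\<close> is not in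
  \<open>B\<close>, it replaces an edge of \<open>B\<close> outside the forest; as \<open>B\<close>
  is acyclic, that edge is still in \<open>F\<close>, so it weighs at least the minimum of
  \<open>F\<close>.\<close>

lemma exchange_min_weight:
  fixes w :: "edge \<Rightarrow> real"
  assumes inv: "kruskal_step_inv n E \<sigma> (Suc k)" and e: "e \<in> snd \<sigma>"
    and B: "spanning_tree n E B" "fst \<sigma> \<subseteq> B"
  shows "\<exists>B'. spanning_tree n E B' \<and> fst (next_state \<sigma> e) \<subseteq> B' \<and> sum w B' \<le> sum w B + (w e - Min (w ` snd \<sigma>))"
proof -
  note F = kruskal_step_inv_Suc[OF con inv]
  have kinv: "kruskal_inv n E \<sigma>" using inv unfolding kruskal_step_inv_def by simp
  have fst': "fst (next_state \<sigma> e) = insert e (fst \<sigma>)" by (simp add: next_state_def)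
  have finB: "finite B" using B finite_edges[OF con] finite_subset unfolding spanning_tree_def by blast
  have Min_le: "Min (w ` snd \<sigma>) \<le> w f" if "f \<in> snd \<sigma>" for f using F(1) that by (intro Min_le) auto
  show ?thesis
  proof (cases "e \<in> B")
    case True
    then show ?thesis using B Min_le[OF e] by (intro exI[of _ B]) (auto simp: fst')
  next
    case False
    have eE: "e \<in> E" "\<not> contains_cycle (insert e (fst \<sigma>))" using e kinv unfolding kruskal_inv_def by auto
    obtain a b where ab: "e = {a, b}" "a \<noteq> b" "a \<in> {1..n}" "b \<in> {1..n}" using edgeE[OF con eE(1)] by metis
    have "\<exists>f\<in>B - fst \<sigma>. spanning_tree n E (insert {a, b} (B - {f}))"
      using con eE ab False by (intro spanning_tree_exchange B finB) (auto simp: connected_graph_def)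
    then obtain f where f: "f \<in> B" "f \<notin> fst \<sigma>" "spanning_tree n E (insert e (B - {f}))" using ab by auto
    have "\<not> contains_cycle (insert f (fst \<sigma>))"
      using f B contains_cycle_mono[of "insert f (fst \<sigma>)" B] unfolding spanning_tree_def by auto
    then have "f \<in> snd \<sigma>" using f B kinv unfolding kruskal_inv_def spanning_tree_def by auto
    then have "Min (w ` snd \<sigma>) \<le> w f" by (rule Min_le)
    moreover have "sum w (insert e (B - {f})) = w e + (sum w B - w f)"
      using finB False f by (simp add: sum_diff1)
    ultimately show ?thesis using f B by (intro exI[of _ "insert e (B - {f})"]) (auto simp: fst')
  qed
qed

lemma set_kruskal_pmf:
  assumes "\<And>e. 0 < l e" "kruskal_step_inv n E \<sigma> k"
  shows "finite (set_pmf (kruskal_pmf l k \<sigma>))" "\<tau> \<in> set_pmf (kruskal_pmf l k \<sigma>) \<Longrightarrow> spanning_tree n E (fst \<tau>)"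
proof -
  have "finite (set_pmf (kruskal_pmf l k \<sigma>)) \<and> (\<forall>\<tau>\<in>set_pmf (kruskal_pmf l k \<sigma>). spanning_tree n E (fst \<tau>))"
    using assms(2)
  proof (induction k arbitrary: \<sigma>)
    case 0
    then show ?case using kruskal_inv_final(1)[OF con, of \<sigma>] by (simp add: kruskal_step_inv_def)
  next
    case (Suc k)
    note F = kruskal_step_inv_Suc[OF con Suc.prems]
    have "set_pmf (pick l (snd \<sigma>)) = snd \<sigma>" by (rule set_pmf_pick) (use F assms in auto)
    moreover have "finite (set_pmf (kruskal_pmf l k (next_state \<sigma> e))) \<and>
        (\<forall>\<tau>\<in>set_pmf (kruskal_pmf l k (next_state \<sigma> e)). spanning_tree n E (fst \<tau>))" if "e \<in> snd \<sigma>" for e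
      using Suc.IH[OF F(4)[OF that]] .
    ultimately show ?case unfolding kruskal_pmf.simps set_bind_pmf
      using F(1) by (intro conjI ballI finite_UN_I) (simp_all, blast)
  qed
  then show "finite (set_pmf (kruskal_pmf l k \<sigma>))" "\<tau> \<in> set_pmf (kruskal_pmf l k \<sigma>) \<Longrightarrow> spanning_tree n E (fst \<tau>)"
    by auto
qed

text \<open>A reference tree containing the forest is carried along. Starting from the initial state
  it can be a minimum spanning tree, and it ends as the output. A round raises its expected weight
  by at most ln |F| / \<eta>, and |F| is at most n^2.\<close>

lemma expectation_kruskal_pmf_le:
  fixes w :: "edge \<Rightarrow> real"
  assumes eta: "0 < \<eta>" and inv: "kruskal_step_inv n E \<sigma> k" and B: "spanning_tree n E B" "fst \<sigma> \<subseteq> B"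
  defines "l \<equiv> \<lambda>e. exp (- \<eta> * w e)"
  shows "measure_pmf.expectation (kruskal_pmf l k \<sigma>) (\<lambda>\<tau>. sum w (fst \<tau>)) \<le> sum w B + real k * (ln (real n ^ 2) / \<eta>)"
  using inv B
proof (induction k arbitrary: \<sigma> B)
  case 0
  then have "spanning_tree n E (fst \<sigma>)" using kruskal_inv_final(1)[OF con, of \<sigma>] by (simp add: kruskal_step_inv_def)
  then have "fst \<sigma> = B"
    using spanning_tree_subset_eq[of n "fst \<sigma>" B E] 0 con unfolding spanning_tree_def connected_graph_def by blast
  then show ?case by simp
next
  case (Suc k)
  define F where "F = snd \<sigma>"
  note F = kruskal_step_inv_Suc[OF con Suc.prems(1), folded F_def]
  have l: "0 < l e" for e unfolding l_def by simp
  have S: "0 < sum l F" using F l by (simp_all add: sum_pos)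
  define G where "G = ln (real n ^ 2) / \<eta>"
  have sp: "set_pmf (pick l F) = F" by (rule set_pmf_pick) (use F l in auto)
  let ?X = "\<lambda>e. measure_pmf.expectation (kruskal_pmf l k (next_state \<sigma> e)) (\<lambda>\<tau>. sum w (fst \<tau>))"
  have IH: "?X e \<le> sum w B + (w e - Min (w ` F)) + real k * G" if e: "e \<in> F" for e
  proof -
    obtain B' where B': "spanning_tree n E B'" "fst (next_state \<sigma> e) \<subseteq> B'" "sum w B' \<le> sum w B + (w e - Min (w ` F))"
      using exchange_min_weight[OF Suc.prems(1) e[unfolded F_def] Suc.prems(2,3), of w] F_def by blast
    have "?X e \<le> sum w B' + real k * G" unfolding G_def using Suc.IH[OF F(4)[OF e] B'(1,2)] .
    then show ?thesis using B'(3) by simp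
  qed
  have "measure_pmf.expectation (kruskal_pmf l (Suc k) \<sigma>) (\<lambda>\<tau>. sum w (fst \<tau>)) = (\<Sum>e\<in>F. pmf (pick l F) e *\<^sub>R ?X e)"
    unfolding kruskal_pmf.simps F_def[symmetric]
    by (rule pmf_expectation_bind) (use F set_kruskal_pmf(1)[of l, OF l] sp in auto)
  also have "\<dots> = (\<Sum>e\<in>F. l e / sum l F * ?X e)" using pmf_pick[of F l, OF F(1,2) l] by (intro sum.cong) auto
  also have "\<dots> \<le> (\<Sum>e\<in>F. l e / sum l F * (sum w B + (w e - Min (w ` F)) + real k * G))"
    using S by (intro sum_mono mult_left_mono IH) (auto simp: l_def)
  also have "\<dots> = (\<Sum>e\<in>F. l e / sum l F) * (sum w B + real k * G) + (\<Sum>e\<in>F. l e / sum l F * (w e - Min (w ` F)))"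
    by (simp add: algebra_simps sum.distrib sum_distrib_left sum_distrib_right sum_subtractf)
  also have "(\<Sum>e\<in>F. l e / sum l F) = 1" using S by (simp add: sum_divide_distrib[symmetric])
  also have "(\<Sum>e\<in>F. l e / sum l F * (w e - Min (w ` F))) \<le> ln (real (card F)) / \<eta>"
    unfolding l_def by (rule pick_gap[OF F(1,2) eta])
  also have "ln (real (card F)) / \<eta> \<le> G"
  proof -
    have "card F \<le> n\<^sup>2" using card_mono[OF finite_edges[OF con] F(3)] card_edges_le[OF con] by linarith
    then have "real (card F) \<le> real n ^ 2" by (metis of_nat_le_iff of_nat_power)
    moreover have "0 < card F" using F by (simp add: card_gt_0_iff)
    ultimately show ?thesis unfolding G_def using eta by (intro divide_right_mono ln_mono) auto
  qed
  finally show ?case unfolding G_def[symmetric] by (simp add: algebra_simps)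
qed

text \<open>Each of the n - 1 rounds costs at most 2 ln n / \<eta>, where \<eta> = r / sqrt (2 (n -
  1)); this produces the power 3 / 2. In 1 / r = (sqrt (\<epsilon> + L) + sqrt L) / \<epsilon> the
  bound \<epsilon> \<le> K L turns the first root into sqrt (K + 1) sqrt L. The difference is
  nonnegative because all outcomes are spanning trees.\<close>

lemma opk_utility:
  assumes K: "0 < K" and eps: "0 < \<epsilon>" and delta: "0 < \<delta>" "\<delta> < 1" and le: "\<epsilon> \<le> K * ln (1 / \<delta>)"
    and T: "minimum_spanning_tree n E w T"
  shows "\<bar>(\<integral>S. (\<Sum>e\<in>S. w e) \<partial>opk n E \<epsilon> \<delta> w) - (\<Sum>e\<in>T. w e)\<bar>
    \<le> 4 * (sqrt (K + 1) + 1) * (1 / \<epsilon> * real n powr (3 / 2) * ln (real n) * sqrt (ln (1 / \<delta>)))"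
proof -
  define L where "L = ln (1 / \<delta>)"
  have L: "0 < L" using delta unfolding L_def by simp
  define r where "r = sqrt (\<epsilon> + L) - sqrt L"
  have r: "0 < r" using eps L unfolding r_def by simp
  have rho: "priv_rho \<epsilon> \<delta> = r\<^sup>2" unfolding priv_rho_def r_def L_def ..
  define \<eta> where "\<eta> = step_eps n \<epsilon> \<delta> / 2"
  define l where "l e = exp (- \<eta> * w e)" for e
  define Q where "Q = kruskal_pmf l (n - 1) ({}, E)"
  have n1: "1 \<le> n" using con unfolding connected_graph_def by simp
  have opk: "opk n E \<epsilon> \<delta> w = measure_pmf (map_pmf fst Q)" unfolding opk_eq_pmf[OF con] Q_def l_def \<eta>_def ..
  have I: "(\<integral>S. (\<Sum>e\<in>S. w e) \<partial>opk n E \<epsilon> \<delta> w) = measure_pmf.expectation Q (\<lambda>\<tau>. sum w (fst \<tau>))"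
    unfolding opk by (rule integral_map_pmf)
  have Q: "finite (set_pmf Q)" "\<And>\<tau>. \<tau> \<in> set_pmf Q \<Longrightarrow> spanning_tree n E (fst \<tau>)"
    unfolding Q_def using set_kruskal_pmf[OF _ kruskal_step_inv_init[OF con], of l] by (auto simp: l_def)
  have lower: "sum w T \<le> measure_pmf.expectation Q (\<lambda>\<tau>. sum w (fst \<tau>))"
  proof (rule measure_pmf.integral_ge_const)
    show "integrable Q (\<lambda>\<tau>. sum w (fst \<tau>))" by (rule integrable_measure_pmf_finite) (rule Q)
    show "AE \<tau> in Q. sum w T \<le> sum w (fst \<tau>)"
      using T Q(2) unfolding AE_measure_pmf_iff minimum_spanning_tree_def by blast
  qed
  show ?thesis
  proof (cases "n = 1")
    \<comment> \<open>With one vertex the only spanning tree is empty, and ln 1 = 0.\<close>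
    case True
    have "spanning_tree n E {}" using kruskal_inv_final(1)[OF con kruskal_inv_init[OF con]] True by simp
    then have "T = {}" using spanning_tree_subset_eq[of n "{}" T E] T con
      unfolding spanning_tree_def connected_graph_def minimum_spanning_tree_def by auto
    then show ?thesis unfolding I by (simp add: Q_def True)
  next
    case False
    then have n2: "2 \<le> n" using n1 by simp
    have eta: "\<eta> = sqrt 2 * r / sqrt (real n - 1) / 2"
      unfolding \<eta>_def step_eps_def rho using r by (simp add: real_sqrt_divide real_sqrt_mult)
    have eta0: "0 < \<eta>" unfolding eta using r n2 by simp
    have "measure_pmf.expectation Q (\<lambda>\<tau>. sum w (fst \<tau>)) \<le> sum w T + real (n - 1) * (ln (real n ^ 2) / \<eta>)"
      unfolding Q_def l_def using T
      by (intro expectation_kruskal_pmf_le[OF eta0 kruskal_step_inv_init[OF con]]) (auto simp: minimum_spanning_tree_def)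
    also have "real (n - 1) * (ln (real n ^ 2) / \<eta>) = (4 / sqrt 2) * ((real n - 1) * sqrt (real n - 1)) * ln (real n) * (1 / r)"
      unfolding eta using n2 r by (simp add: of_nat_diff ln_realpow field_simps)
    also have "\<dots> \<le> 4 * (real n powr (3 / 2)) * ln (real n) * ((sqrt (K + 1) + 1) * sqrt L / \<epsilon>)"
    proof (intro mult_mono)
      show "4 / sqrt 2 \<le> (4 :: real)" by (simp add: field_simps)
      have "real n powr (3 / 2) = real n powr (1 + 1 / 2)" by simp
      also have "\<dots> = real n * sqrt (real n)" using n2 by (subst powr_add) (simp add: powr_half_sqrt)
      finally have pw: "real n powr (3 / 2) = real n * sqrt (real n)" .
      show "(real n - 1) * sqrt (real n - 1) \<le> real n powr (3 / 2)" unfolding pw using n2 by (intro mult_mono) auto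
      have "r * (sqrt (\<epsilon> + L) + sqrt L) = \<epsilon>"
        unfolding r_def using eps L by (simp add: algebra_simps)
      then have "1 / r = (sqrt (\<epsilon> + L) + sqrt L) / \<epsilon>" using r eps by (simp add: field_simps)
      also have "sqrt (\<epsilon> + L) \<le> sqrt ((K + 1) * L)" using le unfolding L_def by (simp add: algebra_simps)
      finally have "1 / r \<le> (sqrt ((K + 1) * L) + sqrt L) / \<epsilon>" using eps by (simp add: divide_right_mono)
      also have "\<dots> = (sqrt (K + 1) + 1) * sqrt L / \<epsilon>" by (simp only: real_sqrt_mult) (simp add: algebra_simps)
      finally show "1 / r \<le> (sqrt (K + 1) + 1) * sqrt L / \<epsilon>" .
    qed (use n2 r in auto)
    also have "4 * (real n powr (3 / 2)) * ln (real n) * ((sqrt (K + 1) + 1) * sqrt L / \<epsilon>) =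
        4 * (sqrt (K + 1) + 1) * (1 / \<epsilon> * real n powr (3 / 2) * ln (real n) * sqrt L)"
      by (simp add: mult_ac)
    finally show ?thesis unfolding I L_def[symmetric] using lower by linarith
  qed
qed

lemma opk_spanning_tree:
  "prob_space (opk n E \<epsilon> \<delta> w)" "AE T in opk n E \<epsilon> \<delta> w. spanning_tree n E T"
proof -
  let ?l = "\<lambda>e. exp (- (step_eps n \<epsilon> \<delta> / 2) * w e)"
  show "prob_space (opk n E \<epsilon> \<delta> w)" unfolding opk_eq_pmf[OF con] by (rule measure_pmf.prob_space_axioms)
  show "AE T in opk n E \<epsilon> \<delta> w. spanning_tree n E T"
    unfolding opk_eq_pmf[OF con] AE_measure_pmf_iff
    using set_kruskal_pmf(2)[OF _ kruskal_step_inv_init[OF con], of ?l] by auto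
qed

end

section \<open>Fibonacci heaps\<close>

text \<open>The heap is a forest on a set \<open>H\<close> of positive numbers, with \<open>p v = 0\<close> at the roots; \<open>L u\<close>
  lists at least the children of \<open>u\<close>. As \<open>d c + k c\<close> does not change when \<open>c\<close> loses its
  first child, the rank condition needs no order of the children: for each \<open>j\<close> at most \<open>j\<close> of
  them have \<open>d c + k c < j\<close>. The heap order and the rank condition may fail at \<open>X\<close>, the node
  about to be cut (\<open>X = 0\<close>: no exception).\<close>

definition fib_heap :: "nat set \<Rightarrow> (nat \<Rightarrow> real) \<Rightarrow> nat \<Rightarrow> (nat \<Rightarrow> nat) \<Rightarrow> (nat \<Rightarrow> nat) \<Rightarrow> (nat \<Rightarrow> nat) \<Rightarrow>
    (nat \<Rightarrow> nat list) \<Rightarrow> bool" where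
  "fib_heap H key X p d k L \<longleftrightarrow> finite H \<and> 0 \<notin> H \<and>
     (\<forall>v. p v \<noteq> 0 \<longrightarrow> v \<in> H \<and> p v \<in> H \<and> v \<in> set (L (p v))) \<and>
     acyclic {(v, p v) | v. p v \<noteq> 0} \<and>
     (\<forall>u. u \<noteq> 0 \<longrightarrow> d u = card {c. p c = u}) \<and>
     (\<forall>u j. u \<noteq> 0 \<longrightarrow> card {c. p c = u \<and> c \<noteq> X \<and> d c + k c < j} \<le> j) \<and>
     (\<forall>c. p c \<noteq> 0 \<longrightarrow> c \<noteq> X \<longrightarrow> key (p c) \<le> key c) \<and>
     (\<forall>v. k v \<le> 1)"

definition roots :: "nat set \<Rightarrow> (nat \<Rightarrow> nat) \<Rightarrow> nat set" where
  "roots H p = {v \<in> H. p v = 0}"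

lemma fib_heapD:
  assumes "fib_heap H key X p d k L"
  shows "finite H" "0 \<notin> H" "p v \<noteq> 0 \<Longrightarrow> v \<in> H" "p v \<noteq> 0 \<Longrightarrow> p v \<in> H" "p v \<noteq> 0 \<Longrightarrow> v \<in> set (L (p v))"
    "acyclic {(v, p v) | v. p v \<noteq> 0}" "u \<noteq> 0 \<Longrightarrow> d u = card {c. p c = u}"
    "u \<noteq> 0 \<Longrightarrow> card {c. p c = u \<and> c \<noteq> X \<and> d c + k c < j} \<le> j"
    "p c \<noteq> 0 \<Longrightarrow> c \<noteq> X \<Longrightarrow> key (p c) \<le> key c" "k v \<le> 1" "p 0 = 0"
  using assms unfolding fib_heap_def by (blast, blast, blast, blast, blast, blast, blast, blast, blast, blast, metis)

lemma fib_heap_children: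
  assumes "fib_heap H key X p d k L" "u \<noteq> 0"
  shows "finite {c. p c = u}" "{c. p c = u} \<subseteq> H"
proof -
  show 1: "{c. p c = u} \<subseteq> H" using fib_heapD(3)[OF assms(1)] assms(2) by auto
  show "finite {c. p c = u}" using 1 fib_heapD(1)[OF assms(1)] finite_subset by blast
qed

lemma fib_heap_parent_neq:
  assumes "fib_heap H key X p d k L" "p v \<noteq> 0"
  shows "p v \<noteq> v"
proof
  assume "p v = v"
  then have "(v, v) \<in> {(v, p v) | v. p v \<noteq> 0}" using assms(2) by fastforce
  then show False using fib_heapD(6)[OF assms(1)] unfolding acyclic_def by blast
qed

text \<open>The exempted conditions concern a node relative to its parent, and a root has
  none.\<close>

lemma fib_heap_no_exception:
  assumes "fib_heap H key X p d k L" "p X = 0"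
  shows "fib_heap H key 0 p d k L"
proof -
  have "{c. p c = u \<and> c \<noteq> 0 \<and> d c + k c < j} = {c. p c = u \<and> c \<noteq> X \<and> d c + k c < j}" if "u \<noteq> 0" for u j
    using that assms(2) fib_heapD(11)[OF assms(1)] by (intro Collect_cong) metis
  moreover have "key (p c) \<le> key c" if "p c \<noteq> 0" for c
    using fib_heapD(9)[OF assms(1) that] that assms(2) by metis
  ultimately show ?thesis using assms unfolding fib_heap_def by simp
qed

lemma fib_heap_exception:
  assumes "fib_heap H key 0 p d k L"
  shows "fib_heap H key X p d k L"
proof -
  have "card {c. p c = u \<and> c \<noteq> X \<and> d c + k c < j} \<le> j" if "u \<noteq> 0" for u j
  proof -
    have "{c. p c = u \<and> c \<noteq> X \<and> d c + k c < j} \<subseteq> {c. p c = u \<and> c \<noteq> 0 \<and> d c + k c < j}"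
      using that fib_heapD(11)[OF assms] by (intro Collect_mono) metis
    moreover have "finite {c. p c = u \<and> c \<noteq> 0 \<and> d c + k c < j}"
      using fib_heap_children(1)[OF assms that] by (rule finite_subset[rotated]) auto
    ultimately show ?thesis using fib_heapD(8)[OF assms that, of j] card_mono by (meson order_trans)
  qed
  moreover have "key (p c) \<le> key c" if "p c \<noteq> 0" for c
    using fib_heapD(9)[OF assms that] fib_heapD(2)[OF assms] fib_heapD(3)[OF assms that] by metis
  ultimately show ?thesis using assms unfolding fib_heap_def by simp
qed

lemma fib_heap_list:
  assumes "fib_heap H key X p d k L" "\<And>c. p c \<noteq> 0 \<Longrightarrow> c \<in> set (L' (p c))"
  shows "fib_heap H key X p d k L'"
  using assms unfolding fib_heap_def by simp

text \<open>Only the order between \<open>x\<close> and its parent can break, so \<open>x\<close>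
  becomes the exception.\<close>

lemma fib_heap_decrease:
  assumes "fib_heap H key 0 p d k L" "key' x \<le> key x" "\<And>v. v \<in> H \<Longrightarrow> v \<noteq> x \<Longrightarrow> key' v = key v"
  shows "fib_heap H key' x p d k L"
proof -
  have "fib_heap H key x p d k L" using fib_heap_exception assms(1) .
  moreover have "key' (p c) \<le> key' c" if "p c \<noteq> 0" "c \<noteq> x" for c
  proof -
    have "c \<in> H" "p c \<in> H" "c \<noteq> 0" using fib_heapD(2,3,4)[OF assms(1)] that by metis+
    then have "key (p c) \<le> key c" using fib_heapD(9)[OF assms(1)] that by blast
    moreover have "key' c = key c" using assms(3) that \<open>c \<in> H\<close> by blast
    moreover have "key' (p c) \<le> key (p c)" using assms(2,3) \<open>p c \<in> H\<close> by (cases "p c = x") auto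
    ultimately show ?thesis by simp
  qed
  ultimately show ?thesis unfolding fib_heap_def by simp
qed

lemma fib_heap_insert:
  assumes "fib_heap H key 0 p d k L" "x \<noteq> 0" "\<And>v. v \<in> H \<Longrightarrow> key' v = key v"
  shows "fib_heap (insert x H) key' 0 p d k L"
proof -
  have "key' (p c) \<le> key' c" if "p c \<noteq> 0" for c
    using fib_heapD(2,3,4,9)[OF assms(1)] that assms(3) by metis
  then show ?thesis using assms unfolding fib_heap_def by auto
qed

lemma fib_heap_delete:
  assumes "fib_heap H key 0 p d k L" "p z = 0" "\<And>c. p c \<noteq> z"
  shows "fib_heap (H - {z}) key 0 p d k L"
  using assms unfolding fib_heap_def by auto

lemma fib_heap_cut_aux:
  assumes h: "fib_heap H key x p d k L" and w: "p x = w" "w \<noteq> 0"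
  shows "finite H \<and> 0 \<notin> H \<and>
     (\<forall>v. (p(x := 0)) v \<noteq> 0 \<longrightarrow> v \<in> H \<and> (p(x := 0)) v \<in> H \<and> v \<in> set (L ((p(x := 0)) v))) \<and>
     acyclic {(v, (p(x := 0)) v) | v. (p(x := 0)) v \<noteq> 0} \<and>
     (\<forall>u. u \<noteq> 0 \<longrightarrow> (d(w := d w - 1)) u = card {c. (p(x := 0)) c = u}) \<and>
     (\<forall>c. (p(x := 0)) c \<noteq> 0 \<longrightarrow> key ((p(x := 0)) c) \<le> key c)"
proof -
  have "{(v, (p(x := 0)) v) | v. (p(x := 0)) v \<noteq> 0} \<subseteq> {(v, p v) | v. p v \<noteq> 0}" by auto
  then have 1: "acyclic {(v, (p(x := 0)) v) | v. (p(x := 0)) v \<noteq> 0}"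
    using fib_heapD(6)[OF h] acyclic_subset by blast
  have 2: "(d(w := d w - 1)) u = card {c. (p(x := 0)) c = u}" if u: "u \<noteq> 0" for u
  proof -
    have "{c. (p(x := 0)) c = u} = {c. p c = u} - {x}" using u by auto
    then show ?thesis using fib_heapD(7)[OF h u] fib_heap_children(1)[OF h u] w by (auto simp: card_Diff_singleton_if)
  qed
  show ?thesis using h 1 2 unfolding fib_heap_def by auto
qed

text \<open>Losing a child lowers \<open>d w\<close>, which may break the rank condition at the
  parent of \<open>w\<close>. So the exception moves from \<open>x\<close>, now a root, up to
  \<open>w\<close>.\<close>

lemma fib_heap_cut:
  assumes h: "fib_heap H key x p d k L" and w: "p x = w" "w \<noteq> 0" and k': "\<And>c. c \<noteq> x \<Longrightarrow> k' c = k c" "k' x \<le> 1"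
  shows "fib_heap H key w (p(x := 0)) (d(w := d w - 1)) k' L"
proof -
  have "card {c. (p(x := 0)) c = u \<and> c \<noteq> w \<and> (d(w := d w - 1)) c + k' c < j} \<le> j" if u: "u \<noteq> 0" for u j
  proof -
    have "{c. (p(x := 0)) c = u \<and> c \<noteq> w \<and> (d(w := d w - 1)) c + k' c < j} \<subseteq> {c. p c = u \<and> c \<noteq> x \<and> d c + k c < j}"
      using u k'(1) by (auto split: if_splits)
    moreover have "finite {c. p c = u \<and> c \<noteq> x \<and> d c + k c < j}"
      using fib_heap_children(1)[OF h u] by (rule finite_subset[rotated]) auto
    ultimately show ?thesis using fib_heapD(8)[OF h u, of j] card_mono by (meson order_trans)
  qed
  moreover have "k' v \<le> 1" for v using k' fib_heapD(10)[OF h] by (cases "v = x") auto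
  ultimately show ?thesis using fib_heap_cut_aux[OF h w] unfolding fib_heap_def by blast
qed

text \<open>The new mark makes up for the lost child: \<open>d w + k w\<close> is unchanged, and the
  cascade stops without an exception.\<close>

lemma fib_heap_cut_mark:
  assumes h: "fib_heap H key x p d k L" and w: "p x = w" "w \<noteq> 0" and kw: "k w = 0"
  shows "fib_heap H key 0 (p(x := 0)) (d(w := d w - 1)) (k(x := 0, w := 1)) L"
proof -
  have wx: "w \<noteq> x" using fib_heap_parent_neq[OF h] w by metis
  have "x \<in> {c. p c = w}" using w by simp
  then have "0 < d w" using fib_heapD(7)[OF h w(2)] fib_heap_children(1)[OF h w(2)] by (metis card_gt_0_iff empty_iff)
  then have dk: "(d(w := d w - 1)) c + (k(x := 0, w := 1)) c = d c + k c" if "c \<noteq> x" for c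
    using kw that by auto
  have "card {c. (p(x := 0)) c = u \<and> c \<noteq> 0 \<and> (d(w := d w - 1)) c + (k(x := 0, w := 1)) c < j} \<le> j" if u: "u \<noteq> 0" for u j
  proof -
    have "{c. (p(x := 0)) c = u \<and> c \<noteq> 0 \<and> (d(w := d w - 1)) c + (k(x := 0, w := 1)) c < j}
       \<subseteq> {c. p c = u \<and> c \<noteq> x \<and> d c + k c < j}"
    proof
      fix c assume c: "c \<in> {c. (p(x := 0)) c = u \<and> c \<noteq> 0 \<and> (d(w := d w - 1)) c + (k(x := 0, w := 1)) c < j}"
      then have "c \<noteq> x" using u by auto
      then show "c \<in> {c. p c = u \<and> c \<noteq> x \<and> d c + k c < j}" using c dk[of c] by simp
    qed
    moreover have "finite {c. p c = u \<and> c \<noteq> x \<and> d c + k c < j}"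
      using fib_heap_children(1)[OF h u] by (rule finite_subset[rotated]) auto
    ultimately show ?thesis using fib_heapD(8)[OF h u, of j] card_mono by (meson order_trans)
  qed
  moreover have "(k(x := 0, w := 1)) v \<le> 1" for v using fib_heapD(10)[OF h] by simp
  ultimately show ?thesis using fib_heap_cut_aux[OF h w] unfolding fib_heap_def by blast
qed

text \<open>The new child has degree \<open>d i\<close>, and \<open>i\<close> then has
  \<open>d i + 1\<close> children. A threshold up to \<open>d i\<close> does not count the new
  child; a larger one is at least the number of all children.\<close>

lemma fib_heap_link:
  assumes h: "fib_heap H key 0 p d k L" and ij: "i \<in> H" "j \<in> H" "i \<noteq> j" "p i = 0" "p j = 0"
    and deg: "d i = d j" and key: "key i \<le> key j"
    and L': "\<And>v. v \<in> H \<Longrightarrow> set (L v) \<subseteq> set (L' v)" "j \<in> set (L' i)"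
  shows "fib_heap H key 0 (p(j := i)) (d(i := d i + 1)) (k(j := 0)) L'"
proof -
  have i0: "i \<noteq> 0" "j \<noteq> 0" using ij fib_heapD(2)[OF h] by metis+
  have no_out: "(i, v) \<notin> {(v, p v) | v. p v \<noteq> 0}" for v using ij by auto
  have "(i, j) \<notin> {(v, p v) | v. p v \<noteq> 0}\<^sup>*"
  proof
    assume "(i, j) \<in> {(v, p v) | v. p v \<noteq> 0}\<^sup>*"
    then show False by (rule converse_rtranclE) (use ij(3) no_out in blast)+
  qed
  then have ac: "acyclic (insert (j, i) {(v, p v) | v. p v \<noteq> 0})" using fib_heapD(6)[OF h] by simp
  have "{(v, (p(j := i)) v) | v. (p(j := i)) v \<noteq> 0} \<subseteq> insert (j, i) {(v, p v) | v. p v \<noteq> 0}" by auto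
  then have 1: "acyclic {(v, (p(j := i)) v) | v. (p(j := i)) v \<noteq> 0}" using ac acyclic_subset by blast
  have ch: "{c. (p(j := i)) c = u} = (if u = i then insert j {c. p c = u} else {c. p c = u})" if "u \<noteq> 0" for u
    using that ij by auto
  have 2: "(d(i := d i + 1)) u = card {c. (p(j := i)) c = u}" if u: "u \<noteq> 0" for u
    unfolding ch[OF u] using fib_heapD(7)[OF h u] fib_heap_children(1)[OF h u] ij i0 by auto
  have 3: "card {c. (p(j := i)) c = u \<and> c \<noteq> 0 \<and> (d(i := d i + 1)) c + (k(j := 0)) c < l} \<le> l" if u: "u \<noteq> 0" for u l
  proof -
    let ?C = "{c. p c = u \<and> c \<noteq> 0 \<and> d c + k c < l}"
    let ?C' = "{c. (p(j := i)) c = u \<and> c \<noteq> 0 \<and> (d(i := d i + 1)) c + (k(j := 0)) c < l}"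
    have fin: "finite ?C" using fib_heap_children(1)[OF h u] by (rule finite_subset[rotated]) auto
    have le: "card ?C \<le> l" using fib_heapD(8)[OF h u] .
    have old: "c \<in> ?C" if "c \<in> ?C'" "c \<noteq> j" for c
      using that u ij(4) by (auto split: if_splits)
    show ?thesis
    proof (cases "u = i \<and> d j < l")
      case False
      then have "j \<notin> ?C'" using ij by auto
      then have "?C' \<subseteq> ?C" using old by blast
      then show ?thesis using fin le card_mono by (meson order_trans)
    next
      case True
      have "?C' \<subseteq> {c. (p(j := i)) c = i}" using True by auto
      then have "card ?C' \<le> card {c. (p(j := i)) c = i}"
        using ch[OF i0(1)] fib_heap_children(1)[OF h i0(1)] by (intro card_mono) auto
      also have "\<dots> = d i + 1" using 2[OF i0(1)] by simp
      finally have "card ?C' \<le> d i + 1" .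
      moreover have "d i + 1 \<le> l" using True deg by linarith
      ultimately show ?thesis by (rule order_trans)
    qed
  qed
  have 4: "key ((p(j := i)) c) \<le> key c" if "(p(j := i)) c \<noteq> 0" for c
    using that key fib_heapD(9)[OF h, of c] fib_heapD(2)[OF h] fib_heapD(3)[OF h, of c] by (auto split: if_splits)
  have 5: "v \<in> H \<and> (p(j := i)) v \<in> H \<and> v \<in> set (L' ((p(j := i)) v))" if "(p(j := i)) v \<noteq> 0" for v
    using that ij L' fib_heapD(3,4,5)[OF h, of v] by (auto split: if_splits)
  have 6: "(k(j := 0)) v \<le> 1" for v using fib_heapD(10)[OF h] by simp
  show ?thesis unfolding fib_heap_def using fib_heapD(1,2)[OF h] 1 2 3 4 5 6 by blast
qed

text \<open>Keys do not increase towards the root and the climb ends by acyclicity, so a minimal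
  root is minimal in the heap.\<close>

lemma fib_heap_root_below:
  assumes h: "fib_heap H key 0 p d k L" and v: "v \<in> H"
  shows "\<exists>r\<in>roots H p. key r \<le> key v"
proof -
  let ?R = "{(v, p v) | v. p v \<noteq> 0}"
  have "?R \<subseteq> H \<times> H" using fib_heapD(3,4)[OF h] by auto
  then have "finite ?R" using fib_heapD(1)[OF h] finite_subset finite_cartesian_product by blast
  then have wf: "wf (?R\<inverse>)" using fib_heapD(6)[OF h] by (intro finite_acyclic_wf_converse)
  show ?thesis using v
  proof (induction v rule: wf_induct_rule[OF wf])
    case (1 v)
    show ?case
    proof (cases "p v = 0")
      case True
      then show ?thesis using 1 unfolding roots_def by auto
    next
      case False
      then have "(p v, v) \<in> ?R\<inverse>" by auto
      then have "\<exists>r\<in>roots H p. key r \<le> key (p v)" using 1(1) fib_heapD(4)[OF h False] by blast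
      moreover have "key (p v) \<le> key v" using fib_heapD(9)[OF h False] fib_heapD(2)[OF h] 1(2) by metis
      ultimately show ?thesis by (meson order_trans)
    qed
  qed
qed

text \<open>A node of degree at least \<open>t + 3\<close> has two children of degree at least \<open>t\<close>, so the number of
  nodes of degree at least \<open>t\<close> halves when \<open>t\<close> grows by three.\<close>

lemma fib_heap_degree:
  assumes h: "fib_heap H key 0 p d k L" and n: "card H \<le> n" "n < 2 ^ q" and u: "u \<in> H"
  shows "d u < 3 * q"
proof (rule ccontr)
  assume "\<not> d u < 3 * q"
  then have big: "3 * q \<le> d u" by simp
  define A where "A t = {u \<in> H. t \<le> d u}" for t
  have finA: "finite (A t)" for t unfolding A_def using fib_heapD(1)[OF h] by simp
  have double: "2 * card (A (t + 3)) \<le> card (A t)" for t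
  proof -
    define C where "C u = {c. p c = u \<and> t \<le> d c}" for u
    \<comment> \<open>Of at least t + 3 children at most t + 1 satisfy
      \<open>d c + k c < t + 1\<close>; the others have degree at least t, since marks are at most
      1.\<close>
    have two: "2 \<le> card (C u)" if "u \<in> A (t + 3)" for u
    proof -
      have u: "u \<in> H" "t + 3 \<le> d u" "u \<noteq> 0" using that fib_heapD(2)[OF h] unfolding A_def by (simp, simp, metis mem_Collect_eq)
      let ?S = "{c. p c = u \<and> c \<noteq> 0 \<and> d c + k c < t + 1}"
      have fin: "finite {c. p c = u}" using fib_heap_children(1)[OF h u(3)] .
      have "{c. p c = u} \<subseteq> ?S \<union> C u"
      proof
        fix c assume "c \<in> {c. p c = u}"
        then have c: "p c = u" by simp
        have "c \<noteq> 0"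
        proof
          assume "c = 0"
          then show False using c fib_heapD(11)[OF h] u(3) by simp
        qed
        then show "c \<in> ?S \<union> C u"
          using c fib_heapD(10)[OF h, of c] by (cases "t \<le> d c") (simp_all add: C_def)
      qed
      moreover have "finite (?S \<union> C u)" using fin unfolding C_def by (rule finite_subset[rotated]) auto
      ultimately have "card {c. p c = u} \<le> card (?S \<union> C u)" by (rule card_mono[rotated])
      also have "\<dots> \<le> card ?S + card (C u)" by (rule card_Un_le)
      also have "\<dots> \<le> t + 1 + card (C u)" using fib_heapD(8)[OF h u(3)] by (intro add_right_mono)
      finally show ?thesis using u(2) fib_heapD(7)[OF h u(3)] by linarith
    qed
    have sub: "(\<Union>u\<in>A (t + 3). C u) \<subseteq> A t"
    proof
      fix c assume "c \<in> (\<Union>u\<in>A (t + 3). C u)"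
      then have "p c \<in> H" "t \<le> d c" unfolding C_def A_def by auto
      then have "p c \<noteq> 0" using fib_heapD(2)[OF h] by metis
      then show "c \<in> A t" using fib_heapD(3)[OF h] \<open>t \<le> d c\<close> unfolding A_def by auto
    qed
    have finC: "finite (C u)" if "u \<in> A (t + 3)" for u
      using sub finA that by (meson SUP_upper finite_subset)
    have "2 * card (A (t + 3)) = (\<Sum>u\<in>A (t + 3). 2)" by simp
    also have "\<dots> \<le> (\<Sum>u\<in>A (t + 3). card (C u))" by (rule sum_mono) (rule two)
    also have "\<dots> = card (\<Union>u\<in>A (t + 3). C u)"
      by (rule card_UN_disjoint[symmetric]) (use finA finC in \<open>auto simp: C_def\<close>)
    also have "\<dots> \<le> card (A t)" by (rule card_mono[OF finA sub])
    finally show ?thesis .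
  qed
  \<comment> \<open>After q halvings fewer than 2 ^ q nodes leave none.\<close>
  have "2 ^ i * card (A (3 * i)) \<le> n" for i
  proof (induction i)
    case 0
    have "card (A 0) \<le> card H" unfolding A_def by (rule card_mono) (use fib_heapD(1)[OF h] in auto)
    then show ?case using n by simp
  next
    case (Suc i)
    have "2 ^ Suc i * card (A (3 * Suc i)) = 2 ^ i * (2 * card (A (3 * i + 3)))" by (simp add: add.commute)
    also have "\<dots> \<le> 2 ^ i * card (A (3 * i))" by (intro mult_left_mono double) simp
    finally show ?case using Suc by linarith
  qed
  then have "2 ^ q * card (A (3 * q)) \<le> n" .
  moreover have "u \<in> A (3 * q)" using u big unfolding A_def by simp
  then have "1 \<le> card (A (3 * q))" using finA by (metis One_nat_def Suc_leI card_gt_0_iff empty_iff)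
  ultimately have "2 ^ q \<le> n" by (metis le_trans mult.right_neutral mult_le_mono2)
  then show False using n by simp
qed

section \<open>Programs with time credits\<close>

text \<open>\<open>k\<close> is a number of credits. The unspent ones are passed to the
  postcondition, so an amortized cost is a lower bound on credits in terms of a potential.\<close>

definition wpt :: "(nat \<Rightarrow> real) \<Rightarrow> com \<Rightarrow> (store \<Rightarrow> nat \<Rightarrow> bool) \<Rightarrow> store \<Rightarrow> nat \<Rightarrow> bool" where
  "wpt \<omega> c Q s k \<longleftrightarrow> (\<exists>t s'. exec \<omega> c s t s' \<and> t \<le> k \<and> Q s' (k - t))"

inductive_cases exec_SkipE: "exec \<omega> Skip s t s'"
inductive_cases exec_NWriteE: "exec \<omega> (NWrite a i x) s t s'"
inductive_cases exec_RWriteE: "exec \<omega> (RWrite a i x) s t s'"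
inductive_cases exec_SampleE: "exec \<omega> (Sample a i) s t s'"
inductive_cases exec_SeqE: "exec \<omega> (Seq c1 c2) s t s'"
inductive_cases exec_IfE: "exec \<omega> (If b c1 c2) s t s'"

lemma wpt_atomic:
  assumes "exec \<omega> c s 1 s1" "\<And>t s'. exec \<omega> c s t s' \<Longrightarrow> t = 1 \<and> s' = s1"
  shows "wpt \<omega> c Q s k \<longleftrightarrow> 1 \<le> k \<and> Q s1 (k - 1)"
  unfolding wpt_def using assms by metis

lemma wpt_Skip: "wpt \<omega> Skip Q s k \<longleftrightarrow> 1 \<le> k \<and> Q s (k - 1)"
  by (rule wpt_atomic, rule exec.Skip) (auto elim: exec_SkipE)

lemma wpt_NWrite: "wpt \<omega> (NWrite a i x) Q s k \<longleftrightarrow> 1 \<le> k \<and> Q (nat_write a (nval i s) (nval x s) s) (k - 1)"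
  by (rule wpt_atomic, rule exec.NWrite) (auto elim: exec_NWriteE)

lemma wpt_RWrite: "wpt \<omega> (RWrite a i x) Q s k \<longleftrightarrow> 1 \<le> k \<and> Q (real_write a (nval i s) (rval x s) s) (k - 1)"
  by (rule wpt_atomic, rule exec.RWrite) (auto elim: exec_RWriteE)

lemma wpt_Sample: "wpt \<omega> (Sample a i) Q s k \<longleftrightarrow> 1 \<le> k \<and>
    Q ((real_write a (nval i s) (\<omega> (drawn s)) s)\<lparr>drawn := Suc (drawn s)\<rparr>) (k - 1)"
  by (rule wpt_atomic, rule exec.Sample) (auto elim: exec_SampleE)

lemma wpt_Seq: "wpt \<omega> (Seq c1 c2) Q s k \<longleftrightarrow> wpt \<omega> c1 (wpt \<omega> c2 Q) s k"
proof
  assume "wpt \<omega> (Seq c1 c2) Q s k"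
  then obtain t1 t2 s' s'' where "exec \<omega> c1 s t1 s'" "exec \<omega> c2 s' t2 s''" "t1 + t2 \<le> k" "Q s'' (k - (t1 + t2))"
    unfolding wpt_def by (blast elim: exec_SeqE)
  then show "wpt \<omega> c1 (wpt \<omega> c2 Q) s k"
    unfolding wpt_def by (intro exI[of _ t1] exI[of _ s'] conjI exI[of _ t2] exI[of _ s'']) auto
next
  assume "wpt \<omega> c1 (wpt \<omega> c2 Q) s k"
  then obtain t1 t2 s' s'' where "exec \<omega> c1 s t1 s'" "exec \<omega> c2 s' t2 s''" "t1 \<le> k" "t2 \<le> k - t1" "Q s'' (k - t1 - t2)"
    unfolding wpt_def by blast
  then show "wpt \<omega> (Seq c1 c2) Q s k"
    unfolding wpt_def by (intro exI[of _ "t1 + t2"] exI[of _ s'']) (auto intro: exec.Seq)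
qed

lemma wpt_If: "wpt \<omega> (If b c1 c2) Q s k \<longleftrightarrow> 1 \<le> k \<and> (if bval b s then wpt \<omega> c1 Q s (k - 1) else wpt \<omega> c2 Q s (k - 1))"
proof
  assume "wpt \<omega> (If b c1 c2) Q s k"
  then obtain t s' where t: "exec \<omega> (If b c1 c2) s t s'" "t \<le> k" "Q s' (k - t)" unfolding wpt_def by blast
  from t(1) show "1 \<le> k \<and> (if bval b s then wpt \<omega> c1 Q s (k - 1) else wpt \<omega> c2 Q s (k - 1))"
    by (rule exec_IfE) (use t in \<open>auto simp: wpt_def intro!: exI\<close>)
next
  assume r: "1 \<le> k \<and> (if bval b s then wpt \<omega> c1 Q s (k - 1) else wpt \<omega> c2 Q s (k - 1))"
  show "wpt \<omega> (If b c1 c2) Q s k"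
  proof (cases "bval b s")
    case True
    then obtain t s' where "exec \<omega> c1 s t s'" "t \<le> k - 1" "Q s' (k - 1 - t)" using r unfolding wpt_def by auto
    then show ?thesis using r True unfolding wpt_def
      by (intro exI[of _ "1 + t"] exI[of _ s']) (auto intro: exec.IfTrue[of b, simplified])
  next
    case False
    then obtain t s' where "exec \<omega> c2 s t s'" "t \<le> k - 1" "Q s' (k - 1 - t)" using r unfolding wpt_def by auto
    then show ?thesis using r False unfolding wpt_def
      by (intro exI[of _ "1 + t"] exI[of _ s']) (auto intro: exec.IfFalse[of b, simplified])
  qed
qed

lemmas wpt_simps = wpt_Skip wpt_NWrite wpt_RWrite wpt_Sample wpt_Seq wpt_If

text \<open>The credits also serve as the termination measure.\<close>

lemma wpt_While:
  assumes "I s k"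
    and step: "\<And>s k. I s k \<Longrightarrow> bval b s \<Longrightarrow> 1 \<le> k \<and> wpt \<omega> c I s (k - 1)"
    and exit: "\<And>s k. I s k \<Longrightarrow> \<not> bval b s \<Longrightarrow> 1 \<le> k \<and> Q s (k - 1)"
  shows "wpt \<omega> (While b c) Q s k"
  using assms(1)
proof (induction k arbitrary: s rule: less_induct)
  case (less k)
  show ?case
  proof (cases "bval b s")
    case True
    then obtain t1 s1 where 1: "1 \<le> k" "exec \<omega> c s t1 s1" "t1 \<le> k - 1" "I s1 (k - 1 - t1)"
      using step[OF less.prems] unfolding wpt_def by blast
    then have "wpt \<omega> (While b c) Q s1 (k - 1 - t1)" by (intro less.IH) auto
    then obtain t2 s2 where "exec \<omega> (While b c) s1 t2 s2" "t2 \<le> k - 1 - t1" "Q s2 (k - 1 - t1 - t2)"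
      unfolding wpt_def by blast
    then show ?thesis using 1 True unfolding wpt_def
      by (intro exI[of _ "1 + t1 + t2"] exI[of _ s2] conjI exec.WhileTrue) auto
  next
    case False
    then show ?thesis using exit[OF less.prems] unfolding wpt_def
      by (intro exI[of _ 1] exI[of _ s] conjI exec.WhileFalse) auto
  qed
qed

lemma wpt_mono: "wpt \<omega> c Q s k \<Longrightarrow> (\<And>s k. Q s k \<Longrightarrow> Q' s k) \<Longrightarrow> wpt \<omega> c Q' s k"
  unfolding wpt_def by blast

primrec nat_arrays :: "com \<Rightarrow> string set" where
  "nat_arrays Skip = {}"
| "nat_arrays (NWrite a i x) = {a}"
| "nat_arrays (RWrite a i x) = {}"
| "nat_arrays (Sample a i) = {}"
| "nat_arrays (Seq c1 c2) = nat_arrays c1 \<union> nat_arrays c2"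
| "nat_arrays (If b c1 c2) = nat_arrays c1 \<union> nat_arrays c2"
| "nat_arrays (While b c) = nat_arrays c"

primrec real_arrays :: "com \<Rightarrow> string set" where
  "real_arrays Skip = {}"
| "real_arrays (NWrite a i x) = {}"
| "real_arrays (RWrite a i x) = {a}"
| "real_arrays (Sample a i) = {a}"
| "real_arrays (Seq c1 c2) = real_arrays c1 \<union> real_arrays c2"
| "real_arrays (If b c1 c2) = real_arrays c1 \<union> real_arrays c2"
| "real_arrays (While b c) = real_arrays c"

lemma nats_write [simp]:
  "nats (nat_write a i x s) b = (if b = a then (nats s a)(i := x) else nats s b)"
  "reals (nat_write a i x s) = reals s"
  "drawn (nat_write a i x s) = drawn s"
  "nats (real_write a i z s) = nats s"
  "reals (real_write a i z s) b = (if b = a then (reals s a)(i := z) else reals s b)"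
  "drawn (real_write a i z s) = drawn s"
  by (simp_all add: nat_write_def real_write_def)

lemma exec_frame:
  "exec \<omega> c s t s' \<Longrightarrow> (\<forall>a. a \<notin> nat_arrays c \<longrightarrow> nats s' a = nats s a) \<and>
    (\<forall>a. a \<notin> real_arrays c \<longrightarrow> reals s' a = reals s a)"
  by (induction rule: exec.induct) auto

text \<open>Lets the specification of a loop be silent about all arrays that the loop does not
  write.\<close>

lemma wpt_frame:
  assumes "wpt \<omega> c Q s k"
    and "\<And>s' k'. Q s' k' \<Longrightarrow> (\<And>a. a \<notin> nat_arrays c \<Longrightarrow> nats s' a = nats s a) \<Longrightarrow>
      (\<And>a. a \<notin> real_arrays c \<Longrightarrow> reals s' a = reals s a) \<Longrightarrow> Q' s' k'"
  shows "wpt \<omega> c Q' s k"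
  using assms exec_frame unfolding wpt_def by meson

section \<open>Arrays of lists\<close>

text \<open>The list with number \<open>u < N\<close> is spread over the cells \<open>u, u + N, u + 2 * N, \<dots>\<close> of the array
  \<open>a\<close>; \<open>c u\<close> is \<open>N\<close> times its length.\<close>

definition stacks :: "nat \<Rightarrow> (nat \<Rightarrow> nat) \<Rightarrow> (nat \<Rightarrow> nat) \<Rightarrow> nat \<Rightarrow> nat list" where
  "stacks N c a u = map (\<lambda>i. a (u + i * N)) [0..<c u div N]"

text \<open>The cells of list \<open>v\<close> are congruent to \<open>v\<close> modulo
  \<open>N\<close>, so lists never collide. Storing \<open>N\<close> times the length reduces
  addressing to an addition, as the machine cannot multiply naturals.\<close>

lemma stacks_push:
  assumes "u < N" "v < N" "N dvd c u"
  shows "stacks N (c(u := c u + N)) (a(u + c u := x)) v = (if v = u then stacks N c a u @ [x] else stacks N c a v)"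
proof (cases "v = u")
  case True
  obtain j where j: "c u = N * j" using assms(3) by (rule dvdE)
  have "(c u + N) div N = Suc (c u div N)" using assms by simp
  moreover have "(a(u + c u := x)) (u + i * N) = a (u + i * N)" if "i < c u div N" for i
    using that j assms by auto
  moreover have "(a(u + c u := x)) (u + c u div N * N) = x" using j assms by (simp add: mult.commute)
  ultimately show ?thesis using True unfolding stacks_def by simp
next
  case False
  have "v + i * N \<noteq> u + c u" for i
  proof
    assume eq: "v + i * N = u + c u"
    obtain j where "c u = N * j" using assms(3) by (rule dvdE)
    then have "(v + i * N) mod N = (u + j * N) mod N" using eq by (simp add: mult.commute)
    then show False using assms False by simp
  qed
  then show ?thesis using False unfolding stacks_def by simp
qed

lemma stacks_pop:
  assumes "N dvd c u" "0 < c u"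
  shows "stacks N c a u = stacks N (c(u := c u - N)) a u @ [a (u + (c u - N))]"
    and "v \<noteq> u \<Longrightarrow> stacks N (c(u := c u - N)) a v = stacks N c a v"
proof -
  obtain j where j: "c u = N * j" using assms(1) by (rule dvdE)
  then obtain j' where j': "j = Suc j'" "0 < N" using assms(2) by (cases j) auto
  then show "stacks N c a u = stacks N (c(u := c u - N)) a u @ [a (u + (c u - N))]"
    using j unfolding stacks_def by (simp add: mult.commute)
  show "v \<noteq> u \<Longrightarrow> stacks N (c(u := c u - N)) a v = stacks N c a v" unfolding stacks_def by simp
qed

lemma push_image:
  assumes "inj_on r {..<q}" "x \<notin> r ` {..<q}"
  shows "inj_on (r(q := x)) {..<Suc q}" "(r(q := x)) ` {..<Suc q} = insert x (r ` {..<q})"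
proof -
  have "(r(q := x)) ` {..<q} = r ` {..<q}" by (intro image_cong) auto
  then show "(r(q := x)) ` {..<Suc q} = insert x (r ` {..<q})"
    unfolding lessThan_Suc image_insert by simp
  have "inj_on (r(q := x)) {..<q}" using assms(1) by (simp add: inj_on_def)
  then show "inj_on (r(q := x)) {..<Suc q}"
    using assms(2) \<open>(r(q := x)) ` {..<q} = r ` {..<q}\<close> by (simp add: lessThan_Suc)
qed

lemma pop_image:
  assumes "inj_on r {..<q}" "0 < (q :: nat)"
  shows "inj_on r {..<q - 1}" "r (q - 1) \<notin> r ` {..<q - 1}" "r ` {..<q} = insert (r (q - 1)) (r ` {..<q - 1})"
proof -
  obtain q' where q: "q = Suc q'" using assms(2) by (cases q) auto
  have "{..<q} = insert q' {..<q'}" using q by auto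
  then show "inj_on r {..<q - 1}" "r (q - 1) \<notin> r ` {..<q - 1}" "r ` {..<q} = insert (r (q - 1)) (r ` {..<q - 1})"
    using assms(1) q by (auto simp: inj_on_def)
qed

lemma sum_fun_upd:
  fixes f :: "nat \<Rightarrow> nat"
  assumes "x \<le> n"
  shows "(\<Sum>v\<le>n. (f(x := a)) v) + f x = (\<Sum>v\<le>n. f v) + a"
proof -
  have "(\<Sum>v\<in>{..n} - {x}. (f(x := a)) v) = (\<Sum>v\<in>{..n} - {x}. f v)" by (rule sum.cong) auto
  then show ?thesis
    using assms by (simp only: sum.remove[of "{..n}" x "f(x := a)"] sum.remove[of "{..n}" x f] finite_atMost atMost_iff) simp
qed

section \<open>Consolidation\<close>

text \<open>During consolidation the roots are the current root \<open>i\<close> (if not 0), the entries \<open>r 0, \<dots>\<close>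
  still to be processed, and the entries of \<open>A\<close>, stored there by degree.\<close>

definition root_split :: "nat \<Rightarrow> nat set \<Rightarrow> nat set \<Rightarrow> nat set \<Rightarrow> bool" where
  "root_split i R S X \<longleftrightarrow> 0 \<notin> X \<and> i \<notin> R \<and> i \<notin> S \<and> R \<inter> S = {} \<and> X = ({i} - {0}) \<union> R \<union> S"

lemma split_pop:
  assumes "root_split 0 (insert i R) S X" "i \<notin> R"
  shows "root_split i R S X"
  using assms unfolding root_split_def by blast

lemma split_link:
  assumes "root_split i R S X" "i \<noteq> 0" "j \<in> S" "i' = i \<and> j' = j \<or> i' = j \<and> j' = i"
  shows "root_split i' R (S - {j}) (X - {j'})"
  using assms unfolding root_split_def by blast

lemma split_store:
  assumes "root_split i R S X" "i \<noteq> 0"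
  shows "root_split 0 R (insert i S) X"
  using assms unfolding root_split_def by blast

lemma split_take:
  assumes "root_split z R S X" "i \<in> S"
  shows "z = 0 \<Longrightarrow> root_split i R (S - {i}) X"
    "z \<noteq> 0 \<Longrightarrow> root_split z (insert i R) (S - {i}) X"
    "z \<noteq> 0 \<Longrightarrow> root_split i (insert z R) (S - {i}) X"
  using assms unfolding root_split_def by blast+

text \<open>The index of an entry of \<open>A\<close> is its degree, so no root is stored twice.
  \<open>t\<close> bounds the occupied indices and tells how many cells have to be visited
  afterwards.\<close>

definition consolidating :: "nat set \<Rightarrow> nat \<Rightarrow> (nat \<Rightarrow> nat) \<Rightarrow> (nat \<Rightarrow> nat) \<Rightarrow> (nat \<Rightarrow> nat) \<Rightarrow> nat \<Rightarrow> nat \<Rightarrow> bool" where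
  "consolidating X i d A r q t \<longleftrightarrow> inj_on r {..<q} \<and> root_split i (r ` {..<q}) (range A - {0}) X \<and>
     (\<forall>e. A e \<noteq> 0 \<longrightarrow> d (A e) = e \<and> e < t)"

lemma consolidating_start:
  assumes "0 \<notin> X" "inj_on r {..<q}" "r ` {..<q} = X"
  shows "consolidating X 0 d (\<lambda>_. 0) r q 0"
  using assms unfolding consolidating_def root_split_def by auto

lemma consolidatingD:
  assumes "consolidating X i d A r q t"
  shows "i \<noteq> 0 \<Longrightarrow> i \<in> X" "A e \<noteq> 0 \<Longrightarrow> A e \<in> X" "A e \<noteq> 0 \<Longrightarrow> A e \<noteq> i" "0 \<notin> X" "inj_on r {..<q}"
    "A e \<noteq> 0 \<Longrightarrow> d (A e) = e" "A e \<noteq> 0 \<Longrightarrow> e < t" "x < q \<Longrightarrow> r x \<in> X"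
    "root_split i (r ` {..<q}) (range A - {0}) X"
  using assms unfolding consolidating_def root_split_def by auto

lemma range_upd_remove:
  assumes "\<And>e. A e \<noteq> (0 :: nat) \<Longrightarrow> d (A e) = e"
  shows "range (A(e0 := 0)) - {0} = range A - {0} - {A e0}"
proof (intro set_eqI iffI)
  fix x assume "x \<in> range (A(e0 := 0)) - {0}"
  then obtain e where e: "x = A e" "e \<noteq> e0" "x \<noteq> 0" by (auto split: if_splits)
  then have "A e \<noteq> A e0" using assms[of e] assms[of e0] by metis
  then show "x \<in> range A - {0} - {A e0}" using e by simp
next
  fix x assume "x \<in> range A - {0} - {A e0}"
  then obtain e where "x = A e" "x \<noteq> 0" "x \<noteq> A e0" by auto
  then show "x \<in> range (A(e0 := 0)) - {0}" by (auto intro!: image_eqI[of _ _ e])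
qed

lemma range_upd_add:
  assumes "i \<noteq> 0" "A e0 = (0 :: nat)"
  shows "range (A(e0 := i)) - {0} = insert i (range A - {0})"
proof (intro set_eqI iffI)
  fix x assume "x \<in> insert i (range A - {0})"
  then consider "x = i" | e where "x = A e" "x \<noteq> 0" by auto
  then show "x \<in> range (A(e0 := i)) - {0}"
  proof cases
    case 1
    then show ?thesis using assms by (auto intro!: image_eqI[of _ _ e0])
  next
    case 2
    then show ?thesis using assms by (auto intro!: image_eqI[of _ _ e])
  qed
qed (use assms in \<open>auto split: if_splits\<close>)

lemma consolidating_pop:
  assumes c: "consolidating X 0 d A r q t" and q: "0 < q"
  shows "consolidating X (r (q - 1)) d A r (q - 1) t"
proof -
  note P = pop_image[OF consolidatingD(5)[OF c] q]
  have "root_split 0 (insert (r (q - 1)) (r ` {..<q - 1})) (range A - {0}) X"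
    using consolidatingD(9)[OF c] P(3) by simp
  then have "root_split (r (q - 1)) (r ` {..<q - 1}) (range A - {0}) X"
    using split_pop P(2) by blast
  then show ?thesis using c P(1) unfolding consolidating_def by blast
qed

text \<open>The keys decide later which root becomes the parent: \<open>i'\<close> is the one that
  stays current, \<open>j'\<close> the one that ceases to be a root. The degree of \<open>i'\<close>
  changes, so it must no longer be stored in \<open>A\<close>.\<close>

lemma consolidating_link:
  assumes c: "consolidating X i d A r q t" and i: "i \<noteq> 0" and j: "A (d i) \<noteq> 0"
    and ij: "i' = i \<and> j' = A (d i) \<or> i' = A (d i) \<and> j' = i"
  shows "consolidating (X - {j'}) i' (d(i' := d i' + 1)) (A(d i := 0)) r q t"
proof -
  have rA: "range (A(d i := 0)) - {0} = range A - {0} - {A (d i)}"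
    using consolidatingD(6)[OF c] by (rule range_upd_remove)
  have mem: "A (d i) \<in> range A - {0}" using j by simp
  have sp: "root_split i' (r ` {..<q}) (range (A(d i := 0)) - {0}) (X - {j'})"
    unfolding rA using split_link[OF consolidatingD(9)[OF c] i mem ij] .
  have "(d(i' := d i' + 1)) ((A(d i := 0)) e) = e \<and> e < t" if e: "(A(d i := 0)) e \<noteq> 0" for e
  proof -
    have "(A(d i := 0)) e \<in> range (A(d i := 0)) - {0}" using e by blast
    then have "(A(d i := 0)) e \<noteq> i'" using sp unfolding root_split_def by blast
    moreover have "e \<noteq> d i" "A e \<noteq> 0" using e by (auto split: if_splits)
    ultimately show ?thesis using consolidatingD(6,7)[OF c] by simp
  qed
  then show ?thesis using sp consolidatingD(5)[OF c] unfolding consolidating_def by blast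
qed

lemma consolidating_store:
  assumes c: "consolidating X i d A r q t" and i: "i \<noteq> 0" "A (d i) = 0" and t': "t \<le> t'" "d i < t'"
  shows "consolidating X 0 d (A(d i := i)) r q t'"
proof -
  have "root_split 0 (r ` {..<q}) (range (A(d i := i)) - {0}) X"
    unfolding range_upd_add[of i A "d i", OF i] using split_store[OF consolidatingD(9)[OF c] i(1)] .
  moreover have "d ((A(d i := i)) e) = e \<and> e < t'" if "(A(d i := i)) e \<noteq> 0" for e
  proof (cases "e = d i")
    case False
    then show ?thesis using that consolidatingD(6,7)[OF c, of e] t' by simp
  qed (use t' in simp)
  ultimately show ?thesis using consolidatingD(5)[OF c] unfolding consolidating_def by blast
qed

text \<open>\<open>z\<close> is the best root so far. The root \<open>i\<close> found in the top
  cell starts as the candidate, joins the list, or displaces \<open>z\<close> into the list.\<close>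

lemma collect_take:
  assumes c: "consolidating X z d A r q t" and i: "A (t - 1) = i" "i \<noteq> 0"
  shows "z = 0 \<Longrightarrow> consolidating X i d (A(t - 1 := 0)) r q (t - 1)"
    "z \<noteq> 0 \<Longrightarrow> consolidating X z d (A(t - 1 := 0)) (r(q := i)) (Suc q) (t - 1)"
    "z \<noteq> 0 \<Longrightarrow> consolidating X i d (A(t - 1 := 0)) (r(q := z)) (Suc q) (t - 1)"
proof -
  have rA: "range (A(t - 1 := 0)) - {0} = range A - {0} - {i}"
    using range_upd_remove[of A d "t - 1", OF consolidatingD(6)[OF c]] i by simp
  have iA: "i \<in> range A - {0}" using i by auto
  note sp = consolidatingD(9)[OF c] and inj = consolidatingD(5)[OF c]
  have ir: "i \<notin> r ` {..<q}" and zr: "z \<notin> r ` {..<q}" using sp iA unfolding root_split_def by blast+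
  have lt: "\<forall>e. (A(t - 1 := 0)) e \<noteq> 0 \<longrightarrow> d ((A(t - 1 := 0)) e) = e \<and> e < t - 1"
  proof (intro allI impI)
    fix e assume "(A(t - 1 := 0)) e \<noteq> 0"
    then have "e \<noteq> t - 1" "A e \<noteq> 0" by (auto split: if_splits)
    then show "d ((A(t - 1 := 0)) e) = e \<and> e < t - 1" using consolidatingD(6,7)[OF c, of e] by simp
  qed
  show "z = 0 \<Longrightarrow> consolidating X i d (A(t - 1 := 0)) r q (t - 1)"
    unfolding consolidating_def rA using split_take(1)[OF sp iA] lt inj by blast
  show "z \<noteq> 0 \<Longrightarrow> consolidating X z d (A(t - 1 := 0)) (r(q := i)) (Suc q) (t - 1)"
    unfolding consolidating_def rA push_image(2)[OF inj ir] using split_take(2)[OF sp iA] lt push_image(1)[OF inj ir] by blast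
  show "z \<noteq> 0 \<Longrightarrow> consolidating X i d (A(t - 1 := 0)) (r(q := z)) (Suc q) (t - 1)"
    unfolding consolidating_def rA push_image(2)[OF inj zr] using split_take(3)[OF sp iA] lt push_image(1)[OF inj zr] by blast
qed

lemma collect_skip:
  assumes c: "consolidating X z d A r q t" and "A (t - 1) = 0"
  shows "consolidating X z d A r q (t - 1)"
proof -
  have "e < t - 1" if "A e \<noteq> 0" for e
  proof -
    have "e < t" using consolidatingD(7)[OF c that] .
    moreover have "e \<noteq> t - 1" using that assms(2) by auto
    ultimately show ?thesis by simp
  qed
  then show ?thesis using c unfolding consolidating_def by blast
qed

section \<open>Prim's algorithm with a Fibonacci heap\<close>

text \<open>Naturals: \<open>s\<close> status of a vertex (0 unseen, 1 in the heap, 2 in the tree), \<open>b\<close> its best edge,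
  \<open>p\<close>, \<open>d\<close>, \<open>k\<close> parent, degree and mark in the heap, \<open>c\<close>, \<open>h\<close> the stacks of children (some entries
  stale), \<open>f\<close>, \<open>g\<close> the stacks of incident edges, \<open>r\<close> the list of roots, of length \<open>q\<close>, and \<open>a\<close> the
  roots by degree. Vertex 0 does not exist, so \<open>p 0 = 0\<close> ends the cascading cuts. Reals: \<open>y\<close> holds
  the noisy weights.\<close>

abbreviation Var :: "string \<Rightarrow> nexp" where
  "Var a \<equiv> NRead a (NConst 0)"

abbreviation Set :: "string \<Rightarrow> nexp \<Rightarrow> com" where
  "Set a x \<equiv> NWrite a (NConst 0) x"

text \<open>There are n + 1 lists, as the vertices are numbered from 1 and the number 0 is a
  dummy.\<close>

abbreviation Stride :: nexp where
  "Stride \<equiv> NAdd (Var ''n'') (NConst 1)"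

abbreviation Key :: "string \<Rightarrow> rexp" where
  "Key a \<equiv> RRead ''y'' (NRead ''b'' (Var a))"

notation Seq (infixr ";;" 60)

definition push_root :: "string \<Rightarrow> com" where
  "push_root a = NWrite ''r'' (Var ''q'') (Var a) ;; Set ''q'' (NAdd (Var ''q'') (NConst 1))"

definition cut_loop :: com where
  "cut_loop = While (NLess (NConst 0) (NRead ''p'' (Var ''x'')))
    (Set ''w'' (NRead ''p'' (Var ''x'')) ;;
     NWrite ''p'' (Var ''x'') (NConst 0) ;;
     NWrite ''k'' (Var ''x'') (NConst 0) ;;
     push_root ''x'' ;;
     NWrite ''d'' (Var ''w'') (NSub (NRead ''d'' (Var ''w'')) (NConst 1)) ;;
     If (NLess (NRead ''k'' (Var ''w'')) (NConst 1))
       (NWrite ''k'' (Var ''w'') (NConst 1) ;; Set ''x'' (NConst 0))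
       (Set ''x'' (Var ''w'')))"

text \<open>The sum of both endpoints minus \<open>u\<close> is the other endpoint, whichever way
  round the edge is listed.\<close>

definition relax_loop :: com where
  "relax_loop = While (NLess (NConst 0) (NRead ''f'' (Var ''u'')))
    (NWrite ''f'' (Var ''u'') (NSub (NRead ''f'' (Var ''u'')) Stride) ;;
     Set ''e'' (NRead ''g'' (NAdd (Var ''u'') (NRead ''f'' (Var ''u'')))) ;;
     Set ''x'' (NSub (NAdd (NRead ''src'' (Var ''e'')) (NRead ''dst'' (Var ''e''))) (Var ''u'')) ;;
     If (NLess (NRead ''s'' (Var ''x'')) (NConst 1))
       (NWrite ''s'' (Var ''x'') (NConst 1) ;; NWrite ''b'' (Var ''x'') (Var ''e'') ;; push_root ''x'')
       (If (BAnd (NLess (NRead ''s'' (Var ''x'')) (NConst 2)) (RLess (RRead ''y'' (Var ''e'')) (Key ''x'')))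
         (NWrite ''b'' (Var ''x'') (Var ''e'') ;; cut_loop)
         Skip))"

definition link_loop :: com where
  "link_loop = While (NLess (NConst 0) (NRead ''a'' (NRead ''d'' (Var ''i''))))
    (Set ''j'' (NRead ''a'' (NRead ''d'' (Var ''i''))) ;;
     NWrite ''a'' (NRead ''d'' (Var ''i'')) (NConst 0) ;;
     If (RLess (Key ''j'') (Key ''i''))
       (Set ''o'' (Var ''i'') ;; Set ''i'' (Var ''j'') ;; Set ''j'' (Var ''o''))
       Skip ;;
     NWrite ''p'' (Var ''j'') (Var ''i'') ;;
     NWrite ''k'' (Var ''j'') (NConst 0) ;;
     NWrite ''h'' (NAdd (Var ''i'') (NRead ''c'' (Var ''i''))) (Var ''j'') ;;
     NWrite ''c'' (Var ''i'') (NAdd (NRead ''c'' (Var ''i'')) Stride) ;;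
     NWrite ''d'' (Var ''i'') (NAdd (NRead ''d'' (Var ''i'')) (NConst 1)))"

definition consolidate_loop :: com where
  "consolidate_loop = While (NLess (NConst 0) (Var ''q''))
    (Set ''q'' (NSub (Var ''q'') (NConst 1)) ;;
     Set ''i'' (NRead ''r'' (Var ''q'')) ;;
     link_loop ;;
     NWrite ''a'' (NRead ''d'' (Var ''i'')) (Var ''i'') ;;
     If (NLess (NRead ''d'' (Var ''i'')) (Var ''t'')) Skip
       (Set ''t'' (NAdd (NRead ''d'' (Var ''i'')) (NConst 1))))"

text \<open>One pass clears the table for the next round, finds the minimal root \<open>z\<close>
  and rebuilds the list of roots without \<open>z\<close>.\<close>

definition collect_loop :: com where
  "collect_loop = While (NLess (NConst 0) (Var ''t''))
    (Set ''t'' (NSub (Var ''t'') (NConst 1)) ;;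
     Set ''i'' (NRead ''a'' (Var ''t'')) ;;
     If (NLess (NConst 0) (Var ''i''))
       (NWrite ''a'' (Var ''t'') (NConst 0) ;;
        If (NLess (Var ''z'') (NConst 1))
          (Set ''z'' (Var ''i''))
          (If (RLess (Key ''i'') (Key ''z''))
            (push_root ''z'' ;; Set ''z'' (Var ''i''))
            (push_root ''i'')))
       Skip)"

text \<open>The test compares the parent of \<open>l\<close> with \<open>z\<close>, which discards
  stale entries. A child that was cut and later linked below \<open>z\<close> again may be listed
  twice; the first encounter clears its parent, so the second fails the test.\<close>

definition children_loop :: com where
  "children_loop = While (NLess (NConst 0) (NRead ''c'' (Var ''z'')))
    (NWrite ''c'' (Var ''z'') (NSub (NRead ''c'' (Var ''z'')) Stride) ;;
     Set ''l'' (NRead ''h'' (NAdd (Var ''z'') (NRead ''c'' (Var ''z'')))) ;;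
     If (BAnd (BNot (NLess (NRead ''p'' (Var ''l'')) (Var ''z''))) (BNot (NLess (Var ''z'') (NRead ''p'' (Var ''l'')))))
       (NWrite ''p'' (Var ''l'') (NConst 0) ;;
        NWrite ''d'' (Var ''z'') (NSub (NRead ''d'' (Var ''z'')) (NConst 1)) ;;
        push_root ''l'')
       Skip)"

definition prim_loop :: com where
  "prim_loop = While (NLess (Var ''v'') (Var ''n''))
    (relax_loop ;;
     Set ''t'' (NConst 0) ;;
     consolidate_loop ;;
     Set ''z'' (NConst 0) ;;
     collect_loop ;;
     NWrite ''out'' (NRead ''b'' (Var ''z'')) (NConst 1) ;;
     NWrite ''s'' (Var ''z'') (NConst 2) ;;
     children_loop ;;
     Set ''u'' (Var ''z'') ;;
     Set ''v'' (NAdd (Var ''v'') (NConst 1)))"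

section \<open>Correctness and amortized cost of the heap loops\<close>

definition heap_state :: "nat \<Rightarrow> nat set \<Rightarrow> nat \<Rightarrow> store \<Rightarrow> bool" where
  "heap_state n H X s \<longleftrightarrow> H \<subseteq> {1..n} \<and> (\<forall>u. Suc n dvd nats s ''c'' u) \<and>
     fib_heap H (\<lambda>v. reals s ''y'' (nats s ''b'' v)) X (nats s ''p'') (nats s ''d'') (nats s ''k'')
       (stacks (Suc n) (nats s ''c'') (nats s ''h''))"

definition root_list :: "nat set \<Rightarrow> store \<Rightarrow> bool" where
  "root_list H s \<longleftrightarrow> inj_on (nats s ''r'') {..<nats s ''q'' 0} \<and>
     nats s ''r'' ` {..<nats s ''q'' 0} = roots H (nats s ''p'')"

text \<open>Per root, 7 credits pay for taking it from the list and 20 for linking it, which leaves the 8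
  credits of a child entry. A mark pays for one cascading cut and the new root, 10 + 7 + 20.\<close>

definition potential :: "nat \<Rightarrow> nat set \<Rightarrow> store \<Rightarrow> nat" where
  "potential n H s = 7 * nats s ''q'' 0 + 20 * card (roots H (nats s ''p'')) +
     37 * (\<Sum>v\<le>n. nats s ''k'' v) + 8 * (\<Sum>v\<le>n. nats s ''c'' v div Suc n)"

lemmas exec_simps = wpt_simps push_root_def

lemma finite_roots: "fib_heap H key X p d k L \<Longrightarrow> finite (roots H p)"
  using fib_heapD(1) unfolding roots_def by fastforce

text \<open>75 credits suffice: 37 for the cut of \<open>x\<close>, that is 10 steps and 27 for the
  new root, 37 for the mark that ends the cascade, and 1 for the last test.\<close>

lemma wpt_cut_loop:
  assumes "heap_state n H (nats s ''x'' 0) s" "root_list H s" "nats s ''x'' 0 \<noteq> 0"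
    and k: "potential n H s + 75 + R \<le> k"
  shows "wpt \<omega> cut_loop (\<lambda>s' k'. heap_state n H 0 s' \<and> root_list H s' \<and> potential n H s' + R \<le> k') s k"
  unfolding cut_loop_def
proof (rule wpt_While)
  \<comment> \<open>The mark of a node awaiting its cut is added on the right as a refund, since
    clearing it releases 37 credits. \<open>x = 0\<close> signals that the cascade has
    ended.\<close>
  let ?I = "\<lambda>s k. heap_state n H (nats s ''x'' 0) s \<and> root_list H s \<and>
    (if nats s ''x'' 0 = 0 then potential n H s + 1 + R \<le> k
     else potential n H s + 75 + R \<le> k + 37 * nats s ''k'' (nats s ''x'' 0))"
  show "?I s k" using assms by simp
  show "1 \<le> k \<and> heap_state n H 0 s \<and> root_list H s \<and> potential n H s + R \<le> k - 1"
    if I: "?I s k" and b: "\<not> bval (NLess (NConst 0) (NRead ''p'' (Var ''x''))) s" for s k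
  proof -
    have p: "nats s ''p'' (nats s ''x'' 0) = 0" using b by simp
    have h: "heap_state n H 0 s"
      using I p fib_heap_no_exception unfolding heap_state_def by blast
    then have "nats s ''k'' (nats s ''x'' 0) \<le> 1" unfolding heap_state_def by (blast dest: fib_heapD(10))
    then have "potential n H s + 1 + R \<le> k" using I by (auto split: if_splits)
    then show ?thesis using h I by simp
  qed
  show "1 \<le> k \<and> wpt \<omega> (Set ''w'' (NRead ''p'' (Var ''x'')) ;;
     NWrite ''p'' (Var ''x'') (NConst 0) ;;
     NWrite ''k'' (Var ''x'') (NConst 0) ;;
     push_root ''x'' ;;
     NWrite ''d'' (Var ''w'') (NSub (NRead ''d'' (Var ''w'')) (NConst 1)) ;;
     If (NLess (NRead ''k'' (Var ''w'')) (NConst 1))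
       (NWrite ''k'' (Var ''w'') (NConst 1) ;; Set ''x'' (NConst 0))
       (Set ''x'' (Var ''w''))) ?I s (k - 1)"
    if I: "?I s k" and b: "bval (NLess (NConst 0) (NRead ''p'' (Var ''x''))) s" for s k
  proof -
    define x where "x = nats s ''x'' 0"
    define w where "w = nats s ''p'' x"
    define p where "p = nats s ''p''"
    define d where "d = nats s ''d''"
    define kk where "kk = nats s ''k''"
    define r where "r = nats s ''r''"
    define q where "q = nats s ''q'' 0"
    define L where "L = stacks (Suc n) (nats s ''c'') (nats s ''h'')"
    define key where "key v = reals s ''y'' (nats s ''b'' v)" for v
    have w0: "w \<noteq> 0" "p x = w" using b by (simp_all add: w_def x_def p_def)
    have hp: "fib_heap H key x p d kk L" and H: "H \<subseteq> {1..n}" and dv: "\<forall>u. Suc n dvd nats s ''c'' u"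
      using I unfolding heap_state_def x_def p_def d_def kk_def L_def key_def by auto
    have x0: "x \<noteq> 0" using fib_heapD(11)[OF hp] w0 by metis
    have xH: "x \<in> H" "w \<in> H" using fib_heapD(3,4)[OF hp, of x] w0 by auto
    have xn: "x \<le> n" "w \<le> n" using xH H by auto
    have wx: "w \<noteq> x" using fib_heap_parent_neq[OF hp, of x] w0 by simp
    have k1: "kk x \<le> 1" "kk w \<le> 1" using fib_heapD(10)[OF hp] by auto
    have rt: "roots H (p(x := 0)) = insert x (roots H p)" "x \<notin> roots H p"
      using xH w0 unfolding roots_def by auto
    have crt: "card (roots H (p(x := 0))) = Suc (card (roots H p))"
      using rt finite_roots[OF hp] by simp
    have rl: "inj_on r {..<q}" "r ` {..<q} = roots H p" using I unfolding root_list_def r_def q_def p_def by auto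
    have rl': "inj_on (r(q := x)) {..<Suc q}" "(r(q := x)) ` {..<Suc q} = roots H (p(x := 0))"
      using push_image[OF rl(1), of x] rt unfolding rl(2) by auto
    have s1: "(\<Sum>v\<le>n. (kk(x := 0)) v) + kk x = (\<Sum>v\<le>n. kk v)"
      using sum_fun_upd[OF xn(1), of kk 0] by simp
    have s2: "(\<Sum>v\<le>n. (kk(x := 0, w := 1)) v) + kk x + kk w = (\<Sum>v\<le>n. kk v) + 1"
      using sum_fun_upd[OF xn(2), of "kk(x := 0)" 1] s1 wx by simp
    have pot: "7 * q + 20 * card (roots H p) + 37 * (\<Sum>v\<le>n. kk v) + 8 * (\<Sum>v\<le>n. nats s ''c'' v div Suc n) + 75 + R \<le> k + 37 * kk x"
      using I x0 unfolding potential_def x_def[symmetric] kk_def[symmetric] q_def[symmetric] p_def[symmetric] by simp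
    have "10 \<le> k" using pot k1 by linarith
    then obtain k' where k10: "k = k' + 10" by (metis le_Suc_ex add.commute)
    show ?thesis
    proof (cases "kk w = 0")
      case True
      have h': "fib_heap H key 0 (p(x := 0)) (d(w := d w - 1)) (kk(x := 0, w := 1)) L"
        using fib_heap_cut_mark[OF hp w0(2,1) True] .
      show ?thesis
        using True wx w0 x0 k10 rl' h' H dv pot s2 crt
        by (simp add: exec_simps heap_state_def root_list_def potential_def x_def[symmetric] w_def[symmetric] p_def[symmetric]
          d_def[symmetric] kk_def[symmetric] r_def[symmetric] q_def[symmetric] key_def[symmetric, abs_def] L_def[symmetric])
    next
      case False
      have h': "fib_heap H key w (p(x := 0)) (d(w := d w - 1)) (kk(x := 0)) L"
        by (rule fib_heap_cut[OF hp w0(2,1)]) auto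
      show ?thesis
        using False wx w0 x0 k10 rl' h' H dv pot s1 crt k1
        by (simp add: exec_simps heap_state_def root_list_def potential_def x_def[symmetric] w_def[symmetric] p_def[symmetric]
          d_def[symmetric] kk_def[symmetric] r_def[symmetric] q_def[symmetric] key_def[symmetric, abs_def] L_def[symmetric])
    qed
  qed
qed


definition cons_state :: "nat set \<Rightarrow> nat \<Rightarrow> store \<Rightarrow> bool" where
  "cons_state H i s \<longleftrightarrow> consolidating (roots H (nats s ''p'')) i (nats s ''d'') (nats s ''a'') (nats s ''r'')
     (nats s ''q'' 0) (nats s ''t'' 0)"

lemma sum_div_fun_upd:
  fixes c :: "nat \<Rightarrow> nat"
  assumes "x \<le> n"
  shows "(\<Sum>v\<le>n. (c(x := a)) v div N) + c x div N = (\<Sum>v\<le>n. c v div N) + a div N"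
proof -
  have "(\<lambda>v. (c(x := a)) v div N) = (\<lambda>v. c v div N)(x := a div N)" by auto
  then show ?thesis using sum_fun_upd[OF assms, of "\<lambda>v. c v div N" "a div N"] by (simp only:)
qed

text \<open>Each link removes one root. Its 20 credits pay for at most 12 steps and the 8 credits of
  the new child entry.\<close>

lemma wpt_link_loop:
  assumes "heap_state n H 0 s" "nats s ''n'' 0 = n" "nats s ''i'' 0 \<noteq> 0" "cons_state H (nats s ''i'' 0) s"
    and k: "potential n H s + 1 + R \<le> k"
  shows "wpt \<omega> link_loop (\<lambda>s' k'. heap_state n H 0 s' \<and> nats s' ''n'' 0 = n \<and> nats s' ''i'' 0 \<noteq> 0 \<and>
    cons_state H (nats s' ''i'' 0) s' \<and> nats s' ''a'' (nats s' ''d'' (nats s' ''i'' 0)) = 0 \<and> potential n H s' + R \<le> k') s k"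
  unfolding link_loop_def
proof (rule wpt_While)
  let ?I = "\<lambda>s k. heap_state n H 0 s \<and> nats s ''n'' 0 = n \<and> nats s ''i'' 0 \<noteq> 0 \<and> cons_state H (nats s ''i'' 0) s \<and>
    potential n H s + 1 + R \<le> k"
  show "?I s k" using assms by simp
  show "1 \<le> k \<and> heap_state n H 0 s \<and> nats s ''n'' 0 = n \<and> nats s ''i'' 0 \<noteq> 0 \<and>
    cons_state H (nats s ''i'' 0) s \<and> nats s ''a'' (nats s ''d'' (nats s ''i'' 0)) = 0 \<and> potential n H s + R \<le> k - 1"
    if I: "?I s k" and b: "\<not> bval (NLess (NConst 0) (NRead ''a'' (NRead ''d'' (Var ''i'')))) s" for s k
    using I b by (simp, linarith)
  show "1 \<le> k \<and> wpt \<omega> (Set ''j'' (NRead ''a'' (NRead ''d'' (Var ''i''))) ;;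
     NWrite ''a'' (NRead ''d'' (Var ''i'')) (NConst 0) ;;
     If (RLess (Key ''j'') (Key ''i''))
       (Set ''o'' (Var ''i'') ;; Set ''i'' (Var ''j'') ;; Set ''j'' (Var ''o''))
       Skip ;;
     NWrite ''p'' (Var ''j'') (Var ''i'') ;;
     NWrite ''k'' (Var ''j'') (NConst 0) ;;
     NWrite ''h'' (NAdd (Var ''i'') (NRead ''c'' (Var ''i''))) (Var ''j'') ;;
     NWrite ''c'' (Var ''i'') (NAdd (NRead ''c'' (Var ''i'')) Stride) ;;
     NWrite ''d'' (Var ''i'') (NAdd (NRead ''d'' (Var ''i'')) (NConst 1))) ?I s (k - 1)"
    if I: "?I s k" and b: "bval (NLess (NConst 0) (NRead ''a'' (NRead ''d'' (Var ''i'')))) s" for s k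
  proof -
    define i where "i = nats s ''i'' 0"
    define p where "p = nats s ''p''"
    define d where "d = nats s ''d''"
    define kk where "kk = nats s ''k''"
    define A where "A = nats s ''a''"
    define r where "r = nats s ''r''"
    define q where "q = nats s ''q'' 0"
    define t where "t = nats s ''t'' 0"
    define c where "c = nats s ''c''"
    define h where "h = nats s ''h''"
    define j where "j = A (d i)"
    define key where "key v = reals s ''y'' (nats s ''b'' v)" for v
    note defs = i_def p_def d_def kk_def A_def r_def q_def t_def c_def h_def
    have n: "nats s ''n'' 0 = n" using I by simp
    have hp: "fib_heap H key 0 p d kk (stacks (Suc n) c h)" and H: "H \<subseteq> {1..n}" and dv: "\<forall>u. Suc n dvd c u"
      using I unfolding heap_state_def defs key_def by auto
    have cs: "consolidating (roots H p) i d A r q t" using I unfolding cons_state_def defs by auto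
    have j0: "j \<noteq> 0" using b unfolding j_def defs by simp
    have i0: "i \<noteq> 0" using I i_def by simp
    have ij: "i \<in> roots H p" "j \<in> roots H p" "j \<noteq> i" "d j = d i"
      using consolidatingD[OF cs] i0 j0 unfolding j_def by auto
    have pot: "7 * q + 20 * card (roots H p) + 37 * (\<Sum>v\<le>n. kk v) + 8 * (\<Sum>v\<le>n. c v div Suc n) + 1 + R \<le> k"
      using I unfolding potential_def defs by simp
    have fr: "finite (roots H p)" using finite_roots[OF hp] .
    have c1: "1 \<le> card (roots H p)" using fr ij(1) by (metis One_nat_def Suc_leI card_gt_0_iff empty_iff)
    then have "20 \<le> k" using pot by linarith
    then obtain k' where k': "k = k' + 20" by (metis le_Suc_ex add.commute)
    \<comment> \<open>\<open>x\<close> is the root that stays and \<open>y\<close> the one linked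
      below it, so both outcomes of the key comparison are covered at once.\<close>
    have gen: "fib_heap H key 0 (p(y := x)) (d(x := Suc (d x))) (kk(y := 0))
          (stacks (Suc n) (c(x := c x + Suc n)) (h(x + c x := y)))"
        "consolidating (roots H (p(y := x))) x (d(x := Suc (d x))) (A(d i := 0)) r q t"
        "x \<noteq> 0" "Suc n dvd c x + Suc n"
        "7 * q + 20 * card (roots H (p(y := x))) + 37 * (\<Sum>v\<le>n. (kk(y := 0)) v) + 8 * (\<Sum>v\<le>n. (c(x := c x + Suc n)) v div Suc n) + 13 + R \<le> k"
      if xy: "x = i \<and> y = j \<or> x = j \<and> y = i" and le: "key x \<le> key y" for x y
    proof -
      have x: "x \<in> H" "y \<in> H" "p x = 0" "p y = 0" "x \<noteq> y" "d x = d y" "x \<noteq> 0" "y \<in> roots H p"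
        using xy ij i0 j0 unfolding roots_def by auto
      have xn: "x \<le> n" "y \<le> n" using x H by auto
      have st: "stacks (Suc n) (c(x := c x + Suc n)) (h(x + c x := y)) v =
          (if v = x then stacks (Suc n) c h x @ [y] else stacks (Suc n) c h v)" if "v \<le> n" for v
        using stacks_push[of x "Suc n" v c h y] xn that dv by simp
      show "fib_heap H key 0 (p(y := x)) (d(x := Suc (d x))) (kk(y := 0))
          (stacks (Suc n) (c(x := c x + Suc n)) (h(x + c x := y)))"
        using fib_heap_link[OF hp x(1,2,5,3,4,6) le, of "stacks (Suc n) (c(x := c x + Suc n)) (h(x + c x := y))"]
          st[OF xn(1)] st H by fastforce
      have rt: "roots H (p(y := x)) = roots H p - {y}" using x unfolding roots_def by auto
      show "consolidating (roots H (p(y := x))) x (d(x := Suc (d x))) (A(d i := 0)) r q t"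
        using consolidating_link[OF cs i0, of x y] j0 xy unfolding rt j_def by auto
      show "x \<noteq> 0" "Suc n dvd c x + Suc n" using x dv by (simp, metis dvd_add dvd_refl)
      have "card (roots H (p(y := x))) + 1 = card (roots H p)"
        unfolding rt using x(8) fr c1 by simp
      moreover have "(\<Sum>v\<le>n. (kk(y := 0)) v) + kk y = (\<Sum>v\<le>n. kk v)"
        using sum_fun_upd[OF xn(2), of kk 0] by simp
      moreover have "(\<Sum>v\<le>n. (c(x := c x + Suc n)) v div Suc n) = (\<Sum>v\<le>n. c v div Suc n) + 1"
      proof -
        have "(c x + Suc n) div Suc n = c x div Suc n + 1" by (simp only: div_add_self2 nat.distinct not_False_eq_True)
        then show ?thesis using sum_div_fun_upd[OF xn(1), of c "c x + Suc n" "Suc n"] by linarith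
      qed
      ultimately show "7 * q + 20 * card (roots H (p(y := x))) + 37 * (\<Sum>v\<le>n. (kk(y := 0)) v) +
          8 * (\<Sum>v\<le>n. (c(x := c x + Suc n)) v div Suc n) + 13 + R \<le> k"
        using pot by linarith
    qed
    note folds = defs[symmetric] key_def[symmetric, abs_def] j_def[symmetric] n
    show ?thesis
    proof (cases "key j < key i")
      case True
      then have le: "key j \<le> key i" by simp
      note g = gen[OF disjI2[OF conjI[OF refl refl]] le]
      show ?thesis
        using True g H dv k'
        by (simp add: exec_simps heap_state_def cons_state_def potential_def folds ij(3,4))
    next
      case False
      then have le: "key i \<le> key j" by simp
      note g = gen[OF disjI1[OF conjI[OF refl refl]] le]
      show ?thesis
        using False g H dv k'
        by (simp add: exec_simps heap_state_def cons_state_def potential_def folds ij(3,4))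
    qed
  qed
qed

text \<open>The 7 credits of a list entry pay for all of its round except the links. Degrees stay
  below 3 * lg, so the table never grows beyond that.\<close>

lemma wpt_consolidate_loop:
  assumes "heap_state n H 0 s" "nats s ''n'' 0 = n" "cons_state H 0 s" "nats s ''t'' 0 \<le> 3 * lg" and lg: "n < 2 ^ lg"
    and k: "potential n H s + 1 + R \<le> k"
  shows "wpt \<omega> consolidate_loop (\<lambda>s' k'. heap_state n H 0 s' \<and> nats s' ''n'' 0 = n \<and> nats s' ''q'' 0 = 0 \<and>
    cons_state H 0 s' \<and> nats s' ''t'' 0 \<le> 3 * lg \<and> potential n H s' + R \<le> k') s k"
  unfolding consolidate_loop_def
proof (rule wpt_While)
  let ?I = "\<lambda>s k. heap_state n H 0 s \<and> nats s ''n'' 0 = n \<and> cons_state H 0 s \<and> nats s ''t'' 0 \<le> 3 * lg \<and>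
    potential n H s + 1 + R \<le> k"
  show "?I s k" using assms by simp
  show "1 \<le> k \<and> heap_state n H 0 s \<and> nats s ''n'' 0 = n \<and> nats s ''q'' 0 = 0 \<and>
    cons_state H 0 s \<and> nats s ''t'' 0 \<le> 3 * lg \<and> potential n H s + R \<le> k - 1"
    if I: "?I s k" and b: "\<not> bval (NLess (NConst 0) (Var ''q'')) s" for s k
    using I b by (simp, linarith)
  let ?rest = "NWrite ''a'' (NRead ''d'' (Var ''i'')) (Var ''i'') ;;
     If (NLess (NRead ''d'' (Var ''i'')) (Var ''t'')) Skip
       (Set ''t'' (NAdd (NRead ''d'' (Var ''i'')) (NConst 1)))"
  have rest: "wpt \<omega> ?rest ?I s k"
    if J: "heap_state n H 0 s \<and> nats s ''n'' 0 = n \<and> nats s ''i'' 0 \<noteq> 0 \<and>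
    cons_state H (nats s ''i'' 0) s \<and> nats s ''a'' (nats s ''d'' (nats s ''i'' 0)) = 0 \<and> potential n H s + (R + 4) \<le> k"
      and t: "nats s ''t'' 0 \<le> 3 * lg" for s k
  proof -
    define i where "i = nats s ''i'' 0"
    have cs: "consolidating (roots H (nats s ''p'')) i (nats s ''d'') (nats s ''a'') (nats s ''r'') (nats s ''q'' 0) (nats s ''t'' 0)"
      using J unfolding cons_state_def i_def by auto
    have i: "i \<noteq> 0" "nats s ''a'' (nats s ''d'' i) = 0" using J i_def by auto
    have "i \<in> H" using consolidatingD(1)[OF cs i(1)] unfolding roots_def by auto
    moreover have "card H \<le> n" using J card_mono[of "{1..n}" H] unfolding heap_state_def by simp
    ultimately have di: "nats s ''d'' i < 3 * lg"
      using J lg fib_heap_degree unfolding heap_state_def by blast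
    have "4 \<le> k" using J by linarith
    then obtain k' where k': "k = k' + 4" by (metis le_Suc_ex add.commute)
    note st = consolidating_store[OF cs i]
    show ?thesis
    proof (cases "nats s ''d'' i < nats s ''t'' 0")
      case True
      then show ?thesis
        using J t k' st[of "nats s ''t'' 0"]
        by (simp add: exec_simps heap_state_def cons_state_def potential_def i_def[symmetric])
    next
      case False
      then show ?thesis
        using J t k' di st[of "Suc (nats s ''d'' i)"]
        by (simp add: exec_simps heap_state_def cons_state_def potential_def i_def[symmetric])
    qed
  qed
  show "1 \<le> k \<and> wpt \<omega> (Set ''q'' (NSub (Var ''q'') (NConst 1)) ;;
     Set ''i'' (NRead ''r'' (Var ''q'')) ;; link_loop ;; ?rest) ?I s (k - 1)"
    if I: "?I s k" and b: "bval (NLess (NConst 0) (Var ''q'')) s" for s k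
  proof -
    have q: "0 < nats s ''q'' 0" using b by simp
    define s1 where "s1 = nat_write ''i'' 0 (nats s ''r'' (nats s ''q'' 0 - 1)) (nat_write ''q'' 0 (nats s ''q'' 0 - 1) s)"
    have cs: "consolidating (roots H (nats s ''p'')) 0 (nats s ''d'') (nats s ''a'') (nats s ''r'') (nats s ''q'' 0) (nats s ''t'' 0)"
      using I unfolding cons_state_def by auto
    have cs1: "cons_state H (nats s1 ''i'' 0) s1"
      using consolidating_pop[OF cs q] unfolding cons_state_def s1_def by simp
    have "nats s1 ''i'' 0 \<in> roots H (nats s ''p'')"
      using consolidatingD(8)[OF cs, of "nats s ''q'' 0 - 1"] q unfolding s1_def by simp
    then have i0: "nats s1 ''i'' 0 \<noteq> 0" using consolidatingD(4)[OF cs] by metis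
    have pot: "potential n H s1 + 7 = potential n H s" using q unfolding potential_def s1_def by simp
    have h1: "heap_state n H 0 s1" "nats s1 ''n'' 0 = n" "nats s1 ''t'' 0 \<le> 3 * lg"
      using I unfolding heap_state_def s1_def by simp_all
    have "wpt \<omega> link_loop (wpt \<omega> ?rest ?I) s1 (k - 3)"
    proof (rule wpt_frame[OF wpt_link_loop[OF h1(1,2) i0 cs1, of "R + 4"]])
      show "potential n H s1 + 1 + (R + 4) \<le> k - 3" using I pot by linarith
    next
      fix s' k'
      assume J: "heap_state n H 0 s' \<and> nats s' ''n'' 0 = n \<and> nats s' ''i'' 0 \<noteq> 0 \<and>
          cons_state H (nats s' ''i'' 0) s' \<and> nats s' ''a'' (nats s' ''d'' (nats s' ''i'' 0)) = 0 \<and> potential n H s' + (R + 4) \<le> k'"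
        and fr: "\<And>a. a \<notin> nat_arrays link_loop \<Longrightarrow> nats s' a = nats s1 a"
      have "''t'' \<notin> nat_arrays link_loop" by (simp add: link_loop_def)
      then have "nats s' ''t'' 0 \<le> 3 * lg" using fr h1(3) by simp
      then show "wpt \<omega> ?rest ?I s' k'" using J by (rule rest[rotated])
    qed
    moreover have "3 \<le> k" using I pot by linarith
    then obtain k' where "k = k' + 3" by (metis le_Suc_ex add.commute)
    ultimately show ?thesis unfolding s1_def by (simp add: exec_simps)
  qed
qed


lemma consolidatingD_done:
  assumes "consolidating X z d A r q 0"
  shows "A = (\<lambda>_. 0)" "z \<noteq> 0 \<Longrightarrow> X = insert z (r ` {..<q})" "z = 0 \<Longrightarrow> X = r ` {..<q}" "z \<notin> r ` {..<q}" "inj_on r {..<q}"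
proof -
  show A: "A = (\<lambda>_. 0)" using consolidatingD(7)[OF assms] by force
  then have "range A - {0} = {}" by auto
  then show "z \<noteq> 0 \<Longrightarrow> X = insert z (r ` {..<q})" "z = 0 \<Longrightarrow> X = r ` {..<q}" "z \<notin> r ` {..<q}"
    using consolidatingD(9)[OF assms] unfolding root_split_def by auto
  show "inj_on r {..<q}" using consolidatingD(5)[OF assms] .
qed

definition best_root :: "store \<Rightarrow> bool" where
  "best_root s \<longleftrightarrow> (if nats s ''z'' 0 = 0 then nats s ''q'' 0 = 0
     else \<forall>v\<in>nats s ''r'' ` {..<nats s ''q'' 0}. reals s ''y'' (nats s ''b'' (nats s ''z'' 0)) \<le> reals s ''y'' (nats s ''b'' v))"

text \<open>A cell costs at most 10 steps and the 7 credits of a new list entry. The set of roots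
  itself does not change.\<close>

lemma wpt_collect_loop:
  assumes "cons_state H (nats s ''z'' 0) s" "best_root s" and k: "potential n H s + 17 * nats s ''t'' 0 + 1 + R \<le> k"
  shows "wpt \<omega> collect_loop (\<lambda>s' k'. cons_state H (nats s' ''z'' 0) s' \<and> best_root s' \<and> nats s' ''t'' 0 = 0 \<and>
    potential n H s' + R \<le> k') s k"
  unfolding collect_loop_def
proof (rule wpt_While)
  let ?I = "\<lambda>s k. cons_state H (nats s ''z'' 0) s \<and> best_root s \<and> potential n H s + 17 * nats s ''t'' 0 + 1 + R \<le> k"
  show "?I s k" using assms by simp
  show "1 \<le> k \<and> cons_state H (nats s ''z'' 0) s \<and> best_root s \<and> nats s ''t'' 0 = 0 \<and> potential n H s + R \<le> k - 1"
    if I: "?I s k" and b: "\<not> bval (NLess (NConst 0) (Var ''t'')) s" for s k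
    using I b by (simp, linarith)
  show "1 \<le> k \<and> wpt \<omega> (Set ''t'' (NSub (Var ''t'') (NConst 1)) ;;
     Set ''i'' (NRead ''a'' (Var ''t'')) ;;
     If (NLess (NConst 0) (Var ''i''))
       (NWrite ''a'' (Var ''t'') (NConst 0) ;;
        If (NLess (Var ''z'') (NConst 1))
          (Set ''z'' (Var ''i''))
          (If (RLess (Key ''i'') (Key ''z''))
            (push_root ''z'' ;; Set ''z'' (Var ''i''))
            (push_root ''i'')))
       Skip) ?I s (k - 1)"
    if I: "?I s k" and b: "bval (NLess (NConst 0) (Var ''t'')) s" for s k
  proof -
    define t where "t = nats s ''t'' 0"
    define z where "z = nats s ''z'' 0"
    define A where "A = nats s ''a''"
    define r where "r = nats s ''r''"
    define q where "q = nats s ''q'' 0"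
    define d where "d = nats s ''d''"
    define i where "i = A (t - 1)"
    define X where "X = roots H (nats s ''p'')"
    define key where "key v = reals s ''y'' (nats s ''b'' v)" for v
    have t: "0 < t" using b unfolding t_def by simp
    then obtain t' where t': "t = Suc t'" by (cases t) auto
    have cs: "consolidating X z d A r q t"
      using I unfolding cons_state_def t_def z_def A_def r_def q_def d_def X_def by simp
    have br: "if z = 0 then q = 0 else \<forall>v\<in>r ` {..<q}. key z \<le> key v"
      using I unfolding best_root_def z_def q_def r_def key_def by simp
    have pot: "7 * q + 20 * card X + 37 * (\<Sum>v\<le>n. nats s ''k'' v) + 8 * (\<Sum>v\<le>n. nats s ''c'' v div Suc n) + 17 * t + 1 + R \<le> k"
      using I unfolding potential_def q_def X_def t_def by simp
    then have "17 \<le> k" using t by linarith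
    then obtain k' where k': "k = k' + 17" by (metis le_Suc_ex add.commute)
    have inj: "inj_on r {..<q}" using consolidatingD(5)[OF cs] .
    have zr: "z \<notin> r ` {..<q}" using consolidatingD(9)[OF cs] unfolding root_split_def by blast
    have img: "(r(q := x)) ` {..<Suc q} = insert x (r ` {..<q})" for x
      unfolding lessThan_Suc image_insert by simp
    have it: "A t' = i" unfolding i_def t' by simp
    note folds = t_def[symmetric] z_def[symmetric] A_def[symmetric] r_def[symmetric] q_def[symmetric] d_def[symmetric]
      X_def[symmetric] key_def[symmetric]
    show ?thesis
    proof (cases "i = 0")
      case True
      have "consolidating X z d A r q t'" using collect_skip[OF cs] True t' i_def by simp
      then show ?thesis using True br pot k' t' it
        by (simp add: exec_simps cons_state_def best_root_def potential_def folds)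
    next
      case i0: False
      note ct = collect_take[OF cs i_def[symmetric] i0, unfolded t' diff_Suc_1]
      show ?thesis
      proof (cases "z = 0")
        case True
        then show ?thesis using i0 br pot k' t' it ct(1)
          by (simp add: exec_simps cons_state_def best_root_def potential_def folds)
      next
        case z0: False
        show ?thesis
        proof (cases "key i < key z")
          case True
          have "\<forall>v\<in>(r(q := z)) ` {..<Suc q}. key i \<le> key v"
            unfolding img using br z0 by (simp add: order_trans[OF less_imp_le[OF True]] True less_imp_le)
          then show ?thesis using i0 z0 True pot k' t' it ct(3)
            by (simp add: exec_simps cons_state_def best_root_def potential_def folds del: image_eqI)
        next
          case False
          have "\<forall>v\<in>(r(q := i)) ` {..<Suc q}. key z \<le> key v"
            unfolding img using False br z0 by simp
          then show ?thesis using i0 z0 False pot k' t' it ct(2)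
            by (simp add: exec_simps cons_state_def best_root_def potential_def folds)
        qed
      qed
    qed
  qed
qed

text \<open>The 8 credits of an entry, stale or not, pay for its round; a genuine child also needs 7
  + 20 credits as a new root. \<open>z\<close> remains a root of the heap but is kept out of the
  list.\<close>

lemma wpt_children_loop:
  assumes "heap_state n H 0 s" "nats s ''n'' 0 = n" and z: "nats s ''z'' 0 = z" and zH: "z \<in> H" and "nats s ''p'' z = 0"
    "roots H (nats s ''p'') = insert z (nats s ''r'' ` {..<nats s ''q'' 0})"
    "z \<notin> nats s ''r'' ` {..<nats s ''q'' 0}" "inj_on (nats s ''r'') {..<nats s ''q'' 0}"
    and k: "potential n H s + 27 * nats s ''d'' z + 1 + R \<le> k"
  shows "wpt \<omega> children_loop (\<lambda>s' k'. heap_state n H 0 s' \<and> nats s' ''p'' z = 0 \<and>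
    roots H (nats s' ''p'') = insert z (nats s' ''r'' ` {..<nats s' ''q'' 0}) \<and>
    z \<notin> nats s' ''r'' ` {..<nats s' ''q'' 0} \<and> inj_on (nats s' ''r'') {..<nats s' ''q'' 0} \<and>
    (\<forall>c. nats s' ''p'' c \<noteq> z) \<and> potential n H s' + R \<le> k') s k"
  unfolding children_loop_def
proof (rule wpt_While)
  let ?I = "\<lambda>s k. heap_state n H 0 s \<and> nats s ''n'' 0 = n \<and> nats s ''z'' 0 = z \<and> nats s ''p'' z = 0 \<and>
    roots H (nats s ''p'') = insert z (nats s ''r'' ` {..<nats s ''q'' 0}) \<and>
    z \<notin> nats s ''r'' ` {..<nats s ''q'' 0} \<and> inj_on (nats s ''r'') {..<nats s ''q'' 0} \<and>
    potential n H s + 27 * nats s ''d'' z + 1 + R \<le> k"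
  show "?I s k" using assms by simp
  show "1 \<le> k1 \<and> heap_state n H 0 s1 \<and> nats s1 ''p'' z = 0 \<and>
    roots H (nats s1 ''p'') = insert z (nats s1 ''r'' ` {..<nats s1 ''q'' 0}) \<and>
    z \<notin> nats s1 ''r'' ` {..<nats s1 ''q'' 0} \<and> inj_on (nats s1 ''r'') {..<nats s1 ''q'' 0} \<and>
    (\<forall>c. nats s1 ''p'' c \<noteq> z) \<and> potential n H s1 + R \<le> k1 - 1"
    if I: "?I s1 k1" and b: "\<not> bval (NLess (NConst 0) (NRead ''c'' (Var ''z''))) s1" for s1 k1
  proof -
    have hp: "fib_heap H (\<lambda>v. reals s1 ''y'' (nats s1 ''b'' v)) 0 (nats s1 ''p'') (nats s1 ''d'') (nats s1 ''k'')
       (stacks (Suc n) (nats s1 ''c'') (nats s1 ''h''))" using I unfolding heap_state_def by blast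
    have "nats s1 ''c'' z = 0" using b I by simp
    then have "stacks (Suc n) (nats s1 ''c'') (nats s1 ''h'') z = []" by (simp add: stacks_def)
    moreover have "z \<noteq> 0" using zH fib_heapD(2)[OF hp] by metis
    ultimately have "\<forall>c. nats s1 ''p'' c \<noteq> z" using fib_heapD(5)[OF hp] by fastforce
    moreover have "1 \<le> k1 \<and> potential n H s1 + R \<le> k1 - 1" using I by linarith
    ultimately show ?thesis using I by blast
  qed
  show "1 \<le> k1 \<and> wpt \<omega> (NWrite ''c'' (Var ''z'') (NSub (NRead ''c'' (Var ''z'')) Stride) ;;
     Set ''l'' (NRead ''h'' (NAdd (Var ''z'') (NRead ''c'' (Var ''z'')))) ;;
     If (BAnd (BNot (NLess (NRead ''p'' (Var ''l'')) (Var ''z''))) (BNot (NLess (Var ''z'') (NRead ''p'' (Var ''l'')))))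
       (NWrite ''p'' (Var ''l'') (NConst 0) ;;
        NWrite ''d'' (Var ''z'') (NSub (NRead ''d'' (Var ''z'')) (NConst 1)) ;;
        push_root ''l'')
       Skip) ?I s1 (k1 - 1)"
    if I: "?I s1 k1" and b: "bval (NLess (NConst 0) (NRead ''c'' (Var ''z''))) s1" for s1 k1
  proof -
    define c where "c = nats s1 ''c''"
    define h where "h = nats s1 ''h''"
    define p where "p = nats s1 ''p''"
    define d where "d = nats s1 ''d''"
    define kk where "kk = nats s1 ''k''"
    define r where "r = nats s1 ''r''"
    define q where "q = nats s1 ''q'' 0"
    define l where "l = h (z + (c z - Suc n))"
    define c' where "c' = c(z := c z - Suc n)"
    define key where "key v = reals s1 ''y'' (nats s1 ''b'' v)" for v
    have zz: "nats s1 ''z'' 0 = z" "nats s1 ''n'' 0 = n" using I by auto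
    note folds = c_def[symmetric] h_def[symmetric] p_def[symmetric] d_def[symmetric] kk_def[symmetric]
      r_def[symmetric] q_def[symmetric] key_def[symmetric, abs_def] zz l_def[symmetric] c'_def[symmetric]
    have hp: "fib_heap H key 0 p d kk (stacks (Suc n) c h)" and H: "H \<subseteq> {1..n}" and dv: "\<forall>u. Suc n dvd c u"
      using I unfolding heap_state_def key_def c_def h_def p_def d_def kk_def by auto
    have c0: "0 < c z" using b zz unfolding c_def by simp
    have zn: "z \<le> n" "z \<noteq> 0" using zH H by auto
    have cge: "Suc n \<le> c z" using dv c0 by (meson dvd_imp_le)
    have pz: "p z = 0" and rt: "roots H p = insert z (r ` {..<q})" and zr: "z \<notin> r ` {..<q}" and inj: "inj_on r {..<q}"
      using I unfolding p_def r_def q_def by auto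
    have dv': "\<forall>u. Suc n dvd c' u" using dv unfolding c'_def by (auto intro: dvd_diff_nat)
    note st = stacks_pop[where a = h and c = c and u = z and N = "Suc n", OF dv[rule_format] c0, folded c'_def l_def]
    have l': "h (z + c' z) = l" unfolding l_def c'_def by simp
    have sl: "set (stacks (Suc n) c h z) = insert l (set (stacks (Suc n) c' h z))" unfolding st(1) by simp
    have old: "v \<in> set (stacks (Suc n) c' h (p v))" if v: "v \<in> set (stacks (Suc n) c h (p v))" "v \<noteq> l \<or> p v \<noteq> z" for v
    proof (cases "p v = z")
      case True
      then have "v \<in> insert l (set (stacks (Suc n) c' h z))" using v(1) sl by metis
      then show ?thesis using v(2) True by auto
    next
      case False
      then show ?thesis using v(1) by (simp only: st(2)[OF False])
    qed
    have "c z div Suc n = c' z div Suc n + 1"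
    proof -
      have "c z = c' z + Suc n" using cge unfolding c'_def by simp
      then show ?thesis by (metis Suc_eq_plus1 div_add_self2 nat.distinct(1))
    qed
    then have "(\<Sum>v\<le>n. c' v div Suc n) + 1 = (\<Sum>v\<le>n. c v div Suc n)"
      using sum_div_fun_upd[OF zn(1), of c "c z - Suc n" "Suc n"] unfolding c'_def by simp
    then have pot: "7 * q + 20 * card (roots H p) + 37 * (\<Sum>v\<le>n. kk v) + 8 * (\<Sum>v\<le>n. c' v div Suc n) + 27 * d z + 9 + R \<le> k1"
      using I unfolding potential_def q_def p_def kk_def c_def d_def by linarith
    then have "9 \<le> k1" by linarith
    then obtain k' where k': "k1 = k' + 9" by (metis le_Suc_ex add.commute)
    show ?thesis
    proof (cases "p l = z")
      case False
      have "fib_heap H key 0 p d kk (stacks (Suc n) c' h)"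
        using hp
      proof (rule fib_heap_list)
        fix v assume v: "p v \<noteq> 0"
        then have "v \<in> set (stacks (Suc n) c h (p v))" using fib_heapD(5)[OF hp] by blast
        then show "v \<in> set (stacks (Suc n) c' h (p v))"
          using old[of v] False by metis
      qed
      then have "?I (nat_write ''l'' 0 l (nat_write ''c'' z (c z - Suc n) s1)) (k1 - 5)"
        using H dv' rt zr inj pz pot k'
        by (simp add: heap_state_def potential_def folds)
      moreover have "\<not> (\<not> p l < z \<and> \<not> z < p l)" using False by linarith
      ultimately show ?thesis using k' by (auto simp: exec_simps folds l')
    next
      case True
      have lz: "l \<noteq> z" using True pz zn by auto
      have lH: "l \<in> H" using fib_heapD(3)[OF hp] True zn by simp
      \<comment> \<open>An ordinary cut that leaves marks alone; the exception it creates at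
        \<open>z\<close> is void because \<open>z\<close> is a root.\<close>
      have hp1: "fib_heap H key z (p(l := 0)) (d(z := d z - 1)) kk (stacks (Suc n) c h)"
        using fib_heap_exception[OF hp, of l] True zn(2) fib_heapD(10)[OF hp] by (intro fib_heap_cut) auto
      have "fib_heap H key 0 (p(l := 0)) (d(z := d z - 1)) kk (stacks (Suc n) c h)"
        by (rule fib_heap_no_exception[OF hp1]) (use pz in simp)
      then have hp2: "fib_heap H key 0 (p(l := 0)) (d(z := d z - 1)) kk (stacks (Suc n) c' h)"
      proof (rule fib_heap_list)
        fix v assume v: "(p(l := 0)) v \<noteq> 0"
        then have vl: "v \<noteq> l" "p v \<noteq> 0" by (auto split: if_splits)
        then have "v \<in> set (stacks (Suc n) c h (p v))" using fib_heapD(5)[OF hp] by blast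
        then show "v \<in> set (stacks (Suc n) c' h ((p(l := 0)) v))"
          using old[of v] vl by (metis fun_upd_other)
      qed
      have lr: "l \<notin> roots H p" using True zn(2) unfolding roots_def by simp
      have rt': "roots H (p(l := 0)) = insert l (roots H p)" using lH unfolding roots_def by auto
      then have crt: "card (roots H (p(l := 0))) = Suc (card (roots H p))" using lr finite_roots[OF hp] by simp
      have lq: "l \<notin> r ` {..<q}" using lr rt by auto
      note P = push_image[OF inj lq]
      have rt2: "roots H (p(l := 0)) = insert z ((r(q := l)) ` {..<Suc q})" unfolding rt' rt P(2) by auto
      have zr2: "z \<notin> (r(q := l)) ` {..<Suc q}" unfolding P(2) using zr lz by auto
      have dz: "1 \<le> d z"
        using fib_heapD(7)[OF hp zn(2)] fib_heap_children(1)[OF hp zn(2)] True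
        by (metis (mono_tags) One_nat_def Suc_leI card_gt_0_iff empty_iff mem_Collect_eq)
      have pot': "7 * Suc q + 20 * card (roots H (p(l := 0))) + 37 * (\<Sum>v\<le>n. kk v) + 8 * (\<Sum>v\<le>n. c' v div Suc n) + 27 * (d z - 1) + 9 + R \<le> k1"
      proof -
        obtain e where "d z = Suc e" using dz by (cases "d z") auto
        then show ?thesis using pot unfolding crt by simp
      qed
      have "?I (nat_write ''q'' 0 (Suc q) (nat_write ''r'' q l (nat_write ''d'' z (d z - 1)
          (nat_write ''p'' l 0 (nat_write ''l'' 0 l (nat_write ''c'' z (c z - Suc n) s1)))))) (k1 - 8)"
        using hp2 H dv' rt2 zr2 P(1) pz lz pot' k'
        by (simp add: heap_state_def potential_def folds)
      then show ?thesis using True k' pz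
        by (simp add: exec_simps folds l')
    qed
  qed
qed

section \<open>The search\<close>

text \<open>\<open>K\<close> stands for the positions of the edges of Kruskal's tree, of which
  Prim's search needs the cut property only.\<close>

locale prim =
  fixes n m lg :: nat and src dst :: "nat \<Rightarrow> nat" and y :: "nat \<Rightarrow> real" and K :: "nat set"
  assumes lg: "n < 2 ^ lg"
    and edge: "e < m \<Longrightarrow> src e \<in> {1..n} \<and> dst e \<in> {1..n} \<and> src e \<noteq> dst e"
    and con: "connects {1..n} ((\<lambda>e. {src e, dst e}) ` {..<m})"
    and cut: "e < m \<Longrightarrow> (src e \<in> S) \<noteq> (dst e \<in> S) \<Longrightarrow>
      (\<And>f. f < m \<Longrightarrow> (src f \<in> S) \<noteq> (dst f \<in> S) \<Longrightarrow> y e \<le> y f) \<Longrightarrow> e \<in> K"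
begin

definition incident :: "nat \<Rightarrow> nat \<Rightarrow> bool" where
  "incident v e \<longleftrightarrow> src e = v \<or> dst e = v"

definition crosses :: "nat set \<Rightarrow> nat \<Rightarrow> bool" where
  "crosses S e \<longleftrightarrow> (src e \<in> S) \<noteq> (dst e \<in> S)"

text \<open>\<open>L v\<close> lists the edges at \<open>v\<close>, those at the last tree vertex \<open>u\<close> only as far as they have not
  yet been relaxed.\<close>

definition search_inv :: "nat set \<Rightarrow> nat set \<Rightarrow> nat \<Rightarrow> (nat \<Rightarrow> nat) \<Rightarrow> (nat \<Rightarrow> nat list) \<Rightarrow> nat set \<Rightarrow> bool" where
  "search_inv T F u b L W \<longleftrightarrow> T \<subseteq> {1..n} \<and> F \<subseteq> {1..n} \<and> T \<inter> F = {} \<and> u \<in> T \<and>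
     (\<forall>v\<in>{1..n}. \<forall>e\<in>set (L v). e < m \<and> incident v e) \<and>
     (\<forall>v\<in>{1..n} - T. \<forall>e<m. incident v e \<longrightarrow> e \<in> set (L v)) \<and>
     (\<forall>v\<in>F. b v < m \<and> incident v (b v) \<and> crosses T (b v)) \<and>
     (\<forall>e<m. \<forall>v. incident v e \<longrightarrow> v \<notin> T \<longrightarrow> crosses T e \<longrightarrow>
        (v \<in> F \<and> y (b v) \<le> y e) \<or> (incident u e \<and> e \<in> set (L u))) \<and>
     (\<forall>e\<in>W. e < m \<and> e \<in> K) \<and> (\<forall>a\<in>T. \<forall>c\<in>T. (a, c) \<in> conn ((\<lambda>e. {src e, dst e}) ` W))"

lemma search_invD:
  assumes "search_inv T F u b L W"
  shows "T \<subseteq> {1..n}" "F \<subseteq> {1..n}" "T \<inter> F = {}" "u \<in> T"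
    "v \<in> {1..n} \<Longrightarrow> e \<in> set (L v) \<Longrightarrow> e < m \<and> incident v e"
    "v \<in> {1..n} \<Longrightarrow> v \<notin> T \<Longrightarrow> e < m \<Longrightarrow> incident v e \<Longrightarrow> e \<in> set (L v)"
    "v \<in> F \<Longrightarrow> b v < m \<and> incident v (b v) \<and> crosses T (b v)"
    "e < m \<Longrightarrow> incident v e \<Longrightarrow> v \<notin> T \<Longrightarrow> crosses T e \<Longrightarrow>
      (v \<in> F \<and> y (b v) \<le> y e) \<or> (incident u e \<and> e \<in> set (L u))"
    "e \<in> W \<Longrightarrow> e < m \<and> e \<in> K"
    "a \<in> T \<Longrightarrow> c \<in> T \<Longrightarrow> (a, c) \<in> conn ((\<lambda>e. {src e, dst e}) ` W)"
  using assms unfolding search_inv_def by (blast, blast, blast, blast, blast, blast, blast, blast, blast, blast)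

lemma search_invI:
  assumes "T \<subseteq> {1..n}" "F \<subseteq> {1..n}" "T \<inter> F = {}" "u \<in> T"
    "\<And>v e. v \<in> {1..n} \<Longrightarrow> e \<in> set (L v) \<Longrightarrow> e < m \<and> incident v e"
    "\<And>v e. v \<in> {1..n} \<Longrightarrow> v \<notin> T \<Longrightarrow> e < m \<Longrightarrow> incident v e \<Longrightarrow> e \<in> set (L v)"
    "\<And>v. v \<in> F \<Longrightarrow> b v < m \<and> incident v (b v) \<and> crosses T (b v)"
    "\<And>e v. e < m \<Longrightarrow> incident v e \<Longrightarrow> v \<notin> T \<Longrightarrow> crosses T e \<Longrightarrow>
      (v \<in> F \<and> y (b v) \<le> y e) \<or> (incident u e \<and> e \<in> set (L u))"
    "\<And>e. e \<in> W \<Longrightarrow> e < m \<and> e \<in> K"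
    "\<And>a c. a \<in> T \<Longrightarrow> c \<in> T \<Longrightarrow> (a, c) \<in> conn ((\<lambda>e. {src e, dst e}) ` W)"
  shows "search_inv T F u b L W"
  using assms unfolding search_inv_def by simp

text \<open>The last three conclusions are the branches of the loop body: insertion, decrease of the
  key, and no action. Only the claim about \<open>e\<close> loses its pending entry, and its
  endpoint outside the tree, if any, is \<open>x\<close>.\<close>

lemma search_relax:
  assumes inv: "search_inv T F u b L W" and L: "L u = l @ [e]" "L' u = l" "\<And>v. v \<noteq> u \<Longrightarrow> L' v = L v"
    and x: "x = src e + dst e - u"
  shows "x \<in> {1..n}" "x \<noteq> u" "e < m"
    "x \<notin> T \<Longrightarrow> x \<notin> F \<Longrightarrow> search_inv T (insert x F) u (b(x := e)) L' W"
    "x \<in> F \<Longrightarrow> y e < y (b x) \<Longrightarrow> search_inv T F u (b(x := e)) L' W"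
    "x \<in> T \<or> x \<in> F \<and> y (b x) \<le> y e \<Longrightarrow> search_inv T F u b L' W"
proof -
  note D = search_invD[OF inv]
  have u: "u \<in> T" "u \<in> {1..n}" using D(1,4) by auto
  have "e \<in> set (L u)" using L(1) by simp
  then have e: "e < m" "incident u e" using D(5)[OF u(2)] by auto
  show "e < m" using e by simp
  have ux: "src e = u \<and> dst e = x \<or> src e = x \<and> dst e = u" using e x unfolding incident_def by auto
  show x1: "x \<in> {1..n}" "x \<noteq> u" using ux edge[OF e(1)] by auto
  have inc: "v = u \<or> v = x" if "incident v e" for v using that ux unfolding incident_def by auto
  have Lu: "set (L u) = insert e (set (L' u))" using L by simp
  have 1: "f < m \<and> incident v f" if "v \<in> {1..n}" "f \<in> set (L' v)" for v f
    using D(5)[OF that(1), of f] that(2) L(3)[of v] Lu by (cases "v = u") auto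
  have 2: "f \<in> set (L' v)" if "v \<in> {1..n}" "v \<notin> T" "f < m" "incident v f" for v f
    using D(6)[OF that] L(3)[of v] u that(2) by metis
  have old: "(v \<in> F \<and> y (b v) \<le> y f) \<or> (incident u f \<and> f \<in> set (L' u))"
    if "f < m" "incident v f" "v \<notin> T" "crosses T f" "f \<noteq> e" for f v
    using D(8)[OF that(1-4)] Lu that(5) by auto
  have cr: "crosses T e" if "x \<notin> T" using that ux u unfolding crosses_def by auto
  have xe: "incident x e" using ux unfolding incident_def by auto
  have ev: "v = x" if "incident v e" "v \<notin> T" for v using inc that u by auto
  show "search_inv T (insert x F) u (b(x := e)) L' W" if xn: "x \<notin> T" "x \<notin> F"
  proof (rule search_invI[OF D(1) _ _ u(1) 1 2 _ _ D(9,10)])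
    show "insert x F \<subseteq> {1..n}" using D(2) x1 by simp
    show "T \<inter> insert x F = {}" using D(3) xn by auto
    show "(b(x := e)) v < m \<and> incident v ((b(x := e)) v) \<and> crosses T ((b(x := e)) v)" if "v \<in> insert x F" for v
      using that D(7)[of v] e xe cr xn by auto
    fix f v assume f: "f < m" "incident v f" "v \<notin> T" "crosses T f"
    show "(v \<in> insert x F \<and> y ((b(x := e)) v) \<le> y f) \<or> (incident u f \<and> f \<in> set (L' u))"
    proof (cases "f = e")
      case True
      then show ?thesis using ev f by simp
    next
      case False
      then show ?thesis using old[OF f False] xn by auto
    qed
  qed
  show "search_inv T F u (b(x := e)) L' W" if xF: "x \<in> F" and lt: "y e < y (b x)"
  proof (rule search_invI[OF D(1,2,3) u(1) 1 2 _ _ D(9,10)])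
    have xT: "x \<notin> T" using xF D(3) by blast
    show "(b(x := e)) v < m \<and> incident v ((b(x := e)) v) \<and> crosses T ((b(x := e)) v)" if "v \<in> F" for v
      using D(7)[OF that] e xe cr xT by auto
    fix f v assume f: "f < m" "incident v f" "v \<notin> T" "crosses T f"
    show "(v \<in> F \<and> y ((b(x := e)) v) \<le> y f) \<or> (incident u f \<and> f \<in> set (L' u))"
    proof (cases "f = e")
      case True
      then show ?thesis using ev f xF by simp
    next
      case False
      then show ?thesis using old[OF f False] lt by (cases "v = x") auto
    qed
  qed
  show "search_inv T F u b L' W" if xx: "x \<in> T \<or> x \<in> F \<and> y (b x) \<le> y e"
  proof (rule search_invI[OF D(1,2,3) u(1) 1 2 D(7) _ D(9,10)])
    fix f v assume f: "f < m" "incident v f" "v \<notin> T" "crosses T f"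
    show "(v \<in> F \<and> y (b v) \<le> y f) \<or> (incident u f \<and> f \<in> set (L' u))"
    proof (cases "f = e")
      case True
      then show ?thesis using ev[of v] xx f by auto
    next
      case False
      then show ?thesis using old[OF f False] by auto
    qed
  qed
qed

text \<open>With no edges at \<open>u\<close> pending, the best edges of the frontier are minimal
  among all edges leaving the tree, so the cut property applies to \<open>b z\<close>. The edges at
  \<open>z\<close> become the pending ones.\<close>

lemma search_next:
  assumes inv: "search_inv T F u b L W" and L: "L u = []" and z: "z \<in> F" "\<And>v. v \<in> F \<Longrightarrow> y (b z) \<le> y (b v)"
  shows "search_inv (insert z T) (F - {z}) z b L (insert (b z) W)"
proof -
  note D = search_invD[OF inv]
  have zn: "z \<in> {1..n}" "z \<notin> T" using z D(2,3) by auto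
  have bz: "b z < m" "incident z (b z)" "crosses T (b z)" using D(7)[OF z(1)] by auto
  have relaxed: "v \<in> F \<and> y (b v) \<le> y f" if "f < m" "incident v f" "v \<notin> T" "crosses T f" for f v
    using D(8)[OF that] L by simp
  have bK: "b z \<in> K"
  proof (rule cut[of _ T])
    show "b z < m" using bz by simp
    show "(src (b z) \<in> T) \<noteq> (dst (b z) \<in> T)" using bz unfolding crosses_def by simp
    fix f assume f: "f < m" "(src f \<in> T) \<noteq> (dst f \<in> T)"
    then obtain v where "incident v f" "v \<notin> T" unfolding incident_def by auto
    then have "v \<in> F \<and> y (b v) \<le> y f" using relaxed f unfolding crosses_def by blast
    then show "y (b z) \<le> y f" using z(2) by force
  qed
  obtain t where t: "t \<in> T" "{t, z} = {src (b z), dst (b z)}"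
  proof (cases "src (b z) = z")
    case True
    then show ?thesis using bz zn that[of "dst (b z)"] unfolding crosses_def by auto
  next
    case False
    then show ?thesis using bz zn that[of "src (b z)"] unfolding crosses_def incident_def by auto
  qed
  let ?C = "conn ((\<lambda>e. {src e, dst e}) ` insert (b z) W)"
  have sub: "conn ((\<lambda>e. {src e, dst e}) ` W) \<subseteq> ?C" by (rule conn_mono) auto
  have tz: "(t, z) \<in> ?C" by (rule conn_edge) (use t in auto)
  have to_t: "(a, t) \<in> ?C" if "a \<in> insert z T" for a
    using that D(10)[OF _ t(1)] sub conn_sym[OF tz] by blast
  show ?thesis
  proof (rule search_invI)
    show "insert z T \<subseteq> {1..n}" "F - {z} \<subseteq> {1..n}" "insert z T \<inter> (F - {z}) = {}" "z \<in> insert z T"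
      using D(1-3) zn by auto
    show "e < m \<and> incident v e" if "v \<in> {1..n}" "e \<in> set (L v)" for v e using D(5)[OF that] .
    show "e \<in> set (L v)" if "v \<in> {1..n}" "v \<notin> insert z T" "e < m" "incident v e" for v e using D(6) that by blast
    show "b v < m \<and> incident v (b v) \<and> crosses (insert z T) (b v)" if v: "v \<in> F - {z}" for v
    proof -
      have "b v < m \<and> incident v (b v) \<and> crosses T (b v)" "v \<notin> T" "v \<noteq> z" using D(7)[of v] D(3) v by auto
      then show ?thesis unfolding incident_def crosses_def by auto
    qed
    show "e < m \<and> e \<in> K" if "e \<in> insert (b z) W" for e using that D(9)[of e] bz bK by auto
    show "(a, c) \<in> ?C" if "a \<in> insert z T" "c \<in> insert z T" for a c
      using to_t[OF that(1)] conn_sym[OF to_t[OF that(2)]] by (rule rtrancl_trans)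
    fix f v assume f: "f < m" "incident v f" "v \<notin> insert z T" "crosses (insert z T) f"
    show "(v \<in> F - {z} \<and> y (b v) \<le> y f) \<or> (incident z f \<and> f \<in> set (L z))"
    proof (cases "incident z f")
      case True
      then show ?thesis using D(6)[OF zn f(1)] by simp
    next
      case False
      then have "crosses T f" using f(4) unfolding incident_def crosses_def by auto
      then show ?thesis using relaxed[OF f(1,2)] f(3) by auto
    qed
  qed
qed

text \<open>By connectivity some edge leaves a tree that is not yet complete; having been relaxed,
  it has its outer end in the frontier.\<close>

lemma search_frontier:
  assumes inv: "search_inv T F u b L W" and L: "L u = []" and T: "card T < n"
  shows "F \<noteq> {}"
proof -
  note D = search_invD[OF inv]
  have "T \<noteq> {1..n}" using T by auto
  then obtain v where v: "v \<in> {1..n}" "v \<notin> T" using D(1) by blast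
  have "(u, v) \<in> conn ((\<lambda>e. {src e, dst e}) ` {..<m})" using con v D(1,4) unfolding connects_def by blast
  then obtain x z where xz: "x \<in> T" "z \<notin> T" "{x, z} \<in> (\<lambda>e. {src e, dst e}) ` {..<m}"
    using conn_crossing[of u v _ T] v D(4) by blast
  then obtain e where e: "e < m" "{x, z} = {src e, dst e}" by auto
  then have "incident z e" "crosses T e" using xz unfolding incident_def crosses_def by (auto simp: doubleton_eq_iff)
  then have "z \<in> F" using D(8)[OF e(1), of z] xz(2) L by simp
  then show ?thesis by blast
qed

section \<open>The search invariant on stores and the credits of a round\<close>

definition tree :: "store \<Rightarrow> nat set" where
  "tree s = {v. nats s ''s'' v = 2}"

definition front :: "store \<Rightarrow> nat set" where
  "front s = {v. nats s ''s'' v = 1}"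

definition graph_inv :: "store \<Rightarrow> bool" where
  "graph_inv s \<longleftrightarrow> nats s ''n'' 0 = n \<and> nats s ''src'' = src \<and> nats s ''dst'' = dst \<and> reals s ''y'' = y \<and>
     (\<forall>v. nats s ''s'' v \<le> 2) \<and> card (tree s) = nats s ''v'' 0 \<and> (\<forall>v. Suc n dvd nats s ''f'' v) \<and>
     search_inv (tree s) (front s) (nats s ''u'' 0) (nats s ''b'') (stacks (Suc n) (nats s ''f'') (nats s ''g''))
       {e. nats s ''out'' e \<noteq> 0}"

lemma graph_inv_cong:
  assumes "graph_inv s" "\<And>a. a \<in> {''n'', ''src'', ''dst'', ''s'', ''v'', ''f'', ''g'', ''u'', ''b'', ''out''} \<Longrightarrow> nats s' a = nats s a"
    "reals s' ''y'' = reals s ''y''"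
  shows "graph_inv s'"
  using assms unfolding graph_inv_def tree_def front_def by simp

text \<open>94 credits per adjacency entry cover the dearest case, a decrease of a key, with 7 steps
  and the 75 credits of the cuts.\<close>

definition edge_credits :: "store \<Rightarrow> nat" where
  "edge_credits s = 94 * (\<Sum>v\<le>n. nats s ''f'' v div Suc n)"

lemma wpt_relax_loop:
  assumes "graph_inv s" "heap_state n (front s) 0 s" "root_list (front s) s"
    and k: "potential n (front s) s + edge_credits s + 1 + R \<le> k"
  shows "wpt \<omega> relax_loop (\<lambda>s' k'. graph_inv s' \<and> heap_state n (front s') 0 s' \<and> root_list (front s') s' \<and>
    nats s' ''f'' (nats s' ''u'' 0) = 0 \<and> potential n (front s') s' + edge_credits s' + R \<le> k') s k"
  unfolding relax_loop_def
proof (rule wpt_While)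
  let ?I = "\<lambda>s k. graph_inv s \<and> heap_state n (front s) 0 s \<and> root_list (front s) s \<and>
    potential n (front s) s + edge_credits s + 1 + R \<le> k"
  show "?I s k" using assms by simp
  show "1 \<le> k \<and> graph_inv s \<and> heap_state n (front s) 0 s \<and> root_list (front s) s \<and>
    nats s ''f'' (nats s ''u'' 0) = 0 \<and> potential n (front s) s + edge_credits s + R \<le> k - 1"
    if I: "?I s k" and b: "\<not> bval (NLess (NConst 0) (NRead ''f'' (Var ''u''))) s" for s k
    using I b by (simp, linarith)
  show "1 \<le> k \<and> wpt \<omega> (NWrite ''f'' (Var ''u'') (NSub (NRead ''f'' (Var ''u'')) Stride) ;;
     Set ''e'' (NRead ''g'' (NAdd (Var ''u'') (NRead ''f'' (Var ''u'')))) ;;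
     Set ''x'' (NSub (NAdd (NRead ''src'' (Var ''e'')) (NRead ''dst'' (Var ''e''))) (Var ''u'')) ;;
     If (NLess (NRead ''s'' (Var ''x'')) (NConst 1))
       (NWrite ''s'' (Var ''x'') (NConst 1) ;; NWrite ''b'' (Var ''x'') (Var ''e'') ;; push_root ''x'')
       (If (BAnd (NLess (NRead ''s'' (Var ''x'')) (NConst 2)) (RLess (RRead ''y'' (Var ''e'')) (Key ''x'')))
         (NWrite ''b'' (Var ''x'') (Var ''e'') ;; cut_loop)
         Skip)) ?I s (k - 1)"
    if I: "?I s k" and b: "bval (NLess (NConst 0) (NRead ''f'' (Var ''u''))) s" for s k
  proof -
    define u where "u = nats s ''u'' 0"
    define f where "f = nats s ''f''"
    define g where "g = nats s ''g''"
    define st where "st = nats s ''s''"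
    define bb where "bb = nats s ''b''"
    define p where "p = nats s ''p''"
    define d where "d = nats s ''d''"
    define kk where "kk = nats s ''k''"
    define r where "r = nats s ''r''"
    define q where "q = nats s ''q'' 0"
    define out where "out = nats s ''out''"
    define f' where "f' = f(u := f u - Suc n)"
    define e where "e = g (u + (f u - Suc n))"
    define x where "x = src e + dst e - u"
    define T where "T = tree s"
    define F where "F = front s"
    define L where "L = stacks (Suc n) (nats s ''c'') (nats s ''h'')"
    have gi: "nats s ''n'' 0 = n" "nats s ''src'' = src" "nats s ''dst'' = dst" "reals s ''y'' = y"
      "\<forall>v. st v \<le> 2" "card T = nats s ''v'' 0" "\<forall>v. Suc n dvd f v"
      and si: "search_inv T F u bb (stacks (Suc n) f g) {e. out e \<noteq> 0}"
      using I unfolding graph_inv_def T_def F_def u_def bb_def f_def g_def out_def st_def by auto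
    have Tst: "{v. st v = 2} = T" and Fst: "{v. st v = Suc 0} = F" unfolding T_def F_def tree_def front_def st_def by auto
    have hp: "fib_heap F (\<lambda>v. y (bb v)) 0 p d kk L" and cdv: "\<forall>v. Suc n dvd nats s ''c'' v" and FH: "F \<subseteq> {1..n}"
      using I gi unfolding heap_state_def bb_def p_def d_def kk_def L_def F_def by auto
    have rl: "inj_on r {..<q}" "r ` {..<q} = roots F p" using I unfolding root_list_def r_def q_def p_def F_def by auto
    have f0: "0 < f u" using b unfolding f_def u_def by simp
    have un: "u \<le> n" using si unfolding search_inv_def by auto
    have dvu: "Suc n dvd f u" using gi by simp
    note sp = stacks_pop[where a = g and c = f and u = u and N = "Suc n", OF dvu f0, folded f'_def e_def]
    note sr = search_relax[OF si sp(1) refl sp(2)[symmetric, THEN sym] x_def, simplified]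
    have dv': "\<forall>v. Suc n dvd f' v" using gi unfolding f'_def by (auto intro: dvd_diff_nat)
    have x1: "1 \<le> x" "x \<le> n" using sr(1) by auto
    have fu: "f' u = f u - Suc n" unfolding f'_def by simp
    have e': "g (u + f' u) = e" unfolding e_def fu ..
    have "f u = f' u + Suc n" using dvu f0 unfolding fu by (auto dest: dvd_imp_le)
    then have "f u div Suc n = f' u div Suc n + 1" by (metis Suc_eq_plus1 div_add_self2 nat.distinct(1))
    then have sf: "(\<Sum>v\<le>n. f' v div Suc n) + 1 = (\<Sum>v\<le>n. f v div Suc n)"
      using sum_div_fun_upd[OF un, of f "f u - Suc n" "Suc n"] unfolding fu f'_def[symmetric] by simp
    define P where "P = 37 * (\<Sum>v\<le>n. kk v) + 8 * (\<Sum>v\<le>n. nats s ''c'' v div Suc n)"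
    have pot: "7 * q + 20 * card (roots F p) + P + 94 * (\<Sum>v\<le>n. f' v div Suc n) + 95 + R \<le> k"
      using I sf unfolding potential_def edge_credits_def q_def p_def F_def f_def kk_def P_def by linarith
    then have "95 \<le> k" by linarith
    then obtain k' where k': "k = k' + 95" by (metis le_Suc_ex add.commute)
    note folds = u_def[symmetric] f_def[symmetric] g_def[symmetric] st_def[symmetric] bb_def[symmetric] p_def[symmetric]
      d_def[symmetric] kk_def[symmetric] r_def[symmetric] q_def[symmetric] out_def[symmetric] f'_def[symmetric] e' x_def[symmetric]
      L_def[symmetric] gi(1-4)
    define s1 where "s1 = nat_write ''x'' 0 x (nat_write ''e'' 0 e (nat_write ''f'' u (f u - Suc n) s))"
    consider "st x = 0" | "st x = 1" "y e < y (bb x)" | "st x = 2 \<or> st x = 1 \<and> y (bb x) \<le> y e"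
      using gi(5) by (metis One_nat_def Suc_1 le_SucE le_zero_eq not_less)
    then show ?thesis
    proof cases
      case 1
      define s2 where "s2 = nat_write ''q'' 0 (Suc q) (nat_write ''r'' q x (nat_write ''b'' x e (nat_write ''s'' x 1 s1)))"
      have xT: "x \<notin> T" "x \<notin> F" using 1 Tst Fst by auto
      have t2: "tree s2 = T" using Tst 1 unfolding tree_def s2_def s1_def by (auto simp: st_def)
      have f2: "front s2 = insert x F" using Fst 1 unfolding front_def s2_def s1_def by (auto simp: st_def)
      have hp2: "fib_heap (insert x F) (\<lambda>v. y ((bb(x := e)) v)) 0 p d kk L"
        using xT x1 by (intro fib_heap_insert[OF hp]) auto
      have px: "p x = 0" using fib_heapD(3)[OF hp] xT by blast
      then have rt: "roots (insert x F) p = insert x (roots F p)" "x \<notin> roots F p" using xT unfolding roots_def by auto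
      have crt: "card (roots (insert x F) p) = Suc (card (roots F p))" using rt finite_roots[OF hp] by simp
      have "x \<notin> r ` {..<q}" using rt rl by simp
      note pi = push_image[OF rl(1) this]
      have "graph_inv s2"
        unfolding graph_inv_def t2 f2 using gi dv' sr(4) xT
        by (simp add: s2_def s1_def folds)
      moreover have "heap_state n (insert x F) 0 s2"
        using hp2 FH x1 cdv by (simp add: heap_state_def s2_def s1_def folds)
      moreover have "root_list (insert x F) s2"
        unfolding root_list_def using pi rt rl by (simp add: s2_def s1_def folds)
      moreover have "potential n (insert x F) s2 + edge_credits s2 + 1 + R \<le> k - 9"
        using pot crt k' by (simp add: potential_def edge_credits_def s2_def s1_def folds P_def)
      ultimately have "?I s2 (k - 9)" unfolding f2 by simp
      then show ?thesis using 1 k' by (simp add: exec_simps s2_def s1_def folds)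
    next
      case 2
      have xF: "x \<in> F" "x \<notin> T" "x \<noteq> 0" using 2 Tst Fst x1 by auto
      define s2 where "s2 = nat_write ''b'' x e s1"
      have t2: "tree s2 = T" "front s2 = F" using Tst Fst unfolding tree_def front_def s2_def s1_def by (auto simp: st_def)
      have hp2: "fib_heap F (\<lambda>v. y ((bb(x := e)) v)) x p d kk L"
        using 2 by (intro fib_heap_decrease[OF hp]) auto
      have g2: "graph_inv s2"
        unfolding graph_inv_def t2 using gi dv' sr(5) xF 2
        by (simp add: s2_def s1_def folds)
      have h2: "heap_state n F (nats s2 ''x'' 0) s2"
        using hp2 FH cdv by (simp add: heap_state_def s2_def s1_def folds)
      have r2: "root_list F s2"
        unfolding root_list_def using rl by (simp add: s2_def s1_def folds)
      have x2: "nats s2 ''x'' 0 \<noteq> 0" unfolding s2_def s1_def using xF by simp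
      have c2: "potential n F s2 + 75 + (edge_credits s2 + 1 + R) \<le> k - 7"
        using pot k' by (simp add: potential_def edge_credits_def s2_def s1_def folds P_def)
      have "wpt \<omega> cut_loop ?I s2 (k - 7)"
      proof (rule wpt_frame[OF wpt_cut_loop[OF h2 r2 x2 c2]])
        fix s' k'
        assume J: "heap_state n F 0 s' \<and> root_list F s' \<and> potential n F s' + (edge_credits s2 + 1 + R) \<le> k'"
          and fr: "\<And>a. a \<notin> nat_arrays cut_loop \<Longrightarrow> nats s' a = nats s2 a"
          and frr: "\<And>a. a \<notin> real_arrays cut_loop \<Longrightarrow> reals s' a = reals s2 a"
        have fr': "nats s' a = nats s2 a" if "a \<in> {''n'', ''src'', ''dst'', ''s'', ''v'', ''f'', ''g'', ''u'', ''b'', ''out''}" for a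
          using that by (intro fr) (auto simp: cut_loop_def push_root_def)
        have "graph_inv s'" by (rule graph_inv_cong[OF g2 fr']) (auto intro!: frr simp: cut_loop_def push_root_def)
        moreover have "front s' = F" using t2(2) fr' unfolding front_def by simp
        moreover have "edge_credits s' = edge_credits s2" using fr' unfolding edge_credits_def by simp
        ultimately show "?I s' k'" using J by simp
      qed
      then show ?thesis using 2 k' by (simp add: exec_simps s2_def s1_def folds)
    next
      case 3
      have x3: "x \<in> T \<or> x \<in> F \<and> y (bb x) \<le> y e" using 3 Tst Fst by auto
      have t2: "tree s1 = T" "front s1 = F" using Tst Fst unfolding tree_def front_def s1_def by (auto simp: st_def)
      have "graph_inv s1"
        unfolding graph_inv_def t2 using gi dv' sr(6)[OF x3]
        by (simp add: s1_def folds)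
      moreover have "heap_state n F 0 s1"
        using hp FH cdv by (simp add: heap_state_def s1_def folds)
      moreover have "root_list F s1"
        unfolding root_list_def using rl by (simp add: s1_def folds)
      moreover have "potential n F s1 + edge_credits s1 + 1 + R \<le> k - 7"
        using pot k' by (simp add: potential_def edge_credits_def s1_def folds P_def)
      ultimately have "?I s1 (k - 7)" unfolding t2 by simp
      moreover have "\<not> st x < 1" "\<not> (st x < 2 \<and> y e < y (bb x))" using 3 by auto
      ultimately show ?thesis using k' by (auto simp: exec_simps s1_def folds)
    qed
  qed
qed

lemma graph_inv_bounds:
  assumes "graph_inv s"
  shows "finite (tree s)" "card (tree s) \<le> n" "card (front s) \<le> n" "front s \<subseteq> {1..n}"
proof -
  have si: "search_inv (tree s) (front s) (nats s ''u'' 0) (nats s ''b'') (stacks (Suc n) (nats s ''f'') (nats s ''g''))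
       {e. nats s ''out'' e \<noteq> 0}" using assms unfolding graph_inv_def by blast
  note D = search_invD(1,2)[OF si]
  show "front s \<subseteq> {1..n}" by (rule D(2))
  show "finite (tree s)" using D(1) finite_subset by blast
  show "card (tree s) \<le> n" "card (front s) \<le> n" using D card_mono[of "{1..n}"] by auto
qed

definition main_inv :: "store \<Rightarrow> bool" where
  "main_inv s \<longleftrightarrow> graph_inv s \<and> heap_state n (front s) 0 s \<and> root_list (front s) s \<and> nats s ''a'' = (\<lambda>_. 0)"

definition done_relaxing :: "store \<Rightarrow> bool" where
  "done_relaxing s \<longleftrightarrow> graph_inv s \<and> heap_state n (front s) 0 s \<and> nats s ''f'' (nats s ''u'' 0) = 0 \<and> nats s ''v'' 0 < n"

lemma done_relaxing_cong:
  assumes "done_relaxing s" "heap_state n (front s) 0 s'"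
    "\<And>a. a \<in> {''n'', ''src'', ''dst'', ''s'', ''v'', ''f'', ''g'', ''u'', ''b'', ''out''} \<Longrightarrow> nats s' a = nats s a"
    "reals s' ''y'' = reals s ''y''"
  shows "done_relaxing s'" "front s' = front s" "edge_credits s' = edge_credits s" "nats s' ''v'' 0 = nats s ''v'' 0"
proof -
  have "graph_inv s'" using assms(1,3,4) graph_inv_cong unfolding done_relaxing_def by blast
  moreover show "front s' = front s" using assms(3) unfolding front_def by simp
  ultimately show "done_relaxing s'" using assms unfolding done_relaxing_def by simp
  show "edge_credits s' = edge_credits s" "nats s' ''v'' 0 = nats s ''v'' 0" using assms(3) unfolding edge_credits_def by simp_all
qed

text \<open>A round visits at most 3 * lg cells at 17 credits and releases fewer than 3 * lg
  children at 27 credits, in total 132 * lg; the constant 20 covers the remaining steps.\<close>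

definition rounds :: "store \<Rightarrow> nat" where
  "rounds s = (132 * lg + 20) * (n - nats s ''v'' 0)"

text \<open>51 * lg + 10 of the credits of the current round may be spent by now, on collecting and
  on single steps; 81 * lg are left for the children of \<open>z\<close>.\<close>

lemma wpt_delete_min:
  assumes dr: "done_relaxing s" and cs: "cons_state (front s) (nats s ''z'' 0) s" and br: "best_root s" and t: "nats s ''t'' 0 = 0"
    and k: "potential n (front s) s + edge_credits s + rounds s + R \<le> k + (51 * lg + 10)"
  shows "wpt \<omega> (NWrite ''out'' (NRead ''b'' (Var ''z'')) (NConst 1) ;;
     NWrite ''s'' (Var ''z'') (NConst 2) ;;
     children_loop ;;
     Set ''u'' (Var ''z'') ;;
     Set ''v'' (NAdd (Var ''v'') (NConst 1)))
     (\<lambda>s k. main_inv s \<and> potential n (front s) s + edge_credits s + rounds s + 1 + R \<le> k) s k"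
proof -
  define z where "z = nats s ''z'' 0"
  define T where "T = tree s"
  define F where "F = front s"
  define r where "r = nats s ''r''"
  define q where "q = nats s ''q'' 0"
  define p where "p = nats s ''p''"
  define key where "key v = y (nats s ''b'' v)" for v
  define L where "L = stacks (Suc n) (nats s ''f'') (nats s ''g'')"
  have gi: "graph_inv s" and hs: "heap_state n F 0 s" and fu: "nats s ''f'' (nats s ''u'' 0) = 0" and vn: "nats s ''v'' 0 < n"
    using dr unfolding done_relaxing_def F_def by auto
  have g: "nats s ''n'' 0 = n" "reals s ''y'' = y" "\<And>v. nats s ''s'' v \<le> 2" "card T = nats s ''v'' 0"
    and si: "search_inv T F (nats s ''u'' 0) (nats s ''b'') L {e. nats s ''out'' e \<noteq> 0}"
    using gi unfolding graph_inv_def T_def F_def L_def by auto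
  have hp: "fib_heap F key 0 p (nats s ''d'') (nats s ''k'') (stacks (Suc n) (nats s ''c'') (nats s ''h''))"
    using hs g unfolding heap_state_def key_def p_def by simp
  have cs': "consolidating (roots F p) z (nats s ''d'') (nats s ''a'') r q 0"
    using cs t unfolding cons_state_def z_def F_def r_def q_def p_def by simp
  note cd = consolidatingD_done[OF cs']
  have Lu: "L (nats s ''u'' 0) = []" unfolding L_def stacks_def using fu by simp
  have "F \<noteq> {}" using search_frontier[OF si Lu] g vn by simp
  then have "roots F p \<noteq> {}" using fib_heap_root_below[OF hp] by blast
  then have z0: "z \<noteq> 0" using cd(3) br unfolding best_root_def z_def q_def by (auto split: if_splits)
  have zr: "z \<in> roots F p" using cd(2)[OF z0] by simp
  then have zF: "z \<in> F" "p z = 0" unfolding roots_def by auto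
  have zn: "z \<le> n" using zF search_invD(2)[OF si] by auto
  have "\<forall>v\<in>r ` {..<q}. key z \<le> key v"
    using br z0 unfolding best_root_def z_def[symmetric] r_def[symmetric] q_def[symmetric] key_def g(2) by simp
  then have "key z \<le> key v" if "v \<in> roots F p" for v using that cd(2)[OF z0] by auto
  then have zmin: "key z \<le> key v" if "v \<in> F" for v
    using fib_heap_root_below[OF hp that] by (meson order_trans)
  have sn: "search_inv (insert z T) (F - {z}) z (nats s ''b'') L (insert (nats s ''b'' z) {e. nats s ''out'' e \<noteq> 0})"
    using search_next[OF si Lu zF(1)] zmin unfolding key_def by blast
  have zT: "z \<notin> T" using zF search_invD(3)[OF si] by blast
  have dz: "nats s ''d'' z < 3 * lg"
    using fib_heap_degree[OF hp _ lg zF(1)] graph_inv_bounds(3)[OF gi] unfolding F_def by blast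
  define s2 where "s2 = nat_write ''s'' z 2 (nat_write ''out'' (nats s ''b'' z) 1 s)"
  have t2: "{v. nats s2 ''s'' v = 2} = insert z T" "{v. nats s2 ''s'' v = 1} = F - {z}"
    unfolding s2_def T_def F_def tree_def front_def by auto
  have h2: "heap_state n F 0 s2" using hs unfolding heap_state_def s2_def by simp
  have e2: "nats s2 ''n'' 0 = n" "nats s2 ''z'' 0 = z" "nats s2 ''p'' z = 0"
    "roots F (nats s2 ''p'') = insert z (nats s2 ''r'' ` {..<nats s2 ''q'' 0})"
    "z \<notin> nats s2 ''r'' ` {..<nats s2 ''q'' 0}" "inj_on (nats s2 ''r'') {..<nats s2 ''q'' 0}"
    using g zF cd(2)[OF z0] cd(4,5) by (simp_all add: s2_def z_def p_def r_def q_def)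
  define M where "M = (132 * lg + 20) * (n - Suc (nats s ''v'' 0))"
  have rn: "rounds s = M + (132 * lg + 20)"
  proof -
    have "n - nats s ''v'' 0 = Suc (n - Suc (nats s ''v'' 0))" using vn by simp
    then show ?thesis unfolding rounds_def M_def by simp
  qed
  have pot2: "potential n F s2 = potential n F s" unfolding potential_def s2_def by simp
  define R' where "R' = edge_credits s + M + 1 + R + 2"
  have d2: "nats s2 ''d'' z = nats s ''d'' z" unfolding s2_def by simp
  have c2: "potential n F s2 + 27 * nats s2 ''d'' z + 1 + R' \<le> k - 2"
    using k[folded F_def] dz rn pot2 d2 R'_def by linarith
  have k2: "2 \<le> k" using c2 R'_def by linarith
  have "wpt \<omega> children_loop (wpt \<omega> (Set ''u'' (Var ''z'') ;; Set ''v'' (NAdd (Var ''v'') (NConst 1)))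
     (\<lambda>s k. main_inv s \<and> potential n (front s) s + edge_credits s + rounds s + 1 + R \<le> k)) s2 (k - 2)"
  proof (rule wpt_frame[OF wpt_children_loop[OF h2 e2(1,2) zF(1) e2(3-6) c2]])
    fix s' k'
    assume J: "heap_state n F 0 s' \<and> nats s' ''p'' z = 0 \<and> roots F (nats s' ''p'') = insert z (nats s' ''r'' ` {..<nats s' ''q'' 0}) \<and>
        z \<notin> nats s' ''r'' ` {..<nats s' ''q'' 0} \<and> inj_on (nats s' ''r'') {..<nats s' ''q'' 0} \<and>
        (\<forall>c. nats s' ''p'' c \<noteq> z) \<and> potential n F s' + R' \<le> k'"
      and fr: "\<And>a. a \<notin> nat_arrays children_loop \<Longrightarrow> nats s' a = nats s2 a"
      and frr: "\<And>a. a \<notin> real_arrays children_loop \<Longrightarrow> reals s' a = reals s2 a"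
    have fr': "nats s' a = nats s2 a"
      if "a \<in> {''n'', ''src'', ''dst'', ''s'', ''v'', ''f'', ''g'', ''u'', ''b'', ''out'', ''a'', ''z''}" for a
      using that by (intro fr) (auto simp: children_loop_def push_root_def)
    have ry: "reals s' ''y'' = y" using frr[of "''y''"] g unfolding s2_def by (simp add: children_loop_def push_root_def)
    define s3 where "s3 = nat_write ''v'' 0 (nats s' ''v'' 0 + 1) (nat_write ''u'' 0 z s')"
    have t3: "tree s3 = insert z T" "front s3 = F - {z}"
      using t2 fr' unfolding tree_def front_def s3_def by simp_all
    have cT: "card (insert z T) = nats s ''v'' 0 + 1" using zT g(4) graph_inv_bounds(1)[OF gi] unfolding T_def by simp
    have out: "{e. nats s2 ''out'' e \<noteq> 0} = insert (nats s ''b'' z) {e. nats s ''out'' e \<noteq> 0}" unfolding s2_def by auto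
    have o3: "nats s3 ''out'' = nats s2 ''out''" using fr' unfolding s3_def by simp
    have "graph_inv s3"
      unfolding graph_inv_def t3 o3 out cT using gi sn fr' ry
      by (simp add: s3_def s2_def graph_inv_def L_def)
    moreover have "heap_state n (F - {z}) 0 s3"
      using J fib_heap_delete[of F _ _ _ _ _ z] unfolding heap_state_def s3_def by auto
    moreover have rt: "roots (F - {z}) (nats s3 ''p'') = roots F (nats s' ''p'') - {z}" unfolding s3_def roots_def by auto
    then have "root_list (F - {z}) s3" using J unfolding root_list_def rt by (simp add: s3_def)
    moreover have "nats s3 ''a'' = (\<lambda>_. 0)" using cd(1) fr' by (simp add: s3_def s2_def)
    ultimately have m3: "main_inv s3" unfolding main_inv_def t3 by blast
    have "card (roots (F - {z}) (nats s3 ''p'')) \<le> card (roots F (nats s' ''p''))"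
    proof (unfold rt, rule card_mono)
      show "finite (roots F (nats s' ''p''))" using J finite_roots unfolding heap_state_def by blast
    qed auto
    then have "potential n (F - {z}) s3 \<le> potential n F s'" unfolding potential_def s3_def by simp
    moreover have "edge_credits s3 = edge_credits s" using fr' unfolding edge_credits_def s3_def s2_def by simp
    moreover have "rounds s3 = M" using fr' unfolding rounds_def M_def s3_def s2_def by simp
    moreover have "potential n F s' + R' \<le> k'" using J by blast
    ultimately have "potential n (front s3) s3 + edge_credits s3 + rounds s3 + 1 + R \<le> k' - 2" "2 \<le> k'"
      unfolding t3 R'_def by linarith+
    moreover have "nats s' ''z'' 0 = z" using fr' e2(2) by simp
    ultimately show "wpt \<omega> (Set ''u'' (Var ''z'') ;; Set ''v'' (NAdd (Var ''v'') (NConst 1)))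
       (\<lambda>s k. main_inv s \<and> potential n (front s) s + edge_credits s + rounds s + 1 + R \<le> k) s' k'"
      using m3 unfolding wpt_simps by (simp add: s3_def numeral_2_eq_2)
  qed
  then show ?thesis using k2 unfolding wpt_simps by (simp add: s2_def z_def[symmetric] numeral_2_eq_2)
qed

lemma wpt_prim_loop:
  assumes "main_inv s" and k: "potential n (front s) s + edge_credits s + rounds s + 1 + R \<le> k"
  shows "wpt \<omega> prim_loop (\<lambda>s' k'. main_inv s' \<and> n \<le> nats s' ''v'' 0) s k"
  unfolding prim_loop_def
proof (rule wpt_While)
  let ?I = "\<lambda>s k. main_inv s \<and> potential n (front s) s + edge_credits s + rounds s + 1 + R \<le> k"
  show "?I s k" using assms by simp
  show "1 \<le> k \<and> main_inv s \<and> n \<le> nats s ''v'' 0" if I: "?I s k" and b: "\<not> bval (NLess (Var ''v'') (Var ''n'')) s" for s k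
  proof -
    have "nats s ''n'' 0 = n" using I unfolding main_inv_def graph_inv_def by blast
    then show ?thesis using I b by simp
  qed
  let ?c5 = "NWrite ''out'' (NRead ''b'' (Var ''z'')) (NConst 1) ;;
     NWrite ''s'' (Var ''z'') (NConst 2) ;;
     children_loop ;;
     Set ''u'' (Var ''z'') ;;
     Set ''v'' (NAdd (Var ''v'') (NConst 1))"
  let ?c4 = "Set ''z'' (NConst 0) ;; collect_loop ;; ?c5"
  let ?c3 = "Set ''t'' (NConst 0) ;; consolidate_loop ;; ?c4"
  let ?G = "{''n'', ''src'', ''dst'', ''s'', ''v'', ''f'', ''g'', ''u'', ''b'', ''out''}"
  \<comment> \<open>The phases of the loop body are treated from the last to the first. The constant
    added to \<open>k\<close> allows for steps of this round that are already paid.\<close>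
  have c4: "wpt \<omega> ?c4 ?I s k"
    if dr: "done_relaxing s" and cs: "cons_state (front s) 0 s" and q: "nats s ''q'' 0 = 0" and t: "nats s ''t'' 0 \<le> 3 * lg"
      and k: "potential n (front s) s + edge_credits s + rounds s + R \<le> k + 8" for s k
  proof -
    define s1 where "s1 = nat_write ''z'' 0 0 s"
    have f1: "front s1 = front s" unfolding front_def s1_def by simp
    have h1: "heap_state n (front s) 0 s1" using dr unfolding done_relaxing_def heap_state_def s1_def by simp
    have dr1: "done_relaxing s1" by (rule done_relaxing_cong(1)[OF dr h1]) (auto simp: s1_def)
    have cs1: "cons_state (front s1) (nats s1 ''z'' 0) s1" unfolding f1 using cs unfolding cons_state_def s1_def by simp
    have br1: "best_root s1" using q unfolding best_root_def s1_def by simp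
    have e1: "potential n (front s1) s1 = potential n (front s) s" "edge_credits s1 = edge_credits s" "rounds s1 = rounds s"
      "nats s1 ''t'' 0 = nats s ''t'' 0"
      unfolding f1 by (simp_all add: potential_def edge_credits_def rounds_def s1_def)
    have rn: "132 * lg + 20 \<le> rounds s"
      using dr unfolding done_relaxing_def rounds_def by (cases "n - nats s ''v'' 0") auto
    \<comment> \<open>All credits that the loop does not consume, passed through its specification
      to the next phase.\<close>
    define B where "B = k - 1 - (potential n (front s1) s1 + 17 * nats s1 ''t'' 0 + 1)"
    have B: "potential n (front s1) s1 + 17 * nats s1 ''t'' 0 + 1 + B \<le> k - 1" "1 \<le> k"
      "edge_credits s + rounds s + R \<le> B + 51 * lg + 10"
      using k rn t unfolding B_def e1 by linarith+
    have "wpt \<omega> collect_loop (wpt \<omega> ?c5 ?I) s1 (k - 1)"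
    proof (rule wpt_frame[OF wpt_collect_loop[OF cs1 br1 B(1)]])
      fix s' k'
      assume J: "cons_state (front s1) (nats s' ''z'' 0) s' \<and> best_root s' \<and> nats s' ''t'' 0 = 0 \<and> potential n (front s1) s' + B \<le> k'"
        and fr: "\<And>a. a \<notin> nat_arrays collect_loop \<Longrightarrow> nats s' a = nats s1 a"
        and frr: "\<And>a. a \<notin> real_arrays collect_loop \<Longrightarrow> reals s' a = reals s1 a"
      have fr': "nats s' a = nats s1 a" if "a \<in> {''p'', ''d'', ''k'', ''c'', ''h''} \<union> ?G" for a
        using that by (intro fr) (auto simp: collect_loop_def push_root_def)
      have ry: "reals s' ''y'' = reals s1 ''y''" by (rule frr) (simp add: collect_loop_def push_root_def)
      have h': "heap_state n (front s1) 0 s'" using h1 fr' ry unfolding heap_state_def f1 by simp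
      have frG: "nats s' a = nats s1 a" if "a \<in> ?G" for a using fr' that by blast
      note dc = done_relaxing_cong[OF dr1 h' frG ry]
      have e': "edge_credits s' = edge_credits s" "rounds s' = rounds s" using dc(3,4) e1 unfolding rounds_def by (simp_all add: s1_def)
      show "wpt \<omega> ?c5 ?I s' k'"
      proof (rule wpt_delete_min)
        show "potential n (front s') s' + edge_credits s' + rounds s' + R \<le> k' + (51 * lg + 10)"
          using B(3) J e' arg_cong[OF dc(2), of "\<lambda>H. potential n H s'"] by linarith
      qed (use dc J in auto)
    qed
    then show ?thesis using B(2) unfolding wpt_simps by (simp add: s1_def)
  qed
  have c3: "wpt \<omega> ?c3 ?I s k"
    if dr: "done_relaxing s" and rl: "root_list (front s) s" and a: "nats s ''a'' = (\<lambda>_. 0)"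
      and k: "potential n (front s) s + edge_credits s + rounds s + R \<le> k + 2" for s k
  proof -
    define s1 where "s1 = nat_write ''t'' 0 0 s"
    have f1: "front s1 = front s" unfolding front_def s1_def by simp
    have h1: "heap_state n (front s) 0 s1" using dr unfolding done_relaxing_def heap_state_def s1_def by simp
    have dr1: "done_relaxing s1" by (rule done_relaxing_cong(1)[OF dr h1]) (auto simp: s1_def)
    have n1: "nats s1 ''n'' 0 = n" using dr1 unfolding done_relaxing_def graph_inv_def by blast
    have "0 \<notin> roots (front s) (nats s ''p'')"
      using graph_inv_bounds(4)[of s] dr unfolding done_relaxing_def roots_def by auto
    then have cs1: "cons_state (front s) 0 s1"
      using consolidating_start rl a unfolding cons_state_def root_list_def s1_def by simp
    have t1: "nats s1 ''t'' 0 \<le> 3 * lg" unfolding s1_def by simp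
    have e1: "potential n (front s) s1 = potential n (front s) s" "edge_credits s1 = edge_credits s" "rounds s1 = rounds s"
      by (simp_all add: potential_def edge_credits_def rounds_def s1_def)
    have rn: "132 * lg + 20 \<le> rounds s"
      using dr unfolding done_relaxing_def rounds_def by (cases "n - nats s ''v'' 0") auto
    define B where "B = k - 1 - (potential n (front s) s1 + 1)"
    have B: "potential n (front s) s1 + 1 + B \<le> k - 1" "1 \<le> k" "edge_credits s + rounds s + R \<le> B + 8"
      using k rn unfolding B_def e1 by linarith+
    have "wpt \<omega> consolidate_loop (wpt \<omega> ?c4 ?I) s1 (k - 1)"
    proof (rule wpt_frame[OF wpt_consolidate_loop[OF h1 n1 cs1 t1 lg B(1)]])
      fix s' k'
      assume J: "heap_state n (front s) 0 s' \<and> nats s' ''n'' 0 = n \<and> nats s' ''q'' 0 = 0 \<and>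
          cons_state (front s) 0 s' \<and> nats s' ''t'' 0 \<le> 3 * lg \<and> potential n (front s) s' + B \<le> k'"
        and fr: "\<And>a. a \<notin> nat_arrays consolidate_loop \<Longrightarrow> nats s' a = nats s1 a"
        and frr: "\<And>a. a \<notin> real_arrays consolidate_loop \<Longrightarrow> reals s' a = reals s1 a"
      have fr': "nats s' a = nats s1 a" if "a \<in> ?G" for a
        using that by (intro fr) (auto simp: consolidate_loop_def link_loop_def push_root_def)
      have ry: "reals s' ''y'' = reals s1 ''y''" by (rule frr) (simp add: consolidate_loop_def link_loop_def push_root_def)
      have h': "heap_state n (front s1) 0 s'" using J f1 by simp
      note dc = done_relaxing_cong[OF dr1 h' fr' ry]
      have f': "front s' = front s" using dc(2) f1 by simp
      have e': "edge_credits s' = edge_credits s" "rounds s' = rounds s" using dc(3,4) e1 unfolding rounds_def by (simp_all add: s1_def)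
      show "wpt \<omega> ?c4 ?I s' k'"
      proof (rule c4)
        show "potential n (front s') s' + edge_credits s' + rounds s' + R \<le> k' + 8"
          unfolding f' e' using B(3) J by linarith
      qed (use dc J f' in auto)
    qed
    then show ?thesis using B(2) unfolding wpt_simps by (simp add: s1_def)
  qed
  show "1 \<le> k \<and> wpt \<omega> (relax_loop ;; ?c3) ?I s (k - 1)"
    if I: "?I s k" and b: "bval (NLess (Var ''v'') (Var ''n'')) s" for s k
  proof -
    have gi: "graph_inv s" and hs: "heap_state n (front s) 0 s" and rl: "root_list (front s) s" and a: "nats s ''a'' = (\<lambda>_. 0)"
      using I unfolding main_inv_def by auto
    have n: "nats s ''n'' 0 = n" using gi unfolding graph_inv_def by blast
    have vn: "nats s ''v'' 0 < n" using b n by simp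
    have rn: "132 * lg + 20 \<le> rounds s" using vn unfolding rounds_def by (cases "n - nats s ''v'' 0") auto
    define B where "B = k - 1 - (potential n (front s) s + edge_credits s + 1)"
    have B: "potential n (front s) s + edge_credits s + 1 + B \<le> k - 1" "1 \<le> k" "rounds s + R \<le> B + 2"
      using I rn unfolding B_def by linarith+
    have "wpt \<omega> relax_loop (wpt \<omega> ?c3 ?I) s (k - 1)"
    proof (rule wpt_frame[OF wpt_relax_loop[OF gi hs rl B(1)]])
      fix s' k'
      assume J: "graph_inv s' \<and> heap_state n (front s') 0 s' \<and> root_list (front s') s' \<and>
          nats s' ''f'' (nats s' ''u'' 0) = 0 \<and> potential n (front s') s' + edge_credits s' + B \<le> k'"
        and fr: "\<And>a. a \<notin> nat_arrays relax_loop \<Longrightarrow> nats s' a = nats s a"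
      have fr': "nats s' a = nats s a" if "a \<in> {''v'', ''a''}" for a
        using that by (intro fr) (auto simp: relax_loop_def cut_loop_def push_root_def)
      have "rounds s' = rounds s" using fr' unfolding rounds_def by simp
      then show "wpt \<omega> ?c3 ?I s' k'"
        using J B(3) vn a fr' by (intro c3) (auto simp: done_relaxing_def)
    qed
    then show ?thesis using B(2) unfolding wpt_Seq by blast
  qed
qed

lemma main_inv_final:
  assumes "main_inv s" "n \<le> nats s ''v'' 0"
  shows "connects {1..n} ((\<lambda>e. {src e, dst e}) ` {e. nats s ''out'' e \<noteq> 0})"
    "{e. nats s ''out'' e \<noteq> 0} \<subseteq> K" "{e. nats s ''out'' e \<noteq> 0} \<subseteq> {..<m}"
proof -
  have gi: "graph_inv s" using assms unfolding main_inv_def by blast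
  have si: "search_inv (tree s) (front s) (nats s ''u'' 0) (nats s ''b'') (stacks (Suc n) (nats s ''f'') (nats s ''g''))
       {e. nats s ''out'' e \<noteq> 0}" and c: "card (tree s) = nats s ''v'' 0" using gi unfolding graph_inv_def by blast+
  note D = search_invD[OF si]
  have "tree s = {1..n}" using D(1) assms(2) c graph_inv_bounds(2)[OF gi] by (intro card_subset_eq) auto
  then show "connects {1..n} ((\<lambda>e. {src e, dst e}) ` {e. nats s ''out'' e \<noteq> 0})"
    unfolding connects_def using D(10) by blast
  show "{e. nats s ''out'' e \<noteq> 0} \<subseteq> K" "{e. nats s ''out'' e \<noteq> 0} \<subseteq> {..<m}" using D(9) by auto
qed

lemma main_inv_init:
  assumes "nats s ''n'' 0 = n" "nats s ''src'' = src" "nats s ''dst'' = dst" "reals s ''y'' = y"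
    and st: "nats s ''s'' = (\<lambda>_. 0)(1 := 2)" and uv: "nats s ''u'' 0 = 1" "nats s ''v'' 0 = 1" and n: "1 \<le> n"
    and dv: "\<forall>v. Suc n dvd nats s ''f'' v"
    and adj: "\<And>v. v \<in> {1..n} \<Longrightarrow> set (stacks (Suc n) (nats s ''f'') (nats s ''g'') v) = {e. e < m \<and> (src e = v \<or> dst e = v)}"
    and z: "\<And>a. a \<in> {''p'', ''d'', ''k'', ''c'', ''a'', ''q'', ''out''} \<Longrightarrow> nats s a = (\<lambda>_. 0)"
  shows "main_inv s" "potential n (front s) s = 0"
proof -
  have t: "tree s = {1}" "front s = {}" unfolding tree_def front_def st by auto
  have "search_inv {1} {} 1 (nats s ''b'') (stacks (Suc n) (nats s ''f'') (nats s ''g'')) {}"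
  proof (rule search_invI)
    fix e v assume e: "e < m" "incident v e" "v \<notin> {1}" "crosses {1} e"
    then have "incident 1 e" unfolding incident_def crosses_def by auto
    then show "v \<in> {} \<and> y (nats s ''b'' v) \<le> y e \<or> incident 1 e \<and> e \<in> set (stacks (Suc n) (nats s ''f'') (nats s ''g'') 1)"
      using adj[of 1] n e(1) unfolding incident_def by auto
  qed (use n adj in \<open>auto simp: incident_def\<close>)
  then have "graph_inv s"
    unfolding graph_inv_def t using assms(1-4) st uv dv z[of "''out''"] by simp
  moreover have "heap_state n {} 0 s"
    unfolding heap_state_def fib_heap_def using z by (simp add: acyclic_def)
  moreover have "root_list {} s" unfolding root_list_def roots_def using z[of "''q''"] by simp
  ultimately show "main_inv s" unfolding main_inv_def t using z[of "''a''"] by simp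
  show "potential n (front s) s = 0" unfolding potential_def t roots_def using z by simp
qed

end

section \<open>The program\<close>

abbreviation Num :: "nat \<Rightarrow> rexp" where
  "Num k \<equiv> ROfNat (NConst k)"

abbreviation RVar :: "string \<Rightarrow> rexp" where
  "RVar a \<equiv> RRead a (NConst 0)"

definition log_delta :: rexp where
  "log_delta = RLn (RDiv (Num 1) (RVar ''delta''))"

definition root_rho :: rexp where
  "root_rho = RSub (RSqrt (RAdd (RVar ''eps'') log_delta)) (RSqrt log_delta)"

definition step_expr :: rexp where
  "step_expr = RSqrt (RDiv (RMul (Num 2) (RMul root_rho root_rho)) (RSub (ROfNat (Var ''n'')) (Num 1)))"

definition noisy_expr :: rexp where
  "noisy_expr = RDiv (RRead ''x'' (Var ''i''))
     (RExp (RMul (RSub (Num 0) (RDiv step_expr (Num 2))) (RRead ''w'' (Var ''i''))))"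

definition add_edge :: "string \<Rightarrow> com" where
  "add_edge a = NWrite ''g'' (NAdd (NRead a (Var ''i'')) (NRead ''f'' (NRead a (Var ''i'')))) (Var ''i'') ;;
     NWrite ''f'' (NRead a (Var ''i'')) (NAdd (NRead ''f'' (NRead a (Var ''i''))) Stride)"

definition init_loop :: com where
  "init_loop = While (NLess (Var ''i'') (Var ''m''))
    (Sample ''x'' (Var ''i'') ;;
     RWrite ''y'' (Var ''i'') noisy_expr ;;
     add_edge ''src'' ;;
     add_edge ''dst'' ;;
     Set ''i'' (NAdd (Var ''i'') (NConst 1)))"

definition opk_program :: com where
  "opk_program = init_loop ;; Set ''u'' (NConst 1) ;; Set ''v'' (NConst 1) ;; NWrite ''s'' (NConst 1) (NConst 2) ;; prim_loop"

definition edges_loaded :: "nat \<Rightarrow> store \<Rightarrow> (nat \<Rightarrow> real) \<Rightarrow> store \<Rightarrow> bool" where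
  "edges_loaded n s0 yy s \<longleftrightarrow> drawn s = nats s ''i'' 0 \<and> nats s ''i'' 0 \<le> nats s0 ''m'' 0 \<and>
     (\<forall>a. a \<notin> {''f'', ''g'', ''i''} \<longrightarrow> nats s a = nats s0 a) \<and> (\<forall>a. a \<notin> {''x'', ''y''} \<longrightarrow> reals s a = reals s0 a) \<and>
     reals s ''y'' = (\<lambda>e. if e < nats s ''i'' 0 then yy e else 0) \<and>
     (\<forall>v. Suc n dvd nats s ''f'' v) \<and> (\<Sum>v\<le>n. nats s ''f'' v div Suc n) = 2 * nats s ''i'' 0 \<and>
     (\<forall>v\<in>{1..n}. set (stacks (Suc n) (nats s ''f'') (nats s ''g'') v) =
        {e. e < nats s ''i'' 0 \<and> (nats s0 ''src'' e = v \<or> nats s0 ''dst'' e = v)})"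

lemma stacks_add:
  fixes f g :: "nat \<Rightarrow> nat"
  assumes "\<forall>v. Suc n dvd f v" "u \<le> n"
  shows "\<forall>v. Suc n dvd (f(u := f u + Suc n)) v"
    "(\<Sum>v\<le>n. (f(u := f u + Suc n)) v div Suc n) = (\<Sum>v\<le>n. f v div Suc n) + 1"
    "\<And>v. v \<le> n \<Longrightarrow> set (stacks (Suc n) (f(u := f u + Suc n)) (g(u + f u := i)) v) =
      (if v = u then insert i (set (stacks (Suc n) f g v)) else set (stacks (Suc n) f g v))"
proof -
  show "\<forall>v. Suc n dvd (f(u := f u + Suc n)) v" using assms(1) by (metis dvd_add dvd_refl fun_upd_apply)
  have "(f u + Suc n) div Suc n = f u div Suc n + 1" by (simp only: div_add_self2 nat.distinct not_False_eq_True)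
  then show "(\<Sum>v\<le>n. (f(u := f u + Suc n)) v div Suc n) = (\<Sum>v\<le>n. f v div Suc n) + 1"
    using sum_div_fun_upd[OF assms(2), of f "f u + Suc n" "Suc n"] by linarith
  show "set (stacks (Suc n) (f(u := f u + Suc n)) (g(u + f u := i)) v) =
      (if v = u then insert i (set (stacks (Suc n) f g v)) else set (stacks (Suc n) f g v))" if "v \<le> n" for v
    using stacks_push[of u "Suc n" v f g i] assms that by simp
qed

lemma wpt_add_edge:
  assumes "nats s ''n'' 0 = n" "a \<notin> {''f'', ''g'', ''i'', ''n''}"
  shows "wpt \<omega> (add_edge a) Q s k \<longleftrightarrow> 2 \<le> k \<and>
    Q (nat_write ''f'' (nats s a (nats s ''i'' 0)) (nats s ''f'' (nats s a (nats s ''i'' 0)) + Suc n)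
        (nat_write ''g'' (nats s a (nats s ''i'' 0) + nats s ''f'' (nats s a (nats s ''i'' 0))) (nats s ''i'' 0) s)) (k - 2)"
  using assms by (auto simp: add_edge_def wpt_simps numeral_2_eq_2)

text \<open>Each edge takes 8 steps, including the two entries in adjacency lists. The noisy weight
  is a parameter \<open>yy\<close>, so its formula does not enter the loop proof.\<close>

lemma wpt_init_loop:
  assumes n: "nats s0 ''n'' 0 = n"
    and edge: "\<And>e. e < nats s0 ''m'' 0 \<Longrightarrow> nats s0 ''src'' e \<in> {1..n} \<and> nats s0 ''dst'' e \<in> {1..n} \<and> nats s0 ''src'' e \<noteq> nats s0 ''dst'' e"
    and yy: "\<And>s e. e < nats s0 ''m'' 0 \<Longrightarrow> nats s ''i'' 0 = e \<Longrightarrow> nats s ''n'' 0 = n \<Longrightarrow>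
      (\<And>a. a \<notin> {''x'', ''y''} \<Longrightarrow> reals s a = reals s0 a) \<Longrightarrow> reals s ''x'' e = \<omega> e \<Longrightarrow> rval noisy_expr s = yy e"
    and start: "edges_loaded n s0 yy s0"
    and i0: "nats s0 ''i'' 0 = 0"
  shows "wpt \<omega> init_loop (\<lambda>s k. edges_loaded n s0 yy s \<and> nats s ''i'' 0 = nats s0 ''m'' 0 \<and> R \<le> k) s0 (8 * nats s0 ''m'' 0 + 1 + R)"
  unfolding init_loop_def
proof (rule wpt_While[where I = "\<lambda>s k. edges_loaded n s0 yy s \<and> 8 * (nats s0 ''m'' 0 - nats s ''i'' 0) + 1 + R \<le> k"])
  let ?m = "nats s0 ''m'' 0"
  let ?I = "\<lambda>s k. edges_loaded n s0 yy s \<and> 8 * (?m - nats s ''i'' 0) + 1 + R \<le> k"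
  show "?I s0 (8 * ?m + 1 + R)" using start i0 by simp
  show "1 \<le> k \<and> edges_loaded n s0 yy s \<and> nats s ''i'' 0 = ?m \<and> R \<le> k - 1"
    if I: "?I s k" and b: "\<not> bval (NLess (Var ''i'') (Var ''m'')) s" for s k
  proof -
    have "nats s ''m'' 0 = ?m" "nats s ''i'' 0 \<le> ?m" using I unfolding edges_loaded_def by auto
    then show ?thesis using I b by auto
  qed
  show "1 \<le> k \<and> wpt \<omega> (Sample ''x'' (Var ''i'') ;; RWrite ''y'' (Var ''i'') noisy_expr ;;
     add_edge ''src'' ;; add_edge ''dst'' ;; Set ''i'' (NAdd (Var ''i'') (NConst 1))) ?I s (k - 1)"
    if I: "?I s k" and b: "bval (NLess (Var ''i'') (Var ''m'')) s" for s k
  proof -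
    define i where "i = nats s ''i'' 0"
    define f where "f = nats s ''f''"
    define g where "g = nats s ''g''"
    define x where "x = nats s0 ''src'' i"
    define z where "z = nats s0 ''dst'' i"
    have L: "drawn s = i" "\<And>a. a \<notin> {''f'', ''g'', ''i''} \<Longrightarrow> nats s a = nats s0 a"
      "\<And>a. a \<notin> {''x'', ''y''} \<Longrightarrow> reals s a = reals s0 a"
      "reals s ''y'' = (\<lambda>e. if e < i then yy e else 0)" "\<forall>v. Suc n dvd f v" "(\<Sum>v\<le>n. f v div Suc n) = 2 * i"
      "\<And>v. v \<in> {1..n} \<Longrightarrow> set (stacks (Suc n) f g v) = {e. e < i \<and> (nats s0 ''src'' e = v \<or> nats s0 ''dst'' e = v)}"
      using I unfolding edges_loaded_def i_def f_def g_def by auto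
    have nm: "nats s ''n'' 0 = n" "nats s ''m'' 0 = ?m" "nats s ''src'' i = x" "nats s ''dst'' i = z"
      using L(2) n unfolding x_def z_def by simp_all
    have im: "i < ?m" using b nm unfolding i_def by simp
    have xz: "x \<in> {1..n}" "z \<in> {1..n}" "x \<noteq> z" using edge[OF im] unfolding x_def z_def by auto
    define s1 where "s1 = (real_write ''x'' i (\<omega> i) s)\<lparr>drawn := Suc i\<rparr>"
    have s1: "nats s1 = nats s" "reals s1 ''x'' i = \<omega> i" "\<And>a. a \<notin> {''x'', ''y''} \<Longrightarrow> reals s1 a = reals s0 a" "drawn s1 = Suc i"
      "reals s1 ''y'' = reals s ''y''"
      using L(3) unfolding s1_def by (simp_all add: real_write_def)
    have yv: "rval noisy_expr s1 = yy i"
      by (rule yy[OF im]) (use s1 nm i_def in auto)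
    define s2 where "s2 = real_write ''y'' i (yy i) s1"
    have s2: "nats s2 = nats s" "drawn s2 = Suc i" unfolding s2_def using s1 by simp_all
    have r2: "reals s2 ''y'' = (\<lambda>e. if e < Suc i then yy e else 0)"
      unfolding s2_def using s1(5) L(4) by (auto simp: fun_eq_iff less_Suc_eq)
    have r2': "reals s2 a = reals s0 a" if "a \<notin> {''x'', ''y''}" for a
      using that s1(3)[OF that] unfolding s2_def by simp
    define f1 where "f1 = f(x := f x + Suc n)"
    define g1 where "g1 = g(x + f x := i)"
    define s3 where "s3 = nat_write ''f'' x (f x + Suc n) (nat_write ''g'' (x + f x) i s2)"
    define f2 where "f2 = f1(z := f1 z + Suc n)"
    define g2 where "g2 = g1(z + f1 z := i)"
    define s4 where "s4 = nat_write ''f'' z (f1 z + Suc n) (nat_write ''g'' (z + f1 z) i s3)"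
    define s5 where "s5 = nat_write ''i'' 0 (Suc i) s4"
    have xn: "x \<le> n" "z \<le> n" using xz by auto
    note A1 = stacks_add(1,2)[OF L(5) xn(1), folded f1_def] stacks_add(3)[OF L(5) xn(1), where g = g and i = i, folded f1_def g1_def]
    note A2 = stacks_add(1,2)[OF A1(1) xn(2), folded f2_def] stacks_add(3)[OF A1(1) xn(2), where g = g1 and i = i, folded f2_def g2_def]
    have s5: "nats s5 ''f'' = f2" "nats s5 ''g'' = g2" "nats s5 ''i'' 0 = Suc i" "drawn s5 = Suc i" "reals s5 = reals s2"
      "\<And>a. a \<notin> {''f'', ''g'', ''i''} \<Longrightarrow> nats s5 a = nats s0 a"
      using L(2) s2 unfolding s5_def s4_def s3_def f2_def g2_def f1_def g1_def f_def g_def by simp_all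
    have st: "set (stacks (Suc n) f2 g2 v) = {e. e < Suc i \<and> (nats s0 ''src'' e = v \<or> nats s0 ''dst'' e = v)}" if v: "v \<in> {1..n}" for v
    proof -
      have "v \<le> n" using v by simp
      then have "set (stacks (Suc n) f2 g2 v) = (if v = x \<or> v = z then insert i (set (stacks (Suc n) f g v)) else set (stacks (Suc n) f g v))"
        using A1(3)[of v] A2(3)[of v] xz(3) by auto
      also have "\<dots> = {e. e < Suc i \<and> (nats s0 ''src'' e = v \<or> nats s0 ''dst'' e = v)}"
        unfolding L(7)[OF v] x_def z_def by (auto simp: less_Suc_eq)
      finally show ?thesis .
    qed
    have "edges_loaded n s0 yy s5"
      unfolding edges_loaded_def s5(1-5) using s5(6) st A2(1,2) A1(2) L(6) im r2 r2' by auto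
    moreover have "8 * (?m - Suc i) + 1 + R \<le> k - 8" "8 \<le> k"
      using I im unfolding i_def by linarith+
    ultimately have fin: "?I s5 (k - 8)" "8 \<le> k" unfolding s5(3) by auto
    have n2: "nats s2 ''n'' 0 = n" "nats s3 ''n'' 0 = n" using s2 nm unfolding s3_def by simp_all
    have w3: "wpt \<omega> (Set ''i'' (NAdd (Var ''i'') (NConst 1))) ?I s4 (k - 7)"
    proof -
      have "nats s4 ''i'' 0 = i" unfolding s4_def s3_def using s2 i_def by simp
      then have "nat_write ''i'' (nval (NConst 0) s4) (nval (NAdd (Var ''i'') (NConst 1)) s4) s4 = s5" unfolding s5_def by simp
      moreover have "k - 7 - 1 = k - 8" "1 \<le> k - 7" using fin(2) by auto
      ultimately show ?thesis using fin(1) unfolding wpt_NWrite by metis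
    qed
    have w2: "wpt \<omega> (add_edge ''dst'' ;; Set ''i'' (NAdd (Var ''i'') (NConst 1))) ?I s3 (k - 5)"
    proof -
      have "nats s3 ''i'' 0 = i" "nats s3 ''dst'' i = z" "nats s3 ''f'' = f1" unfolding s3_def using s2 nm i_def f1_def f_def by simp_all
      moreover have "k - 5 - 2 = k - 7" "2 \<le> k - 5" using fin(2) by auto
      ultimately show ?thesis using w3 unfolding wpt_Seq by (subst wpt_add_edge[OF n2(2)]) (auto simp: s4_def)
    qed
    have w1: "wpt \<omega> (add_edge ''src'' ;; add_edge ''dst'' ;; Set ''i'' (NAdd (Var ''i'') (NConst 1))) ?I s2 (k - 3)"
    proof -
      have "nats s2 ''i'' 0 = i" "nats s2 ''src'' i = x" "nats s2 ''f'' = f" using s2 nm i_def f_def by simp_all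
      moreover have "k - 3 - 2 = k - 5" "2 \<le> k - 3" using fin(2) by auto
      ultimately show ?thesis using w2 unfolding wpt_Seq by (subst wpt_add_edge[OF n2(1)]) (auto simp: s3_def)
    qed
    have "nats s1 ''i'' 0 = i" using s1 i_def by simp
    then have w0: "wpt \<omega> (RWrite ''y'' (Var ''i'') noisy_expr ;; add_edge ''src'' ;; add_edge ''dst'' ;; Set ''i'' (NAdd (Var ''i'') (NConst 1))) ?I s1 (k - 2)"
      using w1 fin(2) yv unfolding wpt_Seq wpt_RWrite by (simp add: s2_def)
    have "k - 1 - 1 = k - 2" using fin(2) by auto
    then show ?thesis
      using w0 fin(2) L(1) unfolding wpt_Seq[of _ "Sample _ _"] wpt_Sample by (simp add: s1_def i_def)
  qed
qed

text \<open>One more than the integer part of log2 n is at most 2 log2 n, and ln 2 is at least 2 /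
  3.\<close>

lemma power_two_above:
  assumes "2 \<le> n"
  obtains lg where "n < 2 ^ lg" "real lg \<le> 3 * ln (real n)"
proof -
  define lg where "lg = nat \<lfloor>log 2 (real n)\<rfloor> + 1"
  have l0: "0 \<le> log 2 (real n)" using assms by simp
  have "log 2 (real n) < real lg" unfolding lg_def using l0 by linarith
  then have "real n < 2 ^ lg" using assms by (simp add: log_less_iff powr_realpow)
  then have 1: "n < 2 ^ lg" by (metis of_nat_less_iff of_nat_numeral of_nat_power)
  have n2: "ln 2 \<le> ln (real n)" using assms by simp
  have l2: "2 / 3 \<le> ln (2 :: real)" using ln2_ge_two_thirds by simp
  have "real lg \<le> log 2 (real n) + 1" unfolding lg_def using l0 by linarith
  also have "\<dots> = (ln (real n) + ln 2) / ln 2" unfolding log_def using l2 by (simp add: field_simps)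
  also have "\<dots> \<le> (2 * ln (real n)) / ln 2" using n2 l2 by (intro divide_right_mono) auto
  also have "\<dots> \<le> (2 * ln (real n)) / (2 / 3)" using l2 n2 by (intro divide_left_mono) auto
  finally have "real lg \<le> 3 * ln (real n)" by simp
  then show ?thesis using 1 that by blast
qed

text \<open>196 is 8 for loading an edge and 94 for each of its two adjacency entries. The output
  connects all vertices and lies inside Kruskal's tree, hence equals it.\<close>

lemma opk_program_correct:
  assumes cg: "connected_graph n E" and el: "edge_listing es E"
    and X: "\<forall>i < length es. \<omega> i = X (undirected (es ! i))" and lg: "n < 2 ^ lg"
  shows "\<exists>t s. exec \<omega> opk_program (input_store n es w \<epsilon> \<delta>) t s \<and> t \<le> 196 * card E + (132 * lg + 20) * n + 5 \<and>
    (inj_on (noisy_weight n \<epsilon> \<delta> w X) E \<longrightarrow> output_tree es s = opk_tree n E \<epsilon> \<delta> w X)"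
proof -
  define m where "m = length es"
  define wt where "wt = noisy_weight n \<epsilon> \<delta> w X"
  define s0 where "s0 = input_store n es w \<epsilon> \<delta>"
  define src where "src = nats s0 ''src''"
  define dst where "dst = nats s0 ''dst''"
  define yy where "yy e = wt (undirected (es ! e))" for e
  \<comment> \<open>If weights tie, the cut property is made trivial by taking all positions, so
    that halting and the step bound still follow from the same search.\<close>
  define K where "K = (if inj_on wt E then {e. undirected (es ! e) \<in> opk_tree n E \<epsilon> \<delta> w X} else UNIV)"
  define y where "y e = (if e < m then yy e else 0)" for e
  have n1: "1 \<le> n" using cg unfolding connected_graph_def by simp
  have dist: "distinct (map undirected es)" and setE: "set (map undirected es) = E" using el unfolding edge_listing_def by auto
  have cE: "card E = m" using distinct_card[OF dist] setE m_def by simp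
  have s0n: "nats s0 ''n'' 0 = n" "nats s0 ''m'' 0 = m" unfolding s0_def input_store_def m_def by simp_all
  have und: "undirected (es ! e) = {src e, dst e}" if "e < m" for e
    using that unfolding src_def dst_def s0_def input_store_def undirected_def m_def by simp
  have inE: "{src e, dst e} \<in> E" if "e < m" for e
    using that und[OF that] setE unfolding m_def by (metis length_map nth_map nth_mem)
  have idx: "\<exists>e<m. {src e, dst e} = f" if f: "f \<in> E" for f
  proof -
    obtain e where "e < length es" "undirected (es ! e) = f" using f setE by (metis in_set_conv_nth length_map nth_map)
    then show ?thesis using und m_def by metis
  qed
  have edgeE: "src e \<in> {1..n} \<and> dst e \<in> {1..n} \<and> src e \<noteq> dst e" if "e < m" for e
    using inE[OF that] cg unfolding connected_graph_def by (auto simp: card_2_iff doubleton_eq_iff)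
  have img: "(\<lambda>e. {src e, dst e}) ` {..<m} = E"
  proof
    show "(\<lambda>e. {src e, dst e}) ` {..<m} \<subseteq> E" using inE by auto
    show "E \<subseteq> (\<lambda>e. {src e, dst e}) ` {..<m}"
    proof
      fix f assume "f \<in> E"
      then obtain e where "e < m" "{src e, dst e} = f" using idx by blast
      then show "f \<in> (\<lambda>e. {src e, dst e}) ` {..<m}" by blast
    qed
  qed
  interpret prim n m lg src dst y K
  proof
    show "n < 2 ^ lg" by (rule lg)
    show "src e \<in> {1..n} \<and> dst e \<in> {1..n} \<and> src e \<noteq> dst e" if "e < m" for e by (rule edgeE[OF that])
    show "connects {1..n} ((\<lambda>e. {src e, dst e}) ` {..<m})" unfolding img using cg unfolding connected_graph_def by blast
    fix e S
    assume e: "e < m" "(src e \<in> S) \<noteq> (dst e \<in> S)"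
      and min: "\<And>f. f < m \<Longrightarrow> (src f \<in> S) \<noteq> (dst f \<in> S) \<Longrightarrow> y e \<le> y f"
    show "e \<in> K"
    proof (cases "inj_on wt E")
      case True
      obtain a b where ab: "{src e, dst e} = {a, b}" "a \<in> S" "b \<notin> S" using e(2) by (metis insert_commute)
      have ye: "y f = wt {src f, dst f}" if "f < m" for f using that und[OF that] unfolding y_def yy_def by simp
      have "{a, b} \<in> fst (kruskal_state E wt (n - 1))"
      proof (rule kruskal_cut_property[OF cg True _ ab(2,3)])
        show "{a, b} \<in> E" using inE[OF e(1)] ab by simp
        fix x z assume xz: "{x, z} \<in> E" "x \<in> S" "z \<notin> S"
        obtain f where f: "f < m" "{src f, dst f} = {x, z}" using idx[OF xz(1)] by blast
        then have "(src f \<in> S) \<noteq> (dst f \<in> S)" using xz by (auto simp: doubleton_eq_iff)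
        then have "y e \<le> y f" using min f by blast
        then show "wt {a, b} \<le> wt {x, z}" using ye[OF e(1)] ye[OF f(1)] ab f by simp
      qed
      then show ?thesis using True ab und[OF e(1)] unfolding K_def opk_tree_def wt_def by simp
    qed (simp add: K_def)
  qed
  have f0: "nats s0 a = (\<lambda>_. 0)"
    if "a \<in> {''f'', ''g'', ''i'', ''p'', ''d'', ''k'', ''c'', ''a'', ''q'', ''out'', ''s''}" for a
    using that unfolding s0_def input_store_def by (auto simp: fun_eq_iff)
  have yy: "rval noisy_expr s = yy e"
    if "e < nats s0 ''m'' 0" "nats s ''i'' 0 = e" "nats s ''n'' 0 = n"
      "\<And>a. a \<notin> {''x'', ''y''} \<Longrightarrow> reals s a = reals s0 a" "reals s ''x'' e = \<omega> e" for s e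
  proof -
    have e: "e < length es" using that(1) s0n m_def by simp
    have "reals s ''eps'' 0 = \<epsilon>" "reals s ''delta'' 0 = \<delta>" "reals s ''w'' e = w (undirected (es ! e))"
      using that(4) e unfolding s0_def input_store_def by simp_all
    then show ?thesis using that X e
      by (simp add: noisy_expr_def step_expr_def root_rho_def log_delta_def yy_def wt_def noisy_weight_def step_eps_def
        priv_rho_def power2_eq_square)
  qed
  have start: "edges_loaded n s0 yy s0"
    unfolding edges_loaded_def using f0 by (simp add: stacks_def s0_def input_store_def)
  have edge0: "nats s0 ''src'' e \<in> {1..n} \<and> nats s0 ''dst'' e \<in> {1..n} \<and> nats s0 ''src'' e \<noteq> nats s0 ''dst'' e"
    if "e < nats s0 ''m'' 0" for e using edgeE[of e] that s0n unfolding src_def dst_def by simp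
  have i0: "nats s0 ''i'' 0 = 0" using f0 by simp
  define R where "R = 188 * m + (132 * lg + 20) * n + 4"
  let ?Q = "\<lambda>s k. main_inv s \<and> n \<le> nats s ''v'' 0"
  have "wpt \<omega> opk_program ?Q s0 (8 * nats s0 ''m'' 0 + 1 + R)"
    unfolding opk_program_def wpt_Seq[of _ init_loop]
  proof (rule wpt_mono[OF wpt_init_loop[where R = R, OF s0n(1) edge0 yy start i0]])
    fix s k
    assume J: "edges_loaded n s0 yy s \<and> nats s ''i'' 0 = nats s0 ''m'' 0 \<and> R \<le> k"
    then have im: "nats s ''i'' 0 = m" using s0n by simp
    have L: "\<And>a. a \<notin> {''f'', ''g'', ''i''} \<Longrightarrow> nats s a = nats s0 a" "reals s ''y'' = y"
      "\<forall>v. Suc n dvd nats s ''f'' v" "(\<Sum>v\<le>n. nats s ''f'' v div Suc n) = 2 * m"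
      "\<And>v. v \<in> {1..n} \<Longrightarrow> set (stacks (Suc n) (nats s ''f'') (nats s ''g'') v) = {e. e < m \<and> (src e = v \<or> dst e = v)}"
      using J im unfolding edges_loaded_def y_def[abs_def] src_def dst_def by auto
    define s1 where "s1 = nat_write ''s'' 1 2 (nat_write ''v'' 0 1 (nat_write ''u'' 0 1 s))"
    have "main_inv s1 \<and> potential n (front s1) s1 = 0"
    proof (intro conjI)
      have a: "nats s1 ''n'' 0 = n" "nats s1 ''src'' = src" "nats s1 ''dst'' = dst" "reals s1 ''y'' = y"
          "nats s1 ''s'' = (\<lambda>_. 0)(1 := 2)" "nats s1 ''u'' 0 = 1" "nats s1 ''v'' 0 = 1"
          "\<forall>v. Suc n dvd nats s1 ''f'' v"
        using L f0[of "''s''"] s0n unfolding s1_def src_def dst_def by simp_all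
      have b: "set (stacks (Suc n) (nats s1 ''f'') (nats s1 ''g'') v) = {e. e < m \<and> (src e = v \<or> dst e = v)}" if "v \<in> {1..n}" for v
        using L(5)[OF that] unfolding s1_def by simp
      have c: "nats s1 a = (\<lambda>_. 0)" if "a \<in> {''p'', ''d'', ''k'', ''c'', ''a'', ''q'', ''out''}" for a
      proof -
        have "nats s1 a = nats s a" unfolding s1_def using that by auto
        also have "\<dots> = nats s0 a" by (rule L(1)) (use that in auto)
        also have "\<dots> = (\<lambda>_. 0)" by (rule f0) (use that in auto)
        finally show ?thesis .
      qed
      show "main_inv s1" by (rule main_inv_init[OF a(1-7) n1 a(8) b c])
      show "potential n (front s1) s1 = 0" by (rule main_inv_init[OF a(1-7) n1 a(8) b c])
    qed
    moreover have "edge_credits s1 = 188 * m" unfolding edge_credits_def using L(4) by (simp add: s1_def)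
    moreover have "rounds s1 \<le> (132 * lg + 20) * n" unfolding rounds_def by (intro mult_le_mono) auto
    moreover have "3 \<le> k" using J R_def by simp
    ultimately have "wpt \<omega> prim_loop ?Q s1 (k - 3)"
      using J unfolding R_def by (intro wpt_prim_loop[where R = 0]) auto
    then show "wpt \<omega> (Set ''u'' (NConst 1) ;; Set ''v'' (NConst 1) ;; NWrite ''s'' (NConst 1) (NConst 2) ;; prim_loop) ?Q s k"
    proof -
      obtain k' where "k = k' + 3" using \<open>3 \<le> k\<close> by (metis le_Suc_ex add.commute)
      then show ?thesis using \<open>wpt \<omega> prim_loop ?Q s1 (k - 3)\<close> unfolding wpt_simps by (simp add: s1_def numeral_3_eq_3)
    qed
  qed
  then obtain t s where ex: "exec \<omega> opk_program s0 t s" "t \<le> 8 * m + 1 + R" and fin: "main_inv s" "n \<le> nats s ''v'' 0"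
    unfolding wpt_def s0n by blast
  note F = main_inv_final[OF fin]
  have out: "output_tree es s = (\<lambda>e. {src e, dst e}) ` {e. nats s ''out'' e \<noteq> 0}"
  proof -
    have "output_tree es s = (\<lambda>e. undirected (es ! e)) ` {e. nats s ''out'' e \<noteq> 0}"
      using F(3) unfolding output_tree_def m_def by auto
    also have "\<dots> = (\<lambda>e. {src e, dst e}) ` {e. nats s ''out'' e \<noteq> 0}"
      using F(3) und by (intro image_cong) auto
    finally show ?thesis .
  qed
  have "output_tree es s = opk_tree n E \<epsilon> \<delta> w X" if inj: "inj_on wt E"
  proof (rule spanning_tree_subset_eq)
    show "connects {1..n} (output_tree es s)" unfolding out by (rule F(1))
    show "output_tree es s \<subseteq> opk_tree n E \<epsilon> \<delta> w X"
      using F(2) inj unfolding K_def output_tree_def by auto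
    show "spanning_tree n E (opk_tree n E \<epsilon> \<delta> w X)" unfolding opk_tree_def by (rule spanning_tree_kruskal[OF cg])
    show "E \<subseteq> {e. e \<subseteq> {1..n} \<and> card e = 2}" using cg unfolding connected_graph_def by blast
  qed
  then show ?thesis
    using ex unfolding s0_def cE R_def wt_def by (intro exI[of _ t] exI[of _ s]) auto
qed

lemma implements_opk_program:
  "implements_opk opk_program (\<lambda>n m. 1000 * (real m + real n * ln (real n)))"
  unfolding implements_opk_def
proof (intro allI impI)
  fix n E w \<epsilon> \<delta> es X and \<omega> :: "nat \<Rightarrow> real"
  assume a: "connected_graph n E" "edge_listing es E" "\<forall>i < length es. \<omega> i = X (undirected (es ! i))"
  show "\<exists>t s. exec \<omega> opk_program (input_store n es w \<epsilon> \<delta>) t s \<and>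
      (2 \<le> n \<longrightarrow> real t \<le> 1000 * (real (card E) + real n * ln (real n))) \<and>
      (inj_on (noisy_weight n \<epsilon> \<delta> w X) E \<longrightarrow> output_tree es s = opk_tree n E \<epsilon> \<delta> w X)"
  proof (cases "2 \<le> n")
    case False
    \<comment> \<open>For n < 2 no step bound is claimed, so any exponent above log2 n will
      do.\<close>
    have "n < 2 ^ n" by (rule less_exp)
    then show ?thesis using opk_program_correct[OF a(1-3), of n w \<epsilon> \<delta>] False by blast
  next
    case True
    obtain lg where lg: "n < 2 ^ lg" "real lg \<le> 3 * ln (real n)" using power_two_above[OF True] .
    obtain t s where ts: "exec \<omega> opk_program (input_store n es w \<epsilon> \<delta>) t s" "t \<le> 196 * card E + (132 * lg + 20) * n + 5"
      "inj_on (noisy_weight n \<epsilon> \<delta> w X) E \<longrightarrow> output_tree es s = opk_tree n E \<epsilon> \<delta> w X"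
      using opk_program_correct[OF a(1-3) lg(1), of w \<epsilon> \<delta>] by blast
    have ln1: "2 / 3 \<le> ln (real n)"
    proof -
      have "ln 2 \<le> ln (real n)" using True by simp
      then show ?thesis using ln2_ge_two_thirds by linarith
    qed
    have "real t \<le> real (196 * card E + (132 * lg + 20) * n + 5)" using ts(2) of_nat_le_iff by blast
    also have "\<dots> = 196 * real (card E) + (132 * real lg + 20) * real n + 5" by simp
    also have "\<dots> \<le> 196 * real (card E) + (132 * real lg + 23) * real n"
      using True by (simp add: algebra_simps)
    \<comment> \<open>23 is at most 35 ln n because ln n is at least 2 / 3; the resulting factor 3 *
      132 + 35 stays below 1000.\<close>
    also have "\<dots> \<le> 196 * real (card E) + (132 * (3 * ln (real n)) + 35 * ln (real n)) * real n"
      using lg(2) ln1 by (intro add_left_mono mult_right_mono) auto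
    also have "\<dots> \<le> 1000 * (real (card E) + real n * ln (real n))"
      using ln1 by (simp add: algebra_simps)
    finally show ?thesis using ts by blast
  qed
qed

theorem theorem3p3:
  shows
    \<comment> \<open>running time\<close>
    "(\<exists>P C. implements_opk P (\<lambda>n m. C * (real m + real n * ln (real n)))) \<and>
    \<comment> \<open>spanning tree output and privacy\<close>
     (\<forall>n E \<epsilon> \<delta>. connected_graph n E \<longrightarrow> \<epsilon> > 0 \<longrightarrow> \<delta> > 0 \<longrightarrow>
        (\<forall>w. prob_space (opk n E \<epsilon> \<delta> w) \<and> (AE T in opk n E \<epsilon> \<delta> w. spanning_tree n E T)) \<and>
        differentially_private n E \<epsilon> \<delta> (opk n E \<epsilon> \<delta>)) \<and>
    \<comment> \<open>utility: one constant for all graphs and all parameters with \<open>\<epsilon> \<le> K * ln (1 / \<delta>)\<close>\<close>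
     (\<forall>K > 0. \<exists>C. \<forall>n E w \<epsilon> \<delta> T.
        connected_graph n E \<longrightarrow> \<epsilon> > 0 \<longrightarrow> \<delta> > 0 \<longrightarrow> \<delta> < 1 \<longrightarrow> \<epsilon> \<le> K * ln (1 / \<delta>) \<longrightarrow>
        minimum_spanning_tree n E w T \<longrightarrow>
        \<bar>(\<integral>S. (\<Sum>e\<in>S. w e) \<partial>opk n E \<epsilon> \<delta> w) - (\<Sum>e\<in>T. w e)\<bar>
          \<le> C * (1 / \<epsilon> * real n powr (3 / 2) * ln (real n) * sqrt (ln (1 / \<delta>))))"
proof (intro conjI allI impI)
  show "\<exists>P C. implements_opk P (\<lambda>n m. C * (real m + real n * ln (real n)))"
    using implements_opk_program by blast
  fix n E \<epsilon> \<delta> assume con: "connected_graph n E" and pos: "(0::real) < \<epsilon>" "(0::real) < \<delta>"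
  show "prob_space (opk n E \<epsilon> \<delta> w)" "AE T in opk n E \<epsilon> \<delta> w. spanning_tree n E T" for w
    by (rule opk_spanning_tree[OF con])+
  show "differentially_private n E \<epsilon> \<delta> (opk n E \<epsilon> \<delta>)" by (rule opk_private[OF con pos])
next
  fix K :: real assume K: "0 < K"
  show "\<exists>C. \<forall>n E w \<epsilon> \<delta> T. connected_graph n E \<longrightarrow> \<epsilon> > 0 \<longrightarrow> \<delta> > 0 \<longrightarrow> \<delta> < 1 \<longrightarrow> \<epsilon> \<le> K * ln (1 / \<delta>) \<longrightarrow>
      minimum_spanning_tree n E w T \<longrightarrow>
      \<bar>(\<integral>S. (\<Sum>e\<in>S. w e) \<partial>opk n E \<epsilon> \<delta> w) - (\<Sum>e\<in>T. w e)\<bar>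
        \<le> C * (1 / \<epsilon> * real n powr (3 / 2) * ln (real n) * sqrt (ln (1 / \<delta>)))"
    using opk_utility[OF _ K] by blast
qed

end
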